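(* Let $X\in 2^\omega$ be $\Pi^1_1$-ML-random but not $\Pi^1_1$-random. Then there is a $\Pi^1_1$ set $A\subseteq\omega$ which is not $\Delta^1_1$ such that $X\ge_{hT}A$.
   Context: Work in $2^\omega$ with uniform measure $\lambda$. A $\Pi^1_1$ open set is $[W]=\bigcup_{\sigma\in W}[\sigma]$ for a $\Pi^1_1$ set $W\subseteq 2^{<\omega}$; a sequence $(U_n)$ of such sets is uniformly $\Pi^1_1$ if the corresponding sets $W_n$ are uniformly $\Pi^1_1$. $X$ is $\Pi^1_1$-ML-random if $X\notin\bigcap_n U_n$ for every uniformly $\Pi^1_1$ sequence of open sets $(U_n)$ with $\lambda(U_n)\le 2^{-n}$ for all $n$. $X$ is $\Pi^1_1$-random if $X$ lies in no $\Pi^1_1$ class of measure $0$. Higher Turing reducibility: $X\ge_{hT}A$ (for $A\subseteq\omega$ identified with its characteristic sequence) means there is a $\Pi^1_1$ set $\Phi\subseteq 2^{<\omega}\times 2^{<\omega}$ such that the set $\{\tau:\exists\sigma\prec X\,(\sigma,\tau)\in\Phi\}$ is linearly ordered by the prefix relation and its union equals $A$ (consistency is only required along $X$). *)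

theory Defs
  imports "HOL-Probability.Probability" "HOL-Library.Nat_Bijection" "HOL-Library.Sublist"
begin

section \<open>Arithmetical formulas\<close>

type_synonym cantor = "nat \<Rightarrow> bool"

datatype arith_term =
    Var nat
  | Zero
  | Succ arith_term
  | Plus arith_term arith_term
  | Times arith_term arith_term

text \<open>
  Formulas of second-order arithmetic without set quantifiers. Number variables and set variables
  are separate de Bruijn indices; \<open>Mem t i\<close> says that \<open>t\<close> belongs to the \<open>i\<close>-th set variable.
\<close>

datatype arith_form =
    Eq arith_term arith_term
  | Mem arith_term nat
  | Neg arith_form
  | Conj arith_form arith_form
  | All arith_form

primrec eval_term :: "(nat \<Rightarrow> nat) \<Rightarrow> arith_term \<Rightarrow> nat" where
  "eval_term e (Var i) = e i"
| "eval_term e Zero = 0"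
| "eval_term e (Succ t) = Suc (eval_term e t)"
| "eval_term e (Plus s t) = eval_term e s + eval_term e t"
| "eval_term e (Times s t) = eval_term e s * eval_term e t"

primrec sat :: "(nat \<Rightarrow> nat) \<Rightarrow> (nat \<Rightarrow> cantor) \<Rightarrow> arith_form \<Rightarrow> bool" where
  "sat e E (Eq s t) \<longleftrightarrow> eval_term e s = eval_term e t"
| "sat e E (Mem t i) \<longleftrightarrow> E i (eval_term e t)"
| "sat e E (Neg \<phi>) \<longleftrightarrow> \<not> sat e E \<phi>"
| "sat e E (Conj \<phi> \<psi>) \<longleftrightarrow> sat e E \<phi> \<and> sat e E \<psi>"
| "sat e E (All \<phi>) \<longleftrightarrow> (\<forall>n. sat (case_nat n e) E \<phi>)"

section \<open>Lightface \<open>\<Pi>\<^sup>1\<^sub>1\<close> sets and classes\<close>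

text \<open>
  A \<open>\<Pi>\<^sup>1\<^sub>1\<close> formula is a universal set quantifier, binding set variable 0, in front of an arithmetical
  formula. Variables other than the quantified one and the argument are interpreted by 0 and by the
  empty set; both are definable, so no parameters enter.
\<close>

definition Pi11_set :: "nat set \<Rightarrow> bool" where
  "Pi11_set A \<longleftrightarrow>
     (\<exists>\<phi>. A = {n. \<forall>Y. sat (case_nat n (\<lambda>_. 0)) (case_nat Y (\<lambda>_ _. False)) \<phi>})"

definition Delta11_set :: "nat set \<Rightarrow> bool" where
  "Delta11_set A \<longleftrightarrow> Pi11_set A \<and> Pi11_set (- A)"

definition Pi11_class :: "cantor set \<Rightarrow> bool" where
  "Pi11_class C \<longleftrightarrow>
     (\<exists>\<phi>. C = {X. \<forall>Y. sat (\<lambda>_. 0) (case_nat Y (case_nat X (\<lambda>_ _. False))) \<phi>})"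

text \<open>
  Sets of strings, of pairs of strings, and sequences of sets of strings are \<open>\<Pi>\<^sup>1\<^sub>1\<close> if their sets of
  codes are, under the computable codings \<^const>\<open>list_encode\<close> and \<^const>\<open>prod_encode\<close>.
\<close>

definition string_code :: "bool list \<Rightarrow> nat" where
  "string_code \<sigma> = list_encode (map of_bool \<sigma>)"

definition Pi11_string_pairs :: "(bool list \<times> bool list) set \<Rightarrow> bool" where
  "Pi11_string_pairs \<Phi> \<longleftrightarrow>
     Pi11_set {prod_encode (string_code \<sigma>, string_code \<tau>) | \<sigma> \<tau>. (\<sigma>, \<tau>) \<in> \<Phi>}"

definition uniformly_Pi11 :: "(nat \<Rightarrow> bool list set) \<Rightarrow> bool" where
  "uniformly_Pi11 W \<longleftrightarrow> Pi11_set {prod_encode (n, string_code \<sigma>) | n \<sigma>. \<sigma> \<in> W n}"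

section \<open>Higher randomness\<close>

definition initial_segment :: "bool list \<Rightarrow> cantor \<Rightarrow> bool" where
  "initial_segment \<sigma> X \<longleftrightarrow> (\<forall>i < length \<sigma>. \<sigma> ! i = X i)"

definition cylinder :: "bool list \<Rightarrow> cantor set" where
  "cylinder \<sigma> = {X. initial_segment \<sigma> X}"

definition open_of :: "bool list set \<Rightarrow> cantor set" where
  "open_of W = (\<Union>\<sigma>\<in>W. cylinder \<sigma>)"

definition cantor_measure :: "cantor measure" where
  "cantor_measure = PiM UNIV (\<lambda>_. measure_pmf (bernoulli_pmf (1/2)))"

lemma open_of_in_sets: "open_of W \<in> sets cantor_measure"
proof -
  have *: "cylinder \<sigma> \<in> sets cantor_measure" for \<sigma>
  proof -
    have "Measurable.pred cantor_measure (\<lambda>X. \<forall>i\<in>{..<length \<sigma>}. \<sigma> ! i = X i)"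
      unfolding cantor_measure_def by measurable
    moreover have "space cantor_measure = UNIV"
      by (simp add: cantor_measure_def space_PiM)
    ultimately show ?thesis
      by (simp add: pred_def cylinder_def initial_segment_def Ball_def)
  qed
  then show ?thesis
    unfolding open_of_def by (intro sets.countable_UN') auto
qed

definition Pi11_ML_random :: "cantor \<Rightarrow> bool" where
  "Pi11_ML_random X \<longleftrightarrow>
     (\<forall>W. uniformly_Pi11 W \<and> (\<forall>n. measure cantor_measure (open_of (W n)) \<le> (1/2) ^ n) \<longrightarrow>
        X \<notin> (\<Inter>n. open_of (W n)))"

text \<open>
  A \<open>\<Pi>\<^sup>1\<^sub>1\<close> class need not be Borel, and \<^const>\<open>measure\<close> is 0 by convention outside the
  \<open>\<sigma>\<close>-algebra, so measure 0 refers to the completion of the uniform measure.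
\<close>

definition Pi11_random :: "cantor \<Rightarrow> bool" where
  "Pi11_random X \<longleftrightarrow>
     \<not> (\<exists>C. Pi11_class C \<and> C \<in> null_sets (completion cantor_measure) \<and> X \<in> C)"

section \<open>Higher Turing reducibility\<close>

text \<open>Strings and sequences as graphs of functions, so that the union of a set of strings makes sense.\<close>

definition string_graph :: "bool list \<Rightarrow> (nat \<times> bool) set" where
  "string_graph \<tau> = {(i, \<tau> ! i) | i. i < length \<tau>}"

definition seq_graph :: "cantor \<Rightarrow> (nat \<times> bool) set" where
  "seq_graph X = {(i, X i) | i. True}"

definition hT_output :: "(bool list \<times> bool list) set \<Rightarrow> cantor \<Rightarrow> bool list set" where
  "hT_output \<Phi> X = {\<tau>. \<exists>\<sigma>. initial_segment \<sigma> X \<and> (\<sigma>, \<tau>) \<in> \<Phi>}"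

definition hT_computes :: "cantor \<Rightarrow> nat set \<Rightarrow> bool" where
  "hT_computes X A \<longleftrightarrow>
     (\<exists>\<Phi>. Pi11_string_pairs \<Phi> \<and>
        (\<forall>\<tau> \<in> hT_output \<Phi> X. \<forall>\<tau>' \<in> hT_output \<Phi> X. prefix \<tau> \<tau>' \<or> prefix \<tau>' \<tau>) \<and>
        (\<Union>\<tau> \<in> hT_output \<Phi> X. string_graph \<tau>) = seq_graph (\<lambda>n. n \<in> A))"

end

theory Submission
  imports Defs
begin

text \<open>
  A class of measure 0 containing \<open>X\<close> consists of the \<open>Y\<close> for which a tree uniformly arithmetical in \<open>Y\<close>
  is well-founded. For each well-founded tree \<open>b\<close> in a universal \<open>\<Pi>\<^sup>1\<^sub>1\<close> family, the subclass of those
  \<open>Y\<close> whose rank is at most that of \<open>b\<close> has open covers of small measure, uniformly in \<open>b\<close>, so by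
  \<open>\<Pi>\<^sup>1\<^sub>1\<close>-ML-randomness the rank of \<open>X\<close> exceeds that of every \<open>b\<close>. Passing to a minimal node \<open>s\<close> with
  this property, each child of \<open>s\<close> has rank bounded by some \<open>b\<close>.

  Let \<open>D(n,b)\<close> be the class on which the first \<open>n\<close> children of \<open>s\<close> have rank at most that of \<open>b\<close>, and
  \<open>Q(b)\<close> the intersection of the \<open>D(n,b)\<close>. The set \<open>A\<close> contains, for each well-founded \<open>b\<close>, exactly one
  number \<open>i = (b,k)\<close>, chosen such that \<open>D(i,b) - Q(b)\<close> has measure about \<open>2\<^sup>-\<^sup>b\<close>. Its projection is
  the universal set, so \<open>A\<close> is not \<open>\<Delta>\<^sup>1\<^sub>1\<close>. To decide \<open>i = (b,k)\<close>, \<open>X\<close> searches for a well-founded \<open>c\<close>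
  such that \<open>X\<close> lies in a tight open cover of \<open>D(i,c)\<close>, and answers no if \<open>b\<close> does not have rank at most
  that of \<open>c\<close>. When this is wrong, \<open>X\<close>, which is outside \<open>Q(b)\<close>, lies in an open set of measure about
  \<open>2\<^sup>-\<^sup>b\<close>; these sets form a Solovay test, so there are only finitely many errors.
\<close>

section \<open>Definability\<close>

text \<open>The ranks of the well-founded \<open>num_tree b\<close> have supremum omega_1^CK. Each
  child of \<open>s\<close> lies below it, but no single \<open>b\<close> bounds them all, so
  \<open>X\<close> knows a cofinal sequence of stages. Ordinals are avoided: trees are compared by
  \<open>rank_le\<close>, and \<open>Univ_no_max\<close> stands in for Sigma^1_1 bounding. If
  \<open>b\<close> enters \<open>Univ\<close> at the stage given by its rank, then the stage
  \<open>c\<close> reached by the first children decides \<open>Univ b\<close> unless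
  \<open>b\<close> enters later. With a number of children fixed in advance for each
  \<open>b\<close>, such errors could be too likely. The coordinate \<open>k\<close> therefore
  postpones the question until \<open>D(i,b)\<close> is hardly larger than \<open>Q(b)\<close>;
  taking the least \<open>k\<close> leaves one question per \<open>b\<close> and makes every other
  \<open>k\<close> recognizably wrong once \<open>b\<close> is in \<open>Univ\<close>. Membership in
  \<open>D(i,c)\<close> is not an open condition, and \<open>X\<close> can act only on open ones.
  Covers replace the classes, and as any \<open>c\<close> may be the one found, their errors are
  summed over all \<open>c\<close>; this is the origin of the exponent \<open>n + c + 1\<close>.
  Finally, the choice of \<open>k\<close> compares measures of covers and must be both confirmed and
  refuted in a Pi^1_1 way. This forces covers that are Delta^1_1 uniformly in \<open>b\<close>,
  hence canonical ones.\<close>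

text \<open>
  Predicates depend on a number environment \<open>e\<close> and a set environment \<open>E\<close>. In the closure rules a bound
  variable becomes index 0 and the remaining environment is shifted, so that they apply by unification.
\<close>

definition Arith :: "((nat \<Rightarrow> nat) \<Rightarrow> (nat \<Rightarrow> cantor) \<Rightarrow> bool) \<Rightarrow> bool" where
  "Arith P \<longleftrightarrow> (\<exists>\<phi>. \<forall>e E. P e E \<longleftrightarrow> sat e E \<phi>)"

definition Pi_pred :: "((nat \<Rightarrow> nat) \<Rightarrow> (nat \<Rightarrow> cantor) \<Rightarrow> bool) \<Rightarrow> bool" where
  "Pi_pred P \<longleftrightarrow> (\<exists>Q. Arith Q \<and> (\<forall>e E. P e E \<longleftrightarrow> (\<forall>Y. Q e (case_nat Y E))))"

definition Delta_pred :: "((nat \<Rightarrow> nat) \<Rightarrow> (nat \<Rightarrow> cantor) \<Rightarrow> bool) \<Rightarrow> bool" where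
  "Delta_pred P \<longleftrightarrow> Pi_pred P \<and> Pi_pred (\<lambda>e E. \<not> P e E)"

definition Delta_fun :: "((nat \<Rightarrow> nat) \<Rightarrow> (nat \<Rightarrow> cantor) \<Rightarrow> nat) \<Rightarrow> bool" where
  "Delta_fun f \<longleftrightarrow> Delta_pred (\<lambda>e E. e 0 = f (\<lambda>i. e (Suc i)) E)"

lemma case_nat_eta [simp]: "case_nat (e 0) (\<lambda>i. e (Suc i)) = e"
  by (auto split: nat.split)

subsection \<open>Arithmetical predicates\<close>

lemma Arith_conj: "Arith P \<Longrightarrow> Arith Q \<Longrightarrow> Arith (\<lambda>e E. P e E \<and> Q e E)"
  unfolding Arith_def by (metis sat.simps(4))

lemma Arith_not: "Arith P \<Longrightarrow> Arith (\<lambda>e E. \<not> P e E)"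
  unfolding Arith_def by (metis sat.simps(3))

lemma Arith_disj: "Arith P \<Longrightarrow> Arith Q \<Longrightarrow> Arith (\<lambda>e E. P e E \<or> Q e E)"
  using Arith_not[OF Arith_conj[OF Arith_not Arith_not], of P Q] by simp

lemma Arith_all: "Arith (\<lambda>e E. P (e 0) (\<lambda>i. e (Suc i)) E) \<Longrightarrow> Arith (\<lambda>e E. \<forall>n. P n e E)"
proof -
  assume "Arith (\<lambda>e E. P (e 0) (\<lambda>i. e (Suc i)) E)"
  then obtain \<phi> where \<phi>: "\<And>e E. P (e 0) (\<lambda>i. e (Suc i)) E \<longleftrightarrow> sat e E \<phi>"
    unfolding Arith_def by auto
  have "P n e E \<longleftrightarrow> sat (case_nat n e) E \<phi>" for n e E
    using \<phi>[of "case_nat n e" E] by simp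
  then have "\<forall>e E. (\<forall>n. P n e E) \<longleftrightarrow> sat e E (All \<phi>)" by simp
  then show ?thesis unfolding Arith_def by blast
qed

lemma Arith_ex: "Arith (\<lambda>e E. P (e 0) (\<lambda>i. e (Suc i)) E) \<Longrightarrow> Arith (\<lambda>e E. \<exists>n. P n e E)"
  using Arith_not[OF Arith_all[of "\<lambda>n e E. \<not> P n e E", OF Arith_not]] by simp

lemma Arith_eq: "Arith (\<lambda>e E. eval_term e s = eval_term e t)"
  unfolding Arith_def by (metis sat.simps(1))

lemma Arith_mem_var: "Arith (\<lambda>e E. E i (e j))"
  unfolding Arith_def by (rule exI[of _ "Mem (Var j) i"]) simp

section \<open>Renaming and substitution in arithmetical predicates\<close>

primrec ren_term :: "(nat \<Rightarrow> nat) \<Rightarrow> arith_term \<Rightarrow> arith_term" where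
  "ren_term r (Var i) = Var (r i)"
| "ren_term r Zero = Zero"
| "ren_term r (Succ t) = Succ (ren_term r t)"
| "ren_term r (Plus s t) = Plus (ren_term r s) (ren_term r t)"
| "ren_term r (Times s t) = Times (ren_term r s) (ren_term r t)"

lemma eval_ren_term: "eval_term e (ren_term r t) = eval_term (\<lambda>i. e (r i)) t"
  by (induction t) auto

lemma case_nat_comp_ren: "case_nat n (\<lambda>i. e (r i)) = (\<lambda>i. (case_nat n e) (case_nat 0 (\<lambda>j. Suc (r j)) i))"
  by (auto split: nat.split)

lemma Arith_ren_num: "Arith P \<Longrightarrow> Arith (\<lambda>e E. P (\<lambda>i. e (r i)) E)"
proof -
  have "\<exists>\<psi>. \<forall>e E. sat (\<lambda>i. e (r i)) E \<phi> \<longleftrightarrow> sat e E \<psi>" for \<phi>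
  proof (induction \<phi> arbitrary: r)
    case (Eq s t)
    show ?case by (rule exI[of _ "Eq (ren_term r s) (ren_term r t)"]) (simp add: eval_ren_term)
  next
    case (Mem t i)
    show ?case by (rule exI[of _ "Mem (ren_term r t) i"]) (simp add: eval_ren_term)
  next
    case (Neg \<phi>)
    then obtain \<psi> where "\<forall>e E. sat (\<lambda>i. e (r i)) E \<phi> \<longleftrightarrow> sat e E \<psi>" by metis
    then show ?case by (intro exI[of _ "Neg \<psi>"]) simp
  next
    case (Conj \<phi>1 \<phi>2)
    obtain \<psi>1 where "\<forall>e E. sat (\<lambda>i. e (r i)) E \<phi>1 \<longleftrightarrow> sat e E \<psi>1" using Conj by metis
    moreover obtain \<psi>2 where "\<forall>e E. sat (\<lambda>i. e (r i)) E \<phi>2 \<longleftrightarrow> sat e E \<psi>2" using Conj by metis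
    ultimately show ?case by (intro exI[of _ "Conj \<psi>1 \<psi>2"]) simp
  next
    case (All \<phi>)
    obtain \<psi> where *: "\<forall>e E. sat (\<lambda>i. e (case_nat 0 (\<lambda>j. Suc (r j)) i)) E \<phi> \<longleftrightarrow> sat e E \<psi>"
      using All by metis
    have "sat (case_nat n (\<lambda>i. e (r i))) E \<phi> \<longleftrightarrow> sat (case_nat n e) E \<psi>" for n e E
      unfolding case_nat_comp_ren[of n e r] using * by blast
    then have "\<forall>e E. sat (\<lambda>i. e (r i)) E (All \<phi>) \<longleftrightarrow> sat e E (All \<psi>)" by simp
    then show ?case by blast
  qed
  then show "Arith P \<Longrightarrow> Arith (\<lambda>e E. P (\<lambda>i. e (r i)) E)"
    unfolding Arith_def by metis
qed

lemma Arith_subst_term: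
  assumes "Arith (\<lambda>e E. Q (e 0) (\<lambda>i. e (Suc i)) E)"
  shows "Arith (\<lambda>e E. Q (eval_term e t) e E)"
proof -
  have "Arith (\<lambda>e E. \<exists>z. z = eval_term e t \<and> Q z e E)"
  proof (rule Arith_ex, rule Arith_conj)
    show "Arith (\<lambda>e E. e 0 = eval_term (\<lambda>i. e (Suc i)) t)"
      using Arith_eq[of "Var 0" "ren_term Suc t"] by (simp add: eval_ren_term)
  qed (use assms in simp)
  then show ?thesis by simp
qed

text \<open>This is how one quantified set is later read as several sets, by columns or by halves.
  In the \<open>All\<close> case the substituted predicates must ignore the newly bound number,
  hence the renaming that skips index 1.\<close>

lemma Arith_subst_set:
  assumes P: "Arith P" and Q: "\<And>i. Arith (\<lambda>e E. Q i (e 0) (\<lambda>j. e (Suc j)) E)"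
  shows "Arith (\<lambda>e E. P e (\<lambda>i m. Q i m e E))"
proof -
  have "Arith (\<lambda>e E. sat e (\<lambda>i m. Q i m e E) \<phi>)" for \<phi>
    using Q
  proof (induction \<phi> arbitrary: Q)
    case (Eq s t)
    then show ?case by (simp add: Arith_eq)
  next
    case (Mem t i)
    show ?case using Arith_subst_term[OF Mem[of i]] by simp
  next
    case (Neg \<phi>)
    show ?case using Arith_not[OF Neg.IH[OF Neg.prems]] by simp
  next
    case (Conj \<phi>1 \<phi>2)
    show ?case using Arith_conj[OF Conj.IH(1)[OF Conj.prems] Conj.IH(2)[OF Conj.prems]] by simp
  next
    case (All \<phi>)
    have "Arith (\<lambda>e E. (\<lambda>n e E. sat (case_nat n e) (\<lambda>i m. Q i m e E) \<phi>) (e 0) (\<lambda>i. e (Suc i)) E)"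
    proof -
      have "Arith (\<lambda>e E. Q i (e 0) (\<lambda>j. e (Suc (Suc j))) E)" for i
        using Arith_ren_num[OF All.prems[of i], of "case_nat 0 (\<lambda>j. Suc (Suc j))"] by simp
      from All.IH[of "\<lambda>i m e E. Q i m (\<lambda>j. e (Suc j)) E", OF this]
      show ?thesis by simp
    qed
    from Arith_all[OF this] show ?case by simp
  qed
  then show ?thesis using P unfolding Arith_def by metis
qed

lemma Arith_ren_set: "Arith P \<Longrightarrow> Arith (\<lambda>e E. P e (\<lambda>i. E (r i)))"
  using Arith_subst_set[of P "\<lambda>i m e E. E (r i) m"] Arith_mem_var by simp

definition npair :: "nat \<Rightarrow> nat \<Rightarrow> nat" where "npair x y = prod_encode (x, y)"

lemma npair_inj [simp]: "npair a b = npair c d \<longleftrightarrow> a = c \<and> b = d"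
  by (simp add: npair_def)

lemma npair_surj: "\<exists>a b. z = npair a b"
  unfolding npair_def by (metis prod_decode_inverse surj_pair)

text \<open>Doubling removes the division from the triangular number, so that pairing becomes an
  equation between terms.\<close>

lemma npair_alt: "z = npair x y \<longleftrightarrow> z + z = (x + y) * Suc (x + y) + (x + x)"
proof -
  have "triangle (x+y) + triangle (x+y) = (x+y) * Suc (x+y)"
    unfolding triangle_def by (metis div_mult_self_is_m mult_2 dvd_mult_div_cancel even_mult_iff even_Suc)
  then show ?thesis unfolding npair_def prod_encode_def by auto
qed

lemma npair_rank_le: "a \<le> npair a b" "b \<le> npair a b"
  unfolding npair_def by (auto simp: le_prod_encode_1 le_prod_encode_2)

lemma npair_0 [simp]: "npair 0 0 = 0"
  by (simp add: npair_def prod_encode_def)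

lemma Arith_npair: "Arith (\<lambda>e E. e i = npair (e j) (e k))"
  unfolding npair_alt
  using Arith_eq[of "Plus (Var i) (Var i)" "Plus (Times (Plus (Var j) (Var k)) (Succ (Plus (Var j) (Var k)))) (Plus (Var j) (Var j))"]
  by simp

subsection \<open>\<open>\<Pi>\<^sup>1\<^sub>1\<close> predicates\<close>

lemma Pi_pred_Arith: "Arith P \<Longrightarrow> Pi_pred P"
  unfolding Pi_pred_def using Arith_ren_set[of P Suc] by (intro exI[of _ "\<lambda>e E. P e (\<lambda>i. E (Suc i))"]) simp

lemma Pi_pred_conj:
  assumes "Pi_pred P" "Pi_pred Q" shows "Pi_pred (\<lambda>e E. P e E \<and> Q e E)"
proof -
  obtain P' Q' where "Arith P'" "Arith Q'" "\<forall>e E. P e E \<longleftrightarrow> (\<forall>Y. P' e (case_nat Y E))"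
    "\<forall>e E. Q e E \<longleftrightarrow> (\<forall>Y. Q' e (case_nat Y E))" using assms unfolding Pi_pred_def by metis
  then show ?thesis unfolding Pi_pred_def by (intro exI[of _ "\<lambda>e E. P' e E \<and> Q' e E"]) (auto intro: Arith_conj)
qed

lemma Pi_pred_Arith_disj:
  assumes "Arith P" "Pi_pred Q" shows "Pi_pred (\<lambda>e E. P e E \<or> Q e E)"
proof -
  obtain Q' where "Arith Q'" "\<forall>e E. Q e E \<longleftrightarrow> (\<forall>Y. Q' e (case_nat Y E))"
    using assms unfolding Pi_pred_def by metis
  then show ?thesis unfolding Pi_pred_def using Arith_ren_set[of P Suc] assms
    by (intro exI[of _ "\<lambda>e E. P e (\<lambda>i. E (Suc i)) \<or> Q' e E"]) (auto intro: Arith_disj)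
qed

lemma Pi_pred_all:
  assumes "Pi_pred (\<lambda>e E. P (e 0) (\<lambda>i. e (Suc i)) E)" shows "Pi_pred (\<lambda>e E. \<forall>n. P n e E)"
proof -
  obtain Q where Q: "Arith Q" "\<And>e E. P (e 0) (\<lambda>i. e (Suc i)) E \<longleftrightarrow> (\<forall>Y. Q e (case_nat Y E))"
    using assms unfolding Pi_pred_def by metis
  have "P n e E \<longleftrightarrow> (\<forall>Y. Q (case_nat n e) (case_nat Y E))" for n e E
    using Q(2)[of "case_nat n e" E] by simp
  then show ?thesis unfolding Pi_pred_def using Q(1)
    by (intro exI[of _ "\<lambda>e E. \<forall>n. Q (case_nat n e) E"]) (auto intro: Arith_all)
qed

lemma Arith_col: "Arith (\<lambda>e E. E i (npair (e j) (e k)))"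
proof -
  have "Arith (\<lambda>e E. \<exists>z. z = npair (e j) (e k) \<and> E i z)"
    by (intro Arith_ex Arith_conj Arith_npair Arith_mem_var)
  then show ?thesis by simp
qed

text \<open>The number quantifier moves inside the set quantifier: if every \<open>n\<close> had its
  own counterexample \<open>F n\<close>, the single set whose columns are the \<open>F n\<close>
  would refute all \<open>n\<close> at once.\<close>

lemma Pi_pred_ex:
  assumes "Pi_pred (\<lambda>e E. P (e 0) (\<lambda>i. e (Suc i)) E)" shows "Pi_pred (\<lambda>e E. \<exists>n. P n e E)"
proof -
  obtain Q where Q: "Arith Q" "\<And>e E. P (e 0) (\<lambda>i. e (Suc i)) E \<longleftrightarrow> (\<forall>Y. Q e (case_nat Y E))"
    using assms unfolding Pi_pred_def by metis
  have P: "P n e E \<longleftrightarrow> (\<forall>Y. Q (case_nat n e) (case_nat Y E))" for n e E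
    using Q(2)[of "case_nat n e" E] by simp
  define R where "R = (\<lambda>e E. Q e (\<lambda>i m. case i of 0 \<Rightarrow> E 0 (npair (e 0) m) | Suc j \<Rightarrow> E (Suc j) m))"
  have "Arith (\<lambda>e E. case i of 0 \<Rightarrow> E 0 (npair (e (Suc 0)) (e 0)) | Suc j \<Rightarrow> E (Suc j) (e 0))" for i
    by (cases i) (auto intro: Arith_col Arith_mem_var)
  then have "Arith R" unfolding R_def by (intro Arith_subst_set[OF Q(1)])
  then have 1: "Arith (\<lambda>e E. \<exists>n. R (case_nat n e) E)" by (intro Arith_ex) auto
  have R: "R (case_nat n e) (case_nat Y E) \<longleftrightarrow> Q (case_nat n e) (case_nat (\<lambda>m. Y (npair n m)) E)" for n e Y E
    unfolding R_def by (rule arg_cong[where f="Q _"]) (auto split: nat.split)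
  have "(\<exists>n. P n e E) \<longleftrightarrow> (\<forall>Y. \<exists>n. R (case_nat n e) (case_nat Y E))" for e E
  proof
    assume r: "\<forall>Y. \<exists>n. R (case_nat n e) (case_nat Y E)"
    show "\<exists>n. P n e E"
    proof (rule ccontr)
      assume "\<not> ?thesis"
      then obtain F where F: "\<And>n. \<not> Q (case_nat n e) (case_nat (F n) E)" unfolding P by metis
      define Y where "Y = (\<lambda>z. \<exists>n m. z = npair n m \<and> F n m)"
      have "(\<lambda>m. Y (npair n m)) = F n" for n unfolding Y_def by auto
      with r R F show False by metis
    qed
  qed (auto simp: P R)
  with 1 show ?thesis unfolding Pi_pred_def by blast
qed

text \<open>Two set quantifiers contract to one: its set holds the inner set on the even numbers and
  the outer set on the odd ones.\<close>

lemma Pi_pred_allset: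
  assumes "Pi_pred (\<lambda>e E. P (E 0) e (\<lambda>i. E (Suc i)))" shows "Pi_pred (\<lambda>e E. \<forall>H. P H e E)"
proof -
  obtain Q where Q: "Arith Q" "\<And>e E. P (E 0) e (\<lambda>i. E (Suc i)) \<longleftrightarrow> (\<forall>Y. Q e (case_nat Y E))"
    using assms unfolding Pi_pred_def by metis
  have P: "P H e E \<longleftrightarrow> (\<forall>Y. Q e (case_nat Y (case_nat H E)))" for H e E
    using Q(2)[where e=e and E="case_nat H E"] by simp
  define R where "R = (\<lambda>(e::nat \<Rightarrow> nat) E. Q e (\<lambda>i m. case i of 0 \<Rightarrow> E 0 (m + m) | Suc j \<Rightarrow> (case j of 0 \<Rightarrow> E 0 (Suc (m + m)) | Suc l \<Rightarrow> E (Suc l) m)))"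
  have "Arith (\<lambda>e E. case i of 0 \<Rightarrow> E 0 (e 0 + e 0) | Suc j \<Rightarrow> (case j of 0 \<Rightarrow> E 0 (Suc (e 0 + e 0)) | Suc l \<Rightarrow> E (Suc l) (e 0)))" for i
  proof -
    have "Arith (\<lambda>e E. E 0 (e 0 + e 0))"
      using Arith_subst_term[of "\<lambda>z e E. E 0 z" "Plus (Var 0) (Var 0)"] Arith_mem_var by simp
    moreover have "Arith (\<lambda>e E. E 0 (Suc (e 0 + e 0)))"
      using Arith_subst_term[of "\<lambda>z e E. E 0 z" "Succ (Plus (Var 0) (Var 0))"] Arith_mem_var by simp
    ultimately show ?thesis
      by (cases i; cases "i - 1") (simp_all add: Arith_mem_var)
  qed
  then have 1: "Arith R" unfolding R_def by (intro Arith_subst_set[OF Q(1)])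
  have R: "R e (case_nat Y E) \<longleftrightarrow> Q e (case_nat (\<lambda>m. Y (m + m)) (case_nat (\<lambda>m. Y (Suc (m + m))) E))" for e Y E
    unfolding R_def by (rule arg_cong[where f="Q _"]) (auto split: nat.split)
  have "(\<forall>H. P H e E) \<longleftrightarrow> (\<forall>Y. R e (case_nat Y E))" for e E
  proof
    assume r: "\<forall>Y. R e (case_nat Y E)"
    show "\<forall>H. P H e E"
      unfolding P
    proof (intro allI)
      fix H Y :: cantor
      define Z where "Z = (\<lambda>z. if even z then Y (z div 2) else H (z div 2))"
      have "(\<lambda>m. Z (m + m)) = Y" "(\<lambda>m. Z (Suc (m + m))) = H" unfolding Z_def
        by (auto simp: fun_eq_iff simp flip: mult_2)
      with r R show "Q e (case_nat Y (case_nat H E))" by metis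
    qed
  qed (auto simp: P R)
  with 1 show ?thesis unfolding Pi_pred_def by blast
qed

lemma Pi_pred_ren:
  assumes "Pi_pred P" shows "Pi_pred (\<lambda>e E. P (\<lambda>i. e (r i)) (\<lambda>i. E (q i)))"
proof -
  obtain Q where Q: "Arith Q" "\<And>e E. P e E \<longleftrightarrow> (\<forall>Y. Q e (case_nat Y E))"
    using assms unfolding Pi_pred_def by metis
  have "Arith (\<lambda>e E. Q (\<lambda>i. e (r i)) (\<lambda>i. E (case_nat 0 (\<lambda>i. Suc (q i)) i)))"
    by (rule Arith_ren_num[OF Arith_ren_set[OF Q(1)]])
  moreover have "(\<lambda>i. (case_nat Y E) (case_nat 0 (\<lambda>i. Suc (q i)) i)) = case_nat Y (\<lambda>i. E (q i))" for Y and E :: "nat \<Rightarrow> cantor"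
    by (auto split: nat.split)
  ultimately show ?thesis unfolding Pi_pred_def Q(2)
    by (intro exI[of _ "\<lambda>e E. Q (\<lambda>i. e (r i)) (\<lambda>i. E (case_nat 0 (\<lambda>i. Suc (q i)) i))"]) simp
qed

text \<open>A disjunction is an existential number quantifier choosing a side, so
  \<open>Pi_pred_ex\<close> does the work and only disjunctions with an arithmetical side
  remain.\<close>

lemma Pi_pred_disj:
  assumes "Pi_pred P" "Pi_pred Q" shows "Pi_pred (\<lambda>e E. P e E \<or> Q e E)"
proof -
  have 0: "Arith (\<lambda>e E. e 0 = 0)" using Arith_eq[of "Var 0" Zero] by simp
  have P: "Pi_pred (\<lambda>e E. P (\<lambda>i. e (Suc i)) E)" and Q: "Pi_pred (\<lambda>e E. Q (\<lambda>i. e (Suc i)) E)"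
    using assms Pi_pred_ren[of _ Suc "\<lambda>i. i"] by auto
  have "Pi_pred (\<lambda>e E. \<exists>n::nat. (n \<noteq> 0 \<or> P e E) \<and> (n = 0 \<or> Q e E))"
    by (rule Pi_pred_ex, intro Pi_pred_conj Pi_pred_Arith_disj P Q Arith_not 0)
  moreover have "(\<lambda>e E. \<exists>n::nat. (n \<noteq> 0 \<or> P e E) \<and> (n = 0 \<or> Q e E)) = (\<lambda>e E. P e E \<or> Q e E)"
    by (auto simp: fun_eq_iff)
  ultimately show ?thesis by simp
qed

lemma Pi11_set_Pi_pred:
  assumes "Pi_pred P" shows "Pi11_set {n. P (case_nat n (\<lambda>_. 0)) (\<lambda>_ _. False)}"
proof -
  obtain \<phi> where "\<And>e E. P e E \<longleftrightarrow> (\<forall>Y. sat e (case_nat Y E) \<phi>)"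
    using assms unfolding Pi_pred_def Arith_def by metis
  then show ?thesis unfolding Pi11_set_def by auto
qed

text \<open>The formula of a \<open>Pi11_set\<close> is meant with its remaining variables read as 0
  and as the empty set, whereas a \<open>Pi_pred\<close> speaks of every environment. So the other
  set variables are replaced by the empty set, and \<open>r\<close> redirects the other number
  variables to a new variable \<open>z\<close>, which is required to be 0.\<close>

lemma Pi_pred_Pi11_set:
  assumes "Pi11_set A" shows "Pi_pred (\<lambda>e E. e 0 \<in> A)"
proof -
  obtain \<phi> where \<phi>: "A = {n. \<forall>Y. sat (case_nat n (\<lambda>_. 0)) (case_nat Y (\<lambda>_ _. False)) \<phi>}"
    using assms unfolding Pi11_set_def by auto
  define P where "P = (\<lambda>e (E :: nat \<Rightarrow> cantor). sat e (\<lambda>i m. i = 0 \<and> E 0 m) \<phi>)"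
  have "Arith (\<lambda>e E. i = 0 \<and> E 0 (e 0))" for i :: nat
    using Arith_mem_var[of 0 0] Arith_eq[of Zero "Succ Zero"] by (cases i) auto
  moreover have "Arith (\<lambda>e E. sat e E \<phi>)" unfolding Arith_def by blast
  ultimately have "Arith P" unfolding P_def
    using Arith_subst_set[of "\<lambda>e E. sat e E \<phi>" "\<lambda>i m e E. i = 0 \<and> E 0 m"] by blast
  define r where "r = (\<lambda>i::nat. case i of 0 \<Rightarrow> Suc 0 | Suc _ \<Rightarrow> 0)"
  have "Arith (\<lambda>e E. e 0 = 0)" using Arith_eq[of "Var 0" Zero] by simp
  then have "Arith (\<lambda>e E. \<forall>z. z \<noteq> 0 \<or> P (\<lambda>i. case_nat z e (r i)) E)"
    using Arith_ren_num[OF \<open>Arith P\<close>, of r] by (intro Arith_all Arith_disj Arith_not) simp_all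
  moreover have "(e 0 \<in> A) \<longleftrightarrow> (\<forall>Y. \<forall>z. z \<noteq> 0 \<or> P (\<lambda>i. case_nat z e (r i)) (case_nat Y E))" for e :: "nat \<Rightarrow> nat" and E :: "nat \<Rightarrow> cantor"
  proof -
    have "(\<lambda>i. case_nat 0 e (r i)) = case_nat (e 0) (\<lambda>_. 0)"
      unfolding r_def by (auto split: nat.split)
    moreover have "P d (case_nat Y E) \<longleftrightarrow> sat d (case_nat Y (\<lambda>_ _. False)) \<phi>" for d Y
      unfolding P_def by (rule arg_cong[where f="\<lambda>F. sat d F \<phi>"]) (auto simp: fun_eq_iff split: nat.split)
    ultimately have "(e 0 \<in> A) \<longleftrightarrow> (\<forall>Y. P (\<lambda>i. case_nat 0 e (r i)) (case_nat Y E))"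
      unfolding \<phi> by simp
    moreover have "(\<forall>z. z \<noteq> 0 \<or> P (\<lambda>i. case_nat z e (r i)) F) \<longleftrightarrow> P (\<lambda>i. case_nat 0 e (r i)) F" for F
      by (auto intro!: gr0I)
    ultimately show ?thesis by simp
  qed
  ultimately show ?thesis unfolding Pi_pred_def by blast
qed

section \<open>Closure properties of Delta^1_1 predicates and functions\<close>

lemma Delta_pred_Pi_pred: "Delta_pred P \<Longrightarrow> Pi_pred P" "Delta_pred P \<Longrightarrow> Pi_pred (\<lambda>e E. \<not> P e E)"
  by (auto simp: Delta_pred_def)

lemma Delta_pred_Arith: "Arith P \<Longrightarrow> Delta_pred P"
  by (auto simp: Delta_pred_def intro: Pi_pred_Arith Arith_not)

lemma Delta_pred_not: "Delta_pred P \<Longrightarrow> Delta_pred (\<lambda>e E. \<not> P e E)"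
  by (auto simp: Delta_pred_def)

lemma Delta_pred_conj: "Delta_pred P \<Longrightarrow> Delta_pred Q \<Longrightarrow> Delta_pred (\<lambda>e E. P e E \<and> Q e E)"
  unfolding Delta_pred_def de_Morgan_conj by (intro conjI Pi_pred_conj Pi_pred_disj) auto

lemma Delta_pred_disj: "Delta_pred P \<Longrightarrow> Delta_pred Q \<Longrightarrow> Delta_pred (\<lambda>e E. P e E \<or> Q e E)"
  unfolding Delta_pred_def de_Morgan_disj by (intro conjI Pi_pred_conj Pi_pred_disj) auto

lemma Delta_pred_imp: "Delta_pred P \<Longrightarrow> Delta_pred Q \<Longrightarrow> Delta_pred (\<lambda>e E. P e E \<longrightarrow> Q e E)"
  unfolding imp_conv_disj by (intro Delta_pred_disj Delta_pred_not)

lemma Delta_pred_iff: "Delta_pred P \<Longrightarrow> Delta_pred Q \<Longrightarrow> Delta_pred (\<lambda>e E. P e E \<longleftrightarrow> Q e E)"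
  unfolding iff_conv_conj_imp by (intro Delta_pred_conj Delta_pred_imp)

lemma Delta_pred_all: "Delta_pred (\<lambda>e E. P (e 0) (\<lambda>i. e (Suc i)) E) \<Longrightarrow> Delta_pred (\<lambda>e E. \<forall>n. P n e E)"
  by (auto simp: Delta_pred_def intro: Pi_pred_all Pi_pred_ex)

lemma Delta_pred_ex: "Delta_pred (\<lambda>e E. P (e 0) (\<lambda>i. e (Suc i)) E) \<Longrightarrow> Delta_pred (\<lambda>e E. \<exists>n. P n e E)"
  by (auto simp: Delta_pred_def intro: Pi_pred_all Pi_pred_ex)

lemma Delta_pred_ren: "Delta_pred P \<Longrightarrow> Delta_pred (\<lambda>e E. P (\<lambda>i. e (r i)) (\<lambda>i. E (q i)))"
  unfolding Delta_pred_def using Pi_pred_ren[of P] Pi_pred_ren[of "\<lambda>e E. \<not> P e E"] by blast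

lemma Delta_fun_ren: "Delta_fun f \<Longrightarrow> Delta_fun (\<lambda>e E. f (\<lambda>i. e (r i)) (\<lambda>i. E (q i)))"
  unfolding Delta_fun_def
  using Delta_pred_ren[of "\<lambda>e E. e 0 = f (\<lambda>i. e (Suc i)) E" "case_nat 0 (\<lambda>i. Suc (r i))"] by simp

lemma Pi_pred_comp:
  assumes "Pi_pred (\<lambda>e E. R (e 0) (\<lambda>i. e (Suc i)) E)" "Delta_fun f"
  shows "Pi_pred (\<lambda>e E. R (f e E) e E)"
proof -
  have "Pi_pred (\<lambda>e E. \<forall>z. z \<noteq> f e E \<or> R z e E)"
    by (rule Pi_pred_all, rule Pi_pred_disj) (use assms in \<open>auto simp: Delta_fun_def intro: Delta_pred_Pi_pred(2)\<close>)
  then show ?thesis by simp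
qed

lemma Delta_pred_comp:
  assumes "Delta_pred (\<lambda>e E. R (e 0) (\<lambda>i. e (Suc i)) E)" "Delta_fun f"
  shows "Delta_pred (\<lambda>e E. R (f e E) e E)"
  using assms Pi_pred_comp[of R f] Pi_pred_comp[of "\<lambda>z e E. \<not> R z e E" f] unfolding Delta_pred_def by blast

lemma Delta_fun_comp:
  assumes "Delta_fun (\<lambda>e E. h (e 0) (\<lambda>i. e (Suc i)) E)" "Delta_fun f"
  shows "Delta_fun (\<lambda>e E. h (f e E) e E)"
  unfolding Delta_fun_def
proof (rule Delta_pred_comp[where R="\<lambda>z e E. e 0 = h z (\<lambda>i. e (Suc i)) E"])
  show "Delta_pred (\<lambda>e E. e (Suc 0) = h (e 0) (\<lambda>i. e (Suc (Suc i))) E)"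
    using Delta_pred_ren[of "\<lambda>e E. e 0 = h (e (Suc 0)) (\<lambda>i. e (Suc (Suc i))) E" "\<lambda>i. case i of 0 \<Rightarrow> Suc 0 | Suc j \<Rightarrow> (case j of 0 \<Rightarrow> 0 | Suc l \<Rightarrow> i)" "\<lambda>i. i"] assms(1)
    unfolding Delta_fun_def by simp
  show "Delta_fun (\<lambda>e E. f (\<lambda>i. e (Suc i)) E)" using Delta_fun_ren[OF assms(2)] by simp
qed

lemma Pi_pred_comp2:
  assumes "Pi_pred (\<lambda>e E. R (e 0) (e (Suc 0)))" "Delta_fun f" "Delta_fun g"
  shows "Pi_pred (\<lambda>e E. R (f e E) (g e E))"
proof (rule Pi_pred_comp[where R="\<lambda>z e E. R z (g e E)"])
  have g: "Delta_fun (\<lambda>e E. g (\<lambda>i. e (Suc i)) E)" using Delta_fun_ren[OF assms(3), of Suc "\<lambda>i. i"] .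
  have "Pi_pred (\<lambda>e E. R (e (Suc 0)) (e 0))"
    using Pi_pred_ren[OF assms(1), of "\<lambda>i. 1 - i"] by simp
  then show "Pi_pred (\<lambda>e E. R (e 0) (g (\<lambda>i. e (Suc i)) E))"
    by (intro Pi_pred_comp[where R="\<lambda>z e E. R (e 0) z", OF _ g])
qed (fact assms)

lemma Delta_pred_comp2:
  assumes "Delta_pred (\<lambda>e E. R (e 0) (e (Suc 0)))" "Delta_fun f" "Delta_fun g"
  shows "Delta_pred (\<lambda>e E. R (f e E) (g e E))"
  using assms Pi_pred_comp2[of R] Pi_pred_comp2[of "\<lambda>x y. \<not> R x y"] unfolding Delta_pred_def by blast

lemma Delta_pred_comp3:
  assumes "Delta_pred (\<lambda>e E. R (e 0) (e (Suc 0)) (e (Suc (Suc 0))))" "Delta_fun f" "Delta_fun g" "Delta_fun h"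
  shows "Delta_pred (\<lambda>e E. R (f e E) (g e E) (h e E))"
proof (rule Delta_pred_comp[where R="\<lambda>z e E. R z (g e E) (h e E)"])
  have g: "Delta_fun (\<lambda>e E. g (\<lambda>i. e (Suc i)) E)" using Delta_fun_ren[OF assms(3), of Suc "\<lambda>i. i"] .
  have h: "Delta_fun (\<lambda>e E. h (\<lambda>i. e (Suc (Suc i))) E)" using Delta_fun_ren[OF assms(4), of "\<lambda>i. Suc (Suc i)" "\<lambda>i. i"] .
  have "Delta_pred (\<lambda>e E. R (e (Suc (Suc 0))) (e (Suc 0)) (e 0))"
    using Delta_pred_ren[OF assms(1), of "\<lambda>i. 2 - i"] by (simp add: numeral_2_eq_2)
  then have "Delta_pred (\<lambda>e E. R (e (Suc 0)) (e 0) (h (\<lambda>i. e (Suc (Suc i))) E))"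
    by (intro Delta_pred_comp[where R="\<lambda>z e E. R (e (Suc 0)) (e 0) z", OF _ h]) simp
  then show "Delta_pred (\<lambda>e E. R (e 0) (g (\<lambda>i. e (Suc i)) E) (h (\<lambda>i. e (Suc i)) E))"
    by (intro Delta_pred_comp[where R="\<lambda>z e E. R (e 0) z (h (\<lambda>i. e (Suc i)) E)", OF _ g])
qed (fact assms)

lemma Delta_fun_comp1:
  assumes "Delta_pred (\<lambda>e E. e 0 = h (e (Suc 0)))" "Delta_fun f"
  shows "Delta_fun (\<lambda>e E. h (f e E))"
  using Delta_fun_comp[of "\<lambda>z e E. h z"] assms unfolding Delta_fun_def by simp

lemma Delta_fun_comp2:
  assumes "Delta_pred (\<lambda>e E. e 0 = h (e (Suc 0)) (e (Suc (Suc 0))))" "Delta_fun f" "Delta_fun g"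
  shows "Delta_fun (\<lambda>e E. h (f e E) (g e E))"
proof (rule Delta_fun_comp[where h="\<lambda>z e E. h z (g e E)"])
  have g: "Delta_fun (\<lambda>e E. g (\<lambda>i. e (Suc i)) E)" using Delta_fun_ren[OF assms(3), of Suc "\<lambda>i. i"] .
  have "Delta_pred (\<lambda>e E. e 0 = h (e (Suc (Suc 0))) (e (Suc 0)))"
    using Delta_pred_ren[OF assms(1), of "\<lambda>i. case i of 0 \<Rightarrow> 0 | Suc j \<Rightarrow> (case j of 0 \<Rightarrow> Suc (Suc 0) | Suc _ \<Rightarrow> Suc 0)"] by simp
  then show "Delta_fun (\<lambda>e E. h (e 0) (g (\<lambda>i. e (Suc i)) E))"
    by (intro Delta_fun_comp[where h="\<lambda>z e E. h (e 0) z", OF _ g]) (simp add: Delta_fun_def)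
qed (fact assms)

lemma Delta_fun_var: "Delta_fun (\<lambda>e E. e i)"
  unfolding Delta_fun_def using Delta_pred_Arith[OF Arith_eq[of "Var 0" "Var (Suc i)"]] by simp

lemma Delta_fun_const: "Delta_fun (\<lambda>e E. k)"
proof -
  have "\<exists>t. \<forall>e. eval_term e t = k"
    by (induction k) (metis eval_term.simps(2), metis eval_term.simps(3))
  then obtain t where "\<forall>e. eval_term e t = k" ..
  then show ?thesis unfolding Delta_fun_def using Delta_pred_Arith[OF Arith_eq[of "Var 0" t]] by simp
qed

lemma Delta_fun_Suc: "Delta_fun f \<Longrightarrow> Delta_fun (\<lambda>e E. Suc (f e E))"
  by (rule Delta_fun_comp1[OF Delta_pred_Arith]) (use Arith_eq[of "Var 0" "Succ (Var 1)"] in simp)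

lemma Delta_fun_plus: "Delta_fun f \<Longrightarrow> Delta_fun g \<Longrightarrow> Delta_fun (\<lambda>e E. f e E + g e E)"
  by (rule Delta_fun_comp2[OF Delta_pred_Arith]) (use Arith_eq[of "Var 0" "Plus (Var 1) (Var 2)"] in \<open>simp_all add: numeral_2_eq_2\<close>)

lemma Delta_fun_times: "Delta_fun f \<Longrightarrow> Delta_fun g \<Longrightarrow> Delta_fun (\<lambda>e E. f e E * g e E)"
  by (rule Delta_fun_comp2[OF Delta_pred_Arith]) (use Arith_eq[of "Var 0" "Times (Var 1) (Var 2)"] in \<open>simp_all add: numeral_2_eq_2\<close>)

lemma Delta_fun_npair: "Delta_fun f \<Longrightarrow> Delta_fun g \<Longrightarrow> Delta_fun (\<lambda>e E. npair (f e E) (g e E))"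
  by (rule Delta_fun_comp2[OF Delta_pred_Arith]) (simp_all add: Arith_npair)

lemma Delta_pred_eq: "Delta_fun f \<Longrightarrow> Delta_fun g \<Longrightarrow> Delta_pred (\<lambda>e E. f e E = g e E)"
  by (rule Delta_pred_comp2[OF Delta_pred_Arith]) (use Arith_eq[of "Var 0" "Var 1"] in simp_all)

lemma Delta_pred_rank_le: "Delta_fun f \<Longrightarrow> Delta_fun g \<Longrightarrow> Delta_pred (\<lambda>e E. f e E \<le> g e E)"
  unfolding le_iff_add
  by (rule Delta_pred_comp2) (intro Delta_pred_ex Delta_pred_eq Delta_fun_plus Delta_fun_var)

lemma Delta_pred_less: "Delta_fun f \<Longrightarrow> Delta_fun g \<Longrightarrow> Delta_pred (\<lambda>e E. f e E < g e E)"
  unfolding less_eq_Suc_le by (intro Delta_pred_rank_le Delta_fun_Suc)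

lemma Delta_pred_mem: "Delta_fun f \<Longrightarrow> Delta_pred (\<lambda>e E. E i (f e E))"
  by (rule Delta_pred_comp[where R="\<lambda>z e E. E i z", OF Delta_pred_Arith[OF Arith_mem_var]])

lemma Delta_pred_bool: "Delta_pred (\<lambda>e E. b)"
proof -
  have t: "Delta_pred (\<lambda>e E. (0::nat) = 0)" by (intro Delta_pred_eq Delta_fun_const)
  then have "Delta_pred (\<lambda>e E. \<not> (0::nat) = 0)" by (rule Delta_pred_not)
  then show ?thesis using t by (cases b) auto
qed

lemma Delta_fun_if:
  assumes "Delta_pred C" "Delta_fun f" "Delta_fun g" shows "Delta_fun (\<lambda>e E. if C e E then f e E else g e E)"
proof -
  have "Delta_pred (\<lambda>e E. (C (\<lambda>i. e (Suc i)) E \<and> e 0 = f (\<lambda>i. e (Suc i)) E) \<or> (\<not> C (\<lambda>i. e (Suc i)) E \<and> e 0 = g (\<lambda>i. e (Suc i)) E))"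
    using assms Delta_pred_ren[OF assms(1), of Suc "\<lambda>i. i"] unfolding Delta_fun_def by (intro Delta_pred_disj Delta_pred_conj Delta_pred_not)
  then show ?thesis unfolding Delta_fun_def by (rule back_subst[of Delta_pred]) (auto simp: fun_eq_iff)
qed

lemmas definability_rules = Delta_pred_conj Delta_pred_disj Delta_pred_not Delta_pred_imp Delta_pred_iff Delta_pred_all Delta_pred_ex Delta_pred_eq Delta_pred_rank_le Delta_pred_less Delta_pred_mem
  Delta_fun_var Delta_fun_Suc Delta_fun_plus Delta_fun_times Delta_fun_npair Delta_fun_if Delta_fun_const Delta_pred_bool

subsection \<open>Recursion and counting\<close>

text \<open>Implicit definition: when exactly one set satisfies \<open>G\<close>, a universal
  quantifier over all solutions expresses both membership and non-membership in it. The hierarchies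
  of covers will be handled by the same idea.\<close>

lemma Delta_pred_unique:
  assumes G: "Delta_pred (\<lambda>e E. G (E 0) e (\<lambda>i. E (Suc i)))"
    and ex: "\<And>e E. G (R e E) e E" and uniq: "\<And>e E H. G H e E \<Longrightarrow> H = R e E"
    and f: "Delta_fun f"
  shows "Delta_pred (\<lambda>e E. R e E (f e E))"
proof -
  have R: "R e E (f e E) \<longleftrightarrow> (\<forall>H. G H e E \<longrightarrow> H (f e E))"
    "\<not> R e E (f e E) \<longleftrightarrow> (\<forall>H. G H e E \<longrightarrow> \<not> H (f e E))" for e E
    using ex uniq by metis+
  have f': "Delta_fun (\<lambda>e E. f e (\<lambda>i. E (Suc i)))" using Delta_fun_ren[OF f, of "\<lambda>i. i" Suc] .
  have "Pi_pred (\<lambda>e E. \<forall>H. G H e E \<longrightarrow> H (f e E))" "Pi_pred (\<lambda>e E. \<forall>H. G H e E \<longrightarrow> \<not> H (f e E))"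
    by (intro Pi_pred_allset Delta_pred_Pi_pred(1) Delta_pred_imp G Delta_pred_mem Delta_pred_not f')+
  then show ?thesis unfolding Delta_pred_def R(2) unfolding R(1) by simp
qed

text \<open>The set of pairs of \<open>n\<close> and the \<open>n\<close>-th iterate is the only
  solution of its recursion equations \<open>G\<close>, so a set quantifier replaces the coding of
  finite computations. The shifts by \<open>Suc\<close> in \<open>R\<close> and \<open>G\<close>
  keep index 0 free for the function value in the graph.\<close>

lemma Delta_fun_funpow:
  assumes h: "Delta_fun (\<lambda>e E. h (e 0) (\<lambda>i. e (Suc i)) E)" and g: "Delta_fun g" and m: "Delta_fun m"
  shows "Delta_fun (\<lambda>e E. ((\<lambda>x. h x e E) ^^ m e E) (g e E))"
proof -
  define R where "R = (\<lambda>(e::nat \<Rightarrow> nat) E z. \<exists>n. z = npair n (((\<lambda>x. h x (\<lambda>i. e (Suc i)) E) ^^ n) (g (\<lambda>i. e (Suc i)) E)))"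
  define G where "G = (\<lambda>H (e::nat \<Rightarrow> nat) E. \<forall>n v. H (npair n v) \<longleftrightarrow> (n = 0 \<and> v = g (\<lambda>i. e (Suc i)) E) \<or>
    (\<exists>k w. n = Suc k \<and> H (npair k w) \<and> v = h w (\<lambda>i. e (Suc i)) E))"
  have h': "Delta_fun (\<lambda>e E. h (e 0) (\<lambda>i. e (Suc (Suc (Suc (Suc (Suc i)))))) (\<lambda>i. E (Suc i)))"
    using Delta_fun_ren[OF h, of "case_nat 0 (\<lambda>i. Suc (Suc (Suc (Suc (Suc i)))))" Suc] by simp
  have g': "Delta_fun (\<lambda>e E. g (\<lambda>i. e (Suc (Suc (Suc i)))) (\<lambda>i. E (Suc i)))"
    by (rule Delta_fun_ren[OF g])
  have 1: "Delta_pred (\<lambda>e E. G (E 0) e (\<lambda>i. E (Suc i)))"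
    unfolding G_def by (intro definability_rules h' g')
  have 2: "G (R e E) e E" for e E
    unfolding G_def R_def
    apply (intro allI)
    subgoal for n v by (cases n) auto
    done
  have 3: "H = R e E" if "G H e E" for H e E
  proof -
    have H: "H (npair n v) \<longleftrightarrow> (n = 0 \<and> v = g (\<lambda>i. e (Suc i)) E) \<or>
      (\<exists>k w. n = Suc k \<and> H (npair k w) \<and> v = h w (\<lambda>i. e (Suc i)) E)" for n v
      using that unfolding G_def by (elim allE)
    have "H (npair n v) \<longleftrightarrow> R e E (npair n v)" for n v
    proof (induction n arbitrary: v)
      case 0
      then show ?case unfolding H[of 0] R_def by simp
    next
      case (Suc n)
      have "H (npair (Suc n) v) \<longleftrightarrow> (\<exists>w. H (npair n w) \<and> v = h w (\<lambda>i. e (Suc i)) E)"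
        unfolding H[of "Suc n"] by simp
      then show ?case unfolding Suc R_def by auto
    qed
    then show ?thesis by (metis npair_surj HOL.ext[of H "R e E"])
  qed
  have m': "Delta_fun (\<lambda>e E. m (\<lambda>i. e (Suc i)) E)" using Delta_fun_ren[OF m, of Suc "\<lambda>i. i"] .
  have "Delta_pred (\<lambda>e E. R e E (npair (m (\<lambda>i. e (Suc i)) E) (e 0)))"
    by (rule Delta_pred_unique[where G=G, OF 1 2 3], assumption, intro Delta_fun_npair Delta_fun_var m')
  then show ?thesis unfolding Delta_fun_def R_def by simp
qed

definition nfst :: "nat \<Rightarrow> nat" where "nfst x = fst (prod_decode x)"
definition nsnd :: "nat \<Rightarrow> nat" where "nsnd x = snd (prod_decode x)"

lemma nproj_npair [simp]: "nfst (npair a b) = a" "nsnd (npair a b) = b" "npair (nfst x) (nsnd x) = x"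
  by (auto simp: nfst_def nsnd_def npair_def)

lemma nproj_eq: "z = nfst x \<longleftrightarrow> (\<exists>b. x = npair z b)" "z = nsnd x \<longleftrightarrow> (\<exists>a. x = npair a z)"
  by (metis nproj_npair)+

lemma Delta_fun_nfst: "Delta_fun f \<Longrightarrow> Delta_fun (\<lambda>e E. nfst (f e E))"
  by (rule Delta_fun_comp1, unfold nproj_eq) (intro definability_rules)

lemma Delta_fun_nsnd: "Delta_fun f \<Longrightarrow> Delta_fun (\<lambda>e E. nsnd (f e E))"
  by (rule Delta_fun_comp1, unfold nproj_eq) (intro definability_rules)

text \<open>Counting strings of a given length is how measures enter definitions. The iteration
  carries the pair of the counter and the count.\<close>

lemma Delta_fun_card:
  assumes Q: "Delta_pred (\<lambda>e E. Q (e 0) (\<lambda>i. e (Suc i)) E)" and m: "Delta_fun m"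
  shows "Delta_fun (\<lambda>e E. card {i. i < m e E \<and> Q i e E})"
proof -
  define h where "h = (\<lambda>x e E. npair (Suc (nfst x)) (if Q (nfst x) e E then Suc (nsnd x) else nsnd x))"
  have *: "((\<lambda>x. h x e E) ^^ n) 0 = npair n (card {i. i < n \<and> Q i e E})" for n e E
  proof (induction n)
    case (Suc n)
    have "{i. i < Suc n \<and> Q i e E} = {i. i < n \<and> Q i e E} \<union> (if Q n e E then {n} else {})"
      using less_Suc_eq by auto
    then show ?case using Suc by (simp add: h_def)
  qed simp
  have "Delta_pred (\<lambda>e E. Q (nfst (e 0)) (\<lambda>i. e (Suc i)) E)"
  proof (rule Delta_pred_comp[where R="\<lambda>z e E. Q z (\<lambda>i. e (Suc i)) E"])
    show "Delta_pred (\<lambda>e E. Q (e 0) (\<lambda>i. e (Suc (Suc i))) E)"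
      using Delta_pred_ren[OF Q, of "case_nat 0 (\<lambda>i. Suc (Suc i))" "\<lambda>i. i"] by simp
  qed (intro Delta_fun_nfst Delta_fun_var)
  then have "Delta_fun (\<lambda>e E. h (e 0) (\<lambda>i. e (Suc i)) E)"
    unfolding h_def by (intro definability_rules Delta_fun_nfst Delta_fun_nsnd)
  from Delta_fun_nsnd[OF Delta_fun_funpow[OF this Delta_fun_const m, of 0]] show ?thesis by (simp add: *)
qed

lemma Delta_fun_pow2: "Delta_fun f \<Longrightarrow> Delta_fun (\<lambda>e E. 2 ^ f e E)"
proof -
  have "2 ^ n = ((\<lambda>x::nat. 2 * x) ^^ n) 1" for n by (induction n) auto
  then show "Delta_fun f \<Longrightarrow> ?thesis"
    by simp (intro Delta_fun_funpow definability_rules)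
qed

section \<open>Codes for nodes of trees and for strings\<close>

text \<open>Nodes are codes of lists under \<open>list_encode\<close> with the latest entry at the
  head. Thus \<open>node_cons n s\<close> is the \<open>n\<close>-th child of \<open>s\<close>,
  \<open>node_tl\<close> is the parent, and 0 is the root.\<close>

definition node_cons :: "nat \<Rightarrow> nat \<Rightarrow> nat" where "node_cons n s = Suc (npair n s)"
definition node_len :: "nat \<Rightarrow> nat" where "node_len s = length (list_decode s)"
definition node_tl :: "nat \<Rightarrow> nat" where "node_tl s = (if s = 0 then 0 else nsnd (s - 1))"
text \<open>Positions are counted from the root, so the position of an entry is the length of what
  lies below it; it does not change when the node is extended.\<close>

definition node_entry :: "nat \<Rightarrow> nat \<Rightarrow> nat \<Rightarrow> bool" where
  "node_entry s u v \<longleftrightarrow> (\<exists>k r. (node_tl ^^ k) s = node_cons v r \<and> node_len r = u)"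

lemma node_cons_inj [simp]: "node_cons a b = node_cons c d \<longleftrightarrow> a = c \<and> b = d"
  by (simp add: node_cons_def)

lemma node_cons_neq_0 [simp]: "node_cons a b \<noteq> 0" "0 \<noteq> node_cons a b" "0 < node_cons a b"
  by (auto simp: node_cons_def)

lemma node_cases: obtains "s = 0" | n r where "s = node_cons n r"
  by (cases s) (auto simp: node_cons_def intro: npair_surj, metis npair_surj)

lemma npair_gt: "a \<noteq> 0 \<Longrightarrow> b < npair a b"
proof -
  have "n \<le> triangle n" for n by (induction n) auto
  from this[of "a + b"] show "a \<noteq> 0 \<Longrightarrow> ?thesis" unfolding npair_def prod_encode_def by simp
qed

lemma node_cons_gt: "s < node_cons n s"
  unfolding node_cons_def using npair_rank_le(2)[of s n] by simp

lemma node_induct [case_names root node_cons]: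
  assumes "P 0" "\<And>n s. P s \<Longrightarrow> P (node_cons n s)" shows "P s"
proof (induction s rule: less_induct)
  case (less s)
  then show ?case using assms node_cons_gt by (cases s rule: node_cases) auto
qed

lemma node_tl_simps [simp]: "node_tl 0 = 0" "node_tl (node_cons n s) = s"
  by (auto simp: node_tl_def node_cons_def)

lemma node_tl_pow_0 [simp]: "(node_tl ^^ k) 0 = 0"
  by (induction k) auto

lemma node_tl_eq: "z = node_tl s \<longleftrightarrow> (s = 0 \<and> z = 0) \<or> (\<exists>n. s = Suc (npair n z))"
  unfolding node_cons_def[symmetric] by (cases s rule: node_cases) auto

lemma node_len_simps [simp]: "node_len 0 = 0" "node_len (node_cons n s) = Suc (node_len s)"
  by (auto simp: node_len_def node_cons_def npair_def)

lemma node_len_eq: "z = node_len s \<longleftrightarrow> (node_tl ^^ z) s = 0 \<and> (\<forall>k<z. (node_tl ^^ k) s \<noteq> 0)"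
proof (induction s arbitrary: z rule: node_induct)
  case root
  then show ?case by auto
next
  case (node_cons n s)
  show ?case
  proof (cases z)
    case (Suc y)
    then show ?thesis using node_cons[of y] by (auto simp: funpow_Suc_right All_less_Suc2 simp del: funpow.simps)
  qed simp
qed

lemma node_entry_0 [simp]: "\<not> node_entry 0 u v"
  unfolding node_entry_def by auto

lemma node_entry_node_cons [simp]: "node_entry (node_cons n s) u v \<longleftrightarrow> (u = node_len s \<and> v = n) \<or> node_entry s u v"
proof -
  have *: "(\<exists>k. P k) \<longleftrightarrow> P 0 \<or> (\<exists>k. P (Suc k))" for P :: "nat \<Rightarrow> bool" by (metis not0_implies_Suc)
  show ?thesis unfolding node_entry_def
    by (subst *) (auto simp: funpow_Suc_right simp del: funpow.simps)
qed

lemma Delta_fun_node_tl: "Delta_fun f \<Longrightarrow> Delta_fun (\<lambda>e E. node_tl (f e E))"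
  by (rule Delta_fun_comp1, unfold node_tl_eq) (intro definability_rules)

lemma Delta_fun_node_cons: "Delta_fun f \<Longrightarrow> Delta_fun g \<Longrightarrow> Delta_fun (\<lambda>e E. node_cons (f e E) (g e E))"
  unfolding node_cons_def by (intro definability_rules)

lemma Delta_fun_node_len: "Delta_fun f \<Longrightarrow> Delta_fun (\<lambda>e E. node_len (f e E))"
  by (rule Delta_fun_comp1, unfold node_len_eq) (intro definability_rules Delta_fun_funpow Delta_fun_node_tl)

lemma Delta_pred_node_entry: "Delta_fun f \<Longrightarrow> Delta_fun g \<Longrightarrow> Delta_fun h \<Longrightarrow> Delta_pred (\<lambda>e E. node_entry (f e E) (g e E) (h e E))"
  by (rule Delta_pred_comp3, unfold node_entry_def) (intro definability_rules Delta_fun_funpow Delta_fun_node_tl Delta_fun_node_cons Delta_fun_node_len)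

primrec path_node :: "(nat \<Rightarrow> nat) \<Rightarrow> nat \<Rightarrow> nat" where
  "path_node f 0 = 0" | "path_node f (Suc k) = node_cons (f k) (path_node f k)"

lemma node_len_path_node [simp]: "node_len (path_node f k) = k" by (induction k) auto

lemma node_entry_path_node: "node_entry (path_node f k) u v \<longleftrightarrow> u < k \<and> v = f u"
  by (induction k) (auto simp: less_Suc_eq)

text \<open>Bit strings are also represented by numbers, in binary with a leading digit 1.\<close>

definition str_bit :: "nat \<Rightarrow> nat \<Rightarrow> bool" where
  "str_bit p i \<longleftrightarrow> (\<exists>d q r. p = (2 * q + 1) * 2 ^ d + r \<and> r < 2 ^ d \<and> 2 ^ i \<le> q \<and> q < 2 ^ Suc i)"

primrec prefix_num :: "cantor \<Rightarrow> nat \<Rightarrow> nat" where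
  "prefix_num Y 0 = 1" | "prefix_num Y (Suc l) = 2 * prefix_num Y l + of_bool (Y l)"

lemma prefix_num_level: "2 ^ l \<le> prefix_num Y l" "prefix_num Y l < 2 ^ Suc l"
  by (induction l) auto

lemma level_unique:
  fixes p :: nat assumes "2 ^ l \<le> p" "p < 2 ^ Suc l" "2 ^ k \<le> p" "p < 2 ^ Suc k" shows "l = k"
proof -
  have "(2::nat) ^ l < 2 ^ Suc k" "(2::nat) ^ k < 2 ^ Suc l" using assms by linarith+
  then have "l < Suc k" "k < Suc l"
    using power_less_imp_less_exp[of "2::nat" l "Suc k"] power_less_imp_less_exp[of "2::nat" k "Suc l"] by simp_all
  then show ?thesis by simp
qed

lemma str_bit_1: "\<not> str_bit 1 i"
proof
  assume "str_bit 1 i"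
  then obtain d q r where *: "1 = (2 * q + 1) * 2 ^ d + r" "2 ^ i \<le> (q::nat)" unfolding str_bit_def by auto
  then have "1 \<le> q" using one_le_power[of "2::nat" i] by linarith
  then have "3 * 1 \<le> (2 * q + 1) * (2 ^ d :: nat)" by (intro mult_le_mono) auto
  with *(1) show False by linarith
qed

text \<open>In \<open>str_bit\<close>, \<open>q\<close> is the number of the string of the first
  \<open>i\<close> bits, the digit after it is 1, and \<open>r\<close> holds the \<open>d\<close>
  remaining digits. Appending a digit raises \<open>d\<close> by one for the old bits; the new bit
  is the case \<open>d = 0\<close>.\<close>

lemma str_bit_step:
  assumes "b \<le> 1"
  shows "str_bit (2 * p + b) i \<longleftrightarrow> str_bit p i \<or> (b = 1 \<and> 2 ^ i \<le> p \<and> p < 2 ^ Suc i)"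
proof
  assume "str_bit (2 * p + b) i"
  then obtain d q r where *: "2 * p + b = (2 * q + 1) * 2 ^ d + r" "r < 2 ^ d" "2 ^ i \<le> q" "q < 2 ^ Suc i"
    unfolding str_bit_def by blast
  show "str_bit p i \<or> (b = 1 \<and> 2 ^ i \<le> p \<and> p < 2 ^ Suc i)"
  proof (cases d)
    case 0
    then have "2 * p + b = 2 * q + 1" using * by simp
    then have "b = 1 \<and> p = q" using assms by presburger
    then show ?thesis using * by auto
  next
    case (Suc d')
    then have "2 * p + b = 2 * ((2 * q + 1) * 2 ^ d') + r" using * by simp
    then have "p = (2 * q + 1) * 2 ^ d' + r div 2" using assms by presburger
    moreover have "r div 2 < 2 ^ d'" using * Suc by auto
    ultimately show ?thesis using * unfolding str_bit_def by blast
  qed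
next
  assume "str_bit p i \<or> (b = 1 \<and> 2 ^ i \<le> p \<and> p < 2 ^ Suc i)"
  then show "str_bit (2 * p + b) i"
  proof
    assume "str_bit p i"
    then obtain d q r where *: "p = (2 * q + 1) * 2 ^ d + r" "r < 2 ^ d" "2 ^ i \<le> q" "q < 2 ^ Suc i"
      unfolding str_bit_def by blast
    then have "2 * p + b = (2 * q + 1) * 2 ^ Suc d + (2 * r + b) \<and> 2 * r + b < 2 ^ Suc d"
      using assms by auto
    then show ?thesis using * unfolding str_bit_def by blast
  next
    assume "b = 1 \<and> 2 ^ i \<le> p \<and> p < 2 ^ Suc i"
    then show ?thesis unfolding str_bit_def by (intro exI[of _ 0] exI[of _ p]) auto
  qed
qed

lemma str_bit_prefix_num: "str_bit (prefix_num Y l) i \<longleftrightarrow> i < l \<and> Y i"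
proof (induction l)
  case 0
  then show ?case using str_bit_1 by simp
next
  case (Suc l)
  have "2 ^ i \<le> prefix_num Y l \<and> prefix_num Y l < 2 ^ Suc i \<longleftrightarrow> i = l"
    using level_unique[of i "prefix_num Y l" l] prefix_num_level[where Y=Y and l=l] by auto
  then show ?case using str_bit_step[of "of_bool (Y l)" "prefix_num Y l" i] Suc by (auto simp: less_Suc_eq)
qed

lemma Delta_pred_str_bit: "Delta_fun f \<Longrightarrow> Delta_fun g \<Longrightarrow> Delta_pred (\<lambda>e E. str_bit (f e E) (g e E))"
  by (rule Delta_pred_comp2, unfold str_bit_def) (intro definability_rules Delta_fun_pow2)

section \<open>The universal tree\<close>

text \<open>Every number codes a term, all tags from 4 on meaning \<open>Times\<close>, and likewise
  for formulas. The universal tree therefore needs no test for well-formed codes.\<close>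

function term_of :: "nat \<Rightarrow> arith_term" where
  "term_of z = (if nfst z = 0 then Var (nsnd z) else if nfst z = 1 then Zero
     else if nfst z = 2 then Succ (term_of (nsnd z))
     else if nfst z = 3 then Plus (term_of (nfst (nsnd z))) (term_of (nsnd (nsnd z)))
     else Times (term_of (nfst (nsnd z))) (term_of (nsnd (nsnd z))))"
  by auto

lemma nsnd_less: "nfst z \<noteq> 0 \<Longrightarrow> nsnd z < z"
  using npair_gt[of "nfst z" "nsnd z"] by simp

lemma nproj_rank_le: "nfst z \<le> z" "nsnd z \<le> z"
  using npair_rank_le[of "nfst z" "nsnd z"] npair_rank_le[of "nsnd z" "nfst z"] by simp_all

lemma nproj_nsnd_less: "nfst z \<noteq> 0 \<Longrightarrow> nfst (nsnd z) < z" "nfst z \<noteq> 0 \<Longrightarrow> nsnd (nsnd z) < z"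
  using nsnd_less[of z] nproj_rank_le[of "nsnd z"] by simp_all

termination term_of
  by (relation "Wellfounded.measure id") (auto intro: nsnd_less nproj_nsnd_less)

function form_of :: "nat \<Rightarrow> arith_form" where
  "form_of z = (if nfst z = 0 then Eq (term_of (nfst (nsnd z))) (term_of (nsnd (nsnd z)))
     else if nfst z = 1 then Mem (term_of (nfst (nsnd z))) (nsnd (nsnd z))
     else if nfst z = 2 then Neg (form_of (nsnd z))
     else if nfst z = 3 then Conj (form_of (nfst (nsnd z))) (form_of (nsnd (nsnd z)))
     else All (form_of (nsnd z)))"
  by auto
termination form_of
  by (relation "Wellfounded.measure id") (auto intro: nsnd_less nproj_nsnd_less)

declare term_of.simps [simp del] form_of.simps [simp del]

lemma term_of_npair [simp]:
  "term_of (npair 0 i) = Var i" "term_of (npair (Suc 0) i) = Zero" "term_of (npair 2 t) = Succ (term_of t)"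
  "term_of (npair 3 (npair s t)) = Plus (term_of s) (term_of t)" "term_of (npair (m + 4) (npair s t)) = Times (term_of s) (term_of t)"
  by (subst term_of.simps, simp)+

lemma form_of_npair [simp]:
  "form_of (npair 0 (npair s t)) = Eq (term_of s) (term_of t)" "form_of (npair (Suc 0) (npair t i)) = Mem (term_of t) i"
  "form_of (npair 2 x) = Neg (form_of x)"
  "form_of (npair 3 (npair x y)) = Conj (form_of x) (form_of y)" "form_of (npair (m + 4) x) = All (form_of x)"
  by (subst form_of.simps, simp)+

lemma term_of_surj: "\<exists>z. term_of z = t"
  by (induction t) (metis term_of_npair)+

lemma form_of_surj: "\<exists>z. form_of z = \<phi>"
proof (induction \<phi>)
  case (Eq s t)
  then show ?case using term_of_surj[of s] term_of_surj[of t] form_of_npair(1) by metis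
next
  case (Mem t i)
  then show ?case using term_of_surj[of t] form_of_npair(2) by metis
qed (metis form_of_npair)+

text \<open>Iterated unpairing: entering the scope of a quantifier is one application of
  \<open>npair\<close>, and 0 codes the environment that is constantly 0.\<close>

primrec env_of :: "nat \<Rightarrow> nat \<Rightarrow> nat" where
  "env_of c 0 = nfst c" | "env_of c (Suc i) = env_of (nsnd c) i"

lemma env_of_npair [simp]: "env_of (npair n c) = case_nat n (env_of c)"
  by (auto simp: fun_eq_iff split: nat.split)

lemma env_of_0 [simp]: "env_of 0 = (\<lambda>_. 0)"
proof -
  have "nfst 0 = 0" "nsnd 0 = 0" using nproj_npair(1)[of 0 0] nproj_npair(2)[of 0 0] by simp_all
  then have "env_of 0 i = 0" for i by (induction i) auto
  then show ?thesis by auto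
qed

text \<open>
  An infinite path \<open>f\<close> of the universal tree records a candidate second-order witness together with
  a truth assignment: \<open>f\<close> holds the value of a variable at \<open>lk\<close>, the value of a term at \<open>tm\<close>, and at
  \<open>fm\<close> and \<open>st\<close> it is 0 for truth; for a false universal formula it is the successor of a counterexample.
\<close>

definition lk :: "nat \<Rightarrow> nat \<Rightarrow> nat" where "lk i c = npair 0 (npair i c)"
definition tm :: "nat \<Rightarrow> nat \<Rightarrow> nat" where "tm t c = npair 1 (npair t c)"
definition fm :: "nat \<Rightarrow> nat \<Rightarrow> nat" where "fm x c = npair 2 (npair x c)"
definition st :: "nat \<Rightarrow> nat" where "st i = npair 3 i"

text \<open>These are Tarski's truth clauses, each involving at most three positions of the path.
  Set variable 0 is the guessed set, stored at \<open>st\<close>; set variable 1 is the oracle,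
  whose bit at \<open>v2\<close> enters as \<open>xb\<close>; all others are empty. The last clause
  asks that the formula coded by \<open>nfst a\<close> be false in the environment
  \<open>nsnd a\<close>.\<close>

definition locally_correct :: "nat \<Rightarrow> bool \<Rightarrow> nat \<Rightarrow> nat \<Rightarrow> nat \<Rightarrow> nat \<Rightarrow> nat \<Rightarrow> nat \<Rightarrow> bool" where
  "locally_correct a xb u1 v1 u2 v2 u3 v3 \<longleftrightarrow>
    (\<forall>n c. u1 = lk 0 (npair n c) \<longrightarrow> v1 = n) \<and>
    (\<forall>i n c. u1 = lk (Suc i) (npair n c) \<and> u2 = lk i c \<longrightarrow> v1 = v2) \<and>
    (\<forall>i c. u1 = tm (npair 0 i) c \<and> u2 = lk i c \<longrightarrow> v1 = v2) \<and>
    (\<forall>i c. u1 = tm (npair 1 i) c \<longrightarrow> v1 = 0) \<and>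
    (\<forall>t c. u1 = tm (npair 2 t) c \<and> u2 = tm t c \<longrightarrow> v1 = Suc v2) \<and>
    (\<forall>s t c. u1 = tm (npair 3 (npair s t)) c \<and> u2 = tm s c \<and> u3 = tm t c \<longrightarrow> v1 = v2 + v3) \<and>
    (\<forall>m s t c. u1 = tm (npair (m + 4) (npair s t)) c \<and> u2 = tm s c \<and> u3 = tm t c \<longrightarrow> v1 = v2 * v3) \<and>
    (\<forall>s t c. u1 = fm (npair 0 (npair s t)) c \<and> u2 = tm s c \<and> u3 = tm t c \<longrightarrow> (v1 = 0 \<longleftrightarrow> v2 = v3)) \<and>
    (\<forall>t c. u1 = fm (npair 1 (npair t 0)) c \<and> u2 = tm t c \<and> u3 = st v2 \<longrightarrow> (v1 = 0 \<longleftrightarrow> v3 = 0)) \<and>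
    (\<forall>t c. u1 = fm (npair 1 (npair t 1)) c \<and> u2 = tm t c \<longrightarrow> (v1 = 0 \<longleftrightarrow> xb)) \<and>
    (\<forall>t i c. u1 = fm (npair 1 (npair t (i + 2))) c \<longrightarrow> v1 \<noteq> 0) \<and>
    (\<forall>x c. u1 = fm (npair 2 x) c \<and> u2 = fm x c \<longrightarrow> (v1 = 0 \<longleftrightarrow> v2 \<noteq> 0)) \<and>
    (\<forall>x y c. u1 = fm (npair 3 (npair x y)) c \<and> u2 = fm x c \<and> u3 = fm y c \<longrightarrow> (v1 = 0 \<longleftrightarrow> v2 = 0 \<and> v3 = 0)) \<and>
    (\<forall>m x n c. u1 = fm (npair (m + 4) x) c \<and> u2 = fm x (npair n c) \<longrightarrow>
       (v1 = 0 \<longrightarrow> v2 = 0) \<and> (v1 = Suc n \<longrightarrow> v2 \<noteq> 0)) \<and>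
    (u1 = fm (nfst a) (nsnd a) \<longrightarrow> v1 \<noteq> 0)"

text \<open>The condition \<open>v2 < node_len s\<close> delays oracle queries, so that a node of
  length \<open>l\<close> depends only on the first \<open>l\<close> bits of \<open>x\<close>. This
  makes the classes at the bottom of the hierarchy clopen.\<close>

definition univ_tree :: "nat \<Rightarrow> cantor \<Rightarrow> nat \<Rightarrow> bool" where
  "univ_tree a x s \<longleftrightarrow> (\<forall>u1 v1 u2 v2 u3 v3. node_entry s u1 v1 \<and> node_entry s u2 v2 \<and> node_entry s u3 v3 \<and> v2 < node_len s \<longrightarrow>
     locally_correct a (x v2) u1 v1 u2 v2 u3 v3)"

lemma univ_tree_cnD: "univ_tree a x (node_cons n s) \<Longrightarrow> univ_tree a x s"
  unfolding univ_tree_def by auto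

lemma univ_tree_cong: "(\<And>i. i < node_len s \<Longrightarrow> x i = y i) \<Longrightarrow> univ_tree a x s \<longleftrightarrow> univ_tree a y s"
  unfolding univ_tree_def by (intro iff_allI imp_cong refl) simp

lemma univ_tree_path_node: "(\<forall>k. univ_tree a x (path_node f k)) \<longleftrightarrow> (\<forall>u1 u2 u3. locally_correct a (x (f u2)) u1 (f u1) u2 (f u2) u3 (f u3))"
proof
  assume *: "\<forall>k. univ_tree a x (path_node f k)"
  show "\<forall>u1 u2 u3. locally_correct a (x (f u2)) u1 (f u1) u2 (f u2) u3 (f u3)"
  proof (intro allI)
    fix u1 u2 u3
    show "locally_correct a (x (f u2)) u1 (f u1) u2 (f u2) u3 (f u3)"
      \<comment> \<open>Long enough to contain all three positions and to permit the query at
        \<open>f u2\<close>.\<close>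
      using *[rule_format, of "Suc (u1 + u2 + u3 + f u2)"] unfolding univ_tree_def node_entry_path_node node_len_path_node by auto
  qed
qed (auto simp: univ_tree_def node_entry_path_node)

lemma Delta_pred_univ_tree: "Delta_fun f \<Longrightarrow> Delta_fun g \<Longrightarrow> Delta_fun h \<Longrightarrow> Delta_pred (\<lambda>e E. univ_tree (f e E) (str_bit (g e E)) (h e E))"
  by (rule Delta_pred_comp3, unfold univ_tree_def locally_correct_def lk_def tm_def fm_def st_def)
    (intro definability_rules Delta_fun_nfst Delta_fun_nsnd Delta_pred_str_bit Delta_pred_node_entry Delta_fun_node_len)

lemma Delta_pred_T0: "Delta_fun f \<Longrightarrow> Delta_fun h \<Longrightarrow> Delta_pred (\<lambda>e E. univ_tree (f e E) (\<lambda>_. False) (h e E))"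
  by (rule Delta_pred_comp2, unfold univ_tree_def locally_correct_def lk_def tm_def fm_def st_def)
    (intro definability_rules Delta_fun_nfst Delta_fun_nsnd Delta_pred_node_entry Delta_fun_node_len)

section \<open>Well-founded nodes and infinite paths\<close>

inductive wf_node :: "(nat \<Rightarrow> bool) \<Rightarrow> nat \<Rightarrow> bool" for S where
  wf_node_leaf: "\<not> S t \<Longrightarrow> wf_node S t"
| wf_node_step: "(\<And>m. wf_node S (node_cons m t)) \<Longrightarrow> wf_node S t"

lemma wf_node_iff_no_path: "wf_node S 0 \<longleftrightarrow> \<not> (\<exists>f. \<forall>k. S (path_node f k))"
proof
  assume "wf_node S 0"
  have "wf_node S t \<Longrightarrow> \<forall>k. S (path_node f k) \<Longrightarrow> \<forall>k. t \<noteq> path_node f k" for t f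
  proof (induction rule: wf_node.induct)
    case (wf_node_step t)
    then show ?case using path_node.simps(2) by metis
  qed auto
  from this[OF \<open>wf_node S 0\<close>] show "\<not> (\<exists>f. \<forall>k. S (path_node f k))" by (metis path_node.simps(1))
next
  assume np: "\<not> (\<exists>f. \<forall>k. S (path_node f k))"
  show "wf_node S 0"
  proof (rule ccontr)
    assume n: "\<not> wf_node S 0"
    have "\<exists>m. \<not> wf_node S (node_cons m t)" if "\<not> wf_node S t" for t
      using that wf_node_step by blast
    then obtain g where g: "\<And>t. \<not> wf_node S t \<Longrightarrow> \<not> wf_node S (node_cons (g t) t)" by metis
    define h where "h = (\<lambda>k. ((\<lambda>t. node_cons (g t) t) ^^ k) 0)"
    have h: "\<not> wf_node S (h k)" for k unfolding h_def by (induction k) (auto simp: n g)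
    have "path_node (\<lambda>k. g (h k)) k = h k" for k unfolding h_def by (induction k) auto
    then have "S (path_node (\<lambda>k. g (h k)) k)" for k using h[of k] wf_node_leaf by metis
    with np show False by blast
  qed
qed

abbreviation two_sets :: "cantor \<Rightarrow> cantor \<Rightarrow> nat \<Rightarrow> cantor" where
  "two_sets Y x \<equiv> case_nat Y (case_nat x (\<lambda>_ _. False))"

lemma tag_cases:
  fixes k :: nat obtains "k = 0" | "k = 1" | "k = 2" | "k = 3" | m where "k = m + 4"
proof (cases "k \<ge> 4")
  case True
  then obtain m where "k = m + 4" using le_iff_add[of 4 k] by (auto simp: add.commute)
  then show ?thesis using that by blast
next
  case False
  then have "k = 0 \<or> k = 1 \<or> k = 2 \<or> k = 3" by linarith
  then show ?thesis using that by blast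
qed

text \<open>A path is a counterexample with Skolem functions. From a path, \<open>Y\<close> is read
  off at the positions \<open>st i\<close>, and induction on codes shows that all other entries are
  the true values. Conversely, the true values together with chosen counterexamples
  \<open>cex\<close> for false universal formulas satisfy every clause.\<close>

lemma univ_tree_path_iff:
  "(\<exists>f. \<forall>k. univ_tree a x (path_node f k)) \<longleftrightarrow> (\<exists>Y. \<not> sat (env_of (nsnd a)) (two_sets Y x) (form_of (nfst a)))"
proof
  assume "\<exists>f. \<forall>k. univ_tree a x (path_node f k)"
  then obtain f where f: "\<And>u1 u2 u3. locally_correct a (x (f u2)) u1 (f u1) u2 (f u2) u3 (f u3)"
    unfolding univ_tree_path_node by auto
  define Y where "Y = (\<lambda>i. f (st i) = 0)"
  have lk: "f (lk i c) = env_of c i" for i c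
  proof (induction i arbitrary: c)
    case 0
    have "c = npair (nfst c) (nsnd c)" by simp
    then show ?case using f[of _ "lk 0 c"] unfolding locally_correct_def by (metis env_of.simps(1))
  next
    case (Suc i)
    have "c = npair (nfst c) (nsnd c)" by simp
    then have "f (lk (Suc i) c) = f (lk i (nsnd c))"
      using f[of "lk i (nsnd c)" "lk (Suc i) c"] unfolding locally_correct_def by metis
    then show ?case using Suc by simp
  qed
  have tm_eqs: "f (tm (npair 0 i) c) = f (lk i c)" "f (tm (npair 1 i) c) = 0"
    "f (tm (npair 2 t) c) = Suc (f (tm t c))"
    "f (tm (npair 3 (npair s t)) c) = f (tm s c) + f (tm t c)"
    "f (tm (npair (m + 4) (npair s t)) c) = f (tm s c) * f (tm t c)" for i c s t m
  proof -
    show "f (tm (npair 0 i) c) = f (lk i c)"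
      using f[of "lk i c" "tm (npair 0 i) c" 0] by (simp add: locally_correct_def lk_def tm_def fm_def st_def)
    show "f (tm (npair 1 i) c) = 0" using f[of 0 "tm (npair 1 i) c" 0] by (simp add: locally_correct_def lk_def tm_def fm_def st_def)
    show "f (tm (npair 2 t) c) = Suc (f (tm t c))"
      using f[of "tm t c" "tm (npair 2 t) c" 0] by (simp add: locally_correct_def lk_def tm_def fm_def st_def)
    show "f (tm (npair 3 (npair s t)) c) = f (tm s c) + f (tm t c)"
      using f[of "tm s c" "tm (npair 3 (npair s t)) c" "tm t c"] by (simp add: locally_correct_def lk_def tm_def fm_def st_def)
    show "f (tm (npair (m + 4) (npair s t)) c) = f (tm s c) * f (tm t c)"
      using f[of "tm s c" "tm (npair (m + 4) (npair s t)) c" "tm t c"] by (simp add: locally_correct_def lk_def tm_def fm_def st_def)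
  qed
  have tm: "f (tm z c) = eval_term (env_of c) (term_of z)" for z c
  proof (induction z rule: less_induct)
    case (less z)
    obtain k r where z: "z = npair k r" using npair_surj by blast
    obtain s t where r: "r = npair s t" using npair_surj by blast
    have lt: "r < z" "s < z" "t < z" if "k \<noteq> 0"
      using npair_gt[OF that, of r] npair_rank_le(1)[of s t] npair_rank_le(2)[of t s] unfolding z r by linarith+
    consider "k = 0" | "k = 1" | "k = 2" | "k = 3" | m where "k = m + 4"
      by (rule tag_cases)
    then show ?case
    proof cases
      case 1
      then show ?thesis unfolding z by (simp add: tm_eqs lk)
    next
      case 2
      then show ?thesis unfolding z using tm_eqs(2) by simp
    next
      case 3
      then show ?thesis using less[OF lt(1)] unfolding z by (simp add: tm_eqs)
    next
      case 4
      then show ?thesis using less[OF lt(2)] less[OF lt(3)] unfolding z r by (simp add: tm_eqs)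
    next
      case (5 m)
      then show ?thesis using less[OF lt(2)] less[OF lt(3)] unfolding z r by (simp add: tm_eqs)
    qed
  qed
  have fm_eqs: "f (fm (npair 0 (npair s t)) c) = 0 \<longleftrightarrow> f (tm s c) = f (tm t c)"
    "f (fm (npair 1 (npair t 0)) c) = 0 \<longleftrightarrow> Y (f (tm t c))"
    "f (fm (npair 1 (npair t 1)) c) = 0 \<longleftrightarrow> x (f (tm t c))"
    "f (fm (npair 1 (npair t (i + 2))) c) \<noteq> 0"
    "f (fm (npair 2 y) c) = 0 \<longleftrightarrow> f (fm y c) \<noteq> 0"
    "f (fm (npair 3 (npair y y')) c) = 0 \<longleftrightarrow> f (fm y c) = 0 \<and> f (fm y' c) = 0" for c s t i y y'
  proof -
    show "f (fm (npair 0 (npair s t)) c) = 0 \<longleftrightarrow> f (tm s c) = f (tm t c)"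
      using f[of "tm s c" "fm (npair 0 (npair s t)) c" "tm t c"] by (simp add: locally_correct_def lk_def tm_def fm_def st_def)
    show "f (fm (npair 1 (npair t 0)) c) = 0 \<longleftrightarrow> Y (f (tm t c))"
      using f[of "tm t c" "fm (npair 1 (npair t 0)) c" "st (f (tm t c))"] by (simp add: locally_correct_def lk_def tm_def fm_def st_def Y_def)
    show "f (fm (npair 1 (npair t 1)) c) = 0 \<longleftrightarrow> x (f (tm t c))"
      using f[of "tm t c" "fm (npair 1 (npair t 1)) c" 0] by (simp add: locally_correct_def lk_def tm_def fm_def st_def)
    show "f (fm (npair 1 (npair t (i + 2))) c) \<noteq> 0"
      using f[of 0 "fm (npair 1 (npair t (i + 2))) c" 0] by (simp add: locally_correct_def lk_def tm_def fm_def st_def)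
    show "f (fm (npair 2 y) c) = 0 \<longleftrightarrow> f (fm y c) \<noteq> 0"
      using f[of "fm y c" "fm (npair 2 y) c" 0] by (simp add: locally_correct_def lk_def tm_def fm_def st_def)
    show "f (fm (npair 3 (npair y y')) c) = 0 \<longleftrightarrow> f (fm y c) = 0 \<and> f (fm y' c) = 0"
      using f[of "fm y c" "fm (npair 3 (npair y y')) c" "fm y' c"] by (simp add: locally_correct_def lk_def tm_def fm_def st_def)
  qed
  have fm_all: "f (fm (npair (m + 4) y) c) = 0 \<longleftrightarrow> (\<forall>n. f (fm y (npair n c)) = 0)" for m y c
  proof
    assume "f (fm (npair (m + 4) y) c) = 0"
    then have "f (fm y (npair n c)) = 0" for n
      using f[of "fm y (npair n c)" "fm (npair (m + 4) y) c" 0] by (simp add: locally_correct_def lk_def tm_def fm_def st_def)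
    then show "\<forall>n. f (fm y (npair n c)) = 0" ..
  next
    assume *: "\<forall>n. f (fm y (npair n c)) = 0"
    show "f (fm (npair (m + 4) y) c) = 0"
    proof (rule ccontr)
      assume "f (fm (npair (m + 4) y) c) \<noteq> 0"
      then obtain n where "f (fm (npair (m + 4) y) c) = Suc n" using not0_implies_Suc by blast
      then have "f (fm y (npair n c)) \<noteq> 0"
        using f[of "fm y (npair n c)" "fm (npair (m + 4) y) c" 0] by (simp add: locally_correct_def lk_def tm_def fm_def st_def)
      with * show False by simp
    qed
  qed
  have "(f (fm z c) = 0) \<longleftrightarrow> sat (env_of c) (two_sets Y x) (form_of z)" for z c
  proof (induction z arbitrary: c rule: less_induct)
    case (less z)
    obtain k r where z: "z = npair k r" using npair_surj by blast
    obtain s t where r: "r = npair s t" using npair_surj by blast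
    have lt: "r < z" "s < z" "t < z" if "k \<noteq> 0"
      using npair_gt[OF that, of r] npair_rank_le(1)[of s t] npair_rank_le(2)[of t s] unfolding z r by linarith+
    consider "k = 0" | "k = 1" | "k = 2" | "k = 3" | m where "k = m + 4"
      by (rule tag_cases)
    then show ?case
    proof cases
      case 1
      then show ?thesis unfolding z r by (simp add: fm_eqs tm)
    next
      case 2
      consider "t = 0" | "t = 1" | i where "t = i + 2"
        by (metis One_nat_def Suc_1 add_2_eq_Suc' not0_implies_Suc)
      then show ?thesis unfolding z r 2
        by cases (use fm_eqs(2,3,4) in \<open>simp_all add: tm\<close>)
    next
      case 3
      then show ?thesis using less[OF lt(1)] unfolding z by (simp add: fm_eqs)
    next
      case 4
      then show ?thesis using less[OF lt(2)] less[OF lt(3)] unfolding z r by (simp add: fm_eqs)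
    next
      case (5 m)
      then show ?thesis using less[OF lt(1)] unfolding z by (simp add: fm_all)
    qed
  qed
  moreover have "f (fm (nfst a) (nsnd a)) \<noteq> 0"
    using f[of 0 "fm (nfst a) (nsnd a)" 0] unfolding locally_correct_def by (elim conjE mp) (rule refl)
  ultimately show "\<exists>Y. \<not> sat (env_of (nsnd a)) (two_sets Y x) (form_of (nfst a))" by metis
next
  assume "\<exists>Y. \<not> sat (env_of (nsnd a)) (two_sets Y x) (form_of (nfst a))"
  then obtain Y where Y: "\<not> sat (env_of (nsnd a)) (two_sets Y x) (form_of (nfst a))" by auto
  define cex where "cex = (\<lambda>z c. case form_of z of All \<phi> \<Rightarrow> (SOME n. \<not> sat (case_nat n (env_of c)) (two_sets Y x) \<phi>) | _ \<Rightarrow> 0)"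
  define f where "f = (\<lambda>u. let r = nsnd u; z = nfst r; c = nsnd r in
    if nfst u = 0 then env_of c z else if nfst u = 1 then eval_term (env_of c) (term_of z)
    else if nfst u = 2 then (if sat (env_of c) (two_sets Y x) (form_of z) then 0 else Suc (cex z c))
    else if Y r then 0 else 1)"
  have f: "f (lk i c) = env_of c i" "f (tm t c) = eval_term (env_of c) (term_of t)"
    "f (fm z c) = (if sat (env_of c) (two_sets Y x) (form_of z) then 0 else Suc (cex z c))"
    "f (st i) = (if Y i then 0 else 1)" for i c t z
    unfolding f_def lk_def tm_def fm_def st_def Let_def by simp_all
  have cex: "\<not> sat (case_nat (cex (npair (m + 4) z) c) (env_of c)) (two_sets Y x) (form_of z)"
    if "\<not> sat (case_nat n (env_of c)) (two_sets Y x) (form_of z)" for m z c n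
    unfolding cex_def using that by (simp, metis (mono_tags, lifting) someI_ex)
  have "locally_correct a (x (f u2)) u1 (f u1) u2 (f u2) u3 (f u3)" for u1 u2 u3
    unfolding locally_correct_def
    apply (intro conjI allI impI; (elim conjE)?; simp add: f Y split: if_splits)
    using cex by blast
  then show "\<exists>f. \<forall>k. univ_tree a x (path_node f k)" using univ_tree_path_node by blast
qed

section \<open>Comparison of ranks\<close>

text \<open>\<open>rank_le S S' s t\<close>: the rank of \<open>s\<close> in \<open>S\<close> is at most the rank of \<open>t\<close> in \<open>S'\<close>, where nodes
  outside the tree have the least rank.\<close>

inductive rank_le :: "(nat \<Rightarrow> bool) \<Rightarrow> (nat \<Rightarrow> bool) \<Rightarrow> nat \<Rightarrow> nat \<Rightarrow> bool" for S S' where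
  rank_le_leaf: "\<not> S' t \<Longrightarrow> \<not> S s \<Longrightarrow> rank_le S S' s t"
| rank_le_step: "S' t \<Longrightarrow> \<forall>n. \<exists>m. rank_le S S' (node_cons n s) (node_cons m t) \<Longrightarrow> rank_le S S' s t"

definition tree :: "(nat \<Rightarrow> bool) \<Rightarrow> bool" where
  "tree S \<longleftrightarrow> (\<forall>n s. S (node_cons n s) \<longrightarrow> S s)"

lemma rank_le_in: "S' t \<Longrightarrow> rank_le S S' s t \<longleftrightarrow> (\<forall>n. \<exists>m. rank_le S S' (node_cons n s) (node_cons m t))"
  using rank_le.cases rank_le_step by metis

lemma rank_le_out: "\<not> S' t \<Longrightarrow> rank_le S S' s t \<longleftrightarrow> \<not> S s"
  using rank_le.cases rank_le_leaf by metis

text \<open>Well-foundedness of \<open>t\<close> matters because \<open>rank_le\<close> is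
  inductive: while \<open>t\<close> is in its tree, the derivation has to pass to children of
  \<open>t\<close>.\<close>

lemma rank_le_not_in:
  assumes "wf_node S' t" "tree S" shows "\<not> S s \<Longrightarrow> rank_le S S' s t"
  using assms(1)
proof (induction arbitrary: s rule: wf_node.induct)
  case (wf_node_leaf t)
  then show ?case by (simp add: rank_le_leaf)
next
  case (wf_node_step t)
  then have "\<not> S (node_cons n s)" for n using assms(2) unfolding tree_def by blast
  then have "rank_le S S' (node_cons n s) (node_cons m t)" for n m using wf_node_step.IH by blast
  then show ?case using wf_node_step.prems rank_le_leaf rank_le_step by metis
qed

lemma rank_le_trans':
  assumes "tree S" "tree S'" "rank_le S' S'' t r" shows "rank_le S S' s t \<Longrightarrow> rank_le S S'' s r"
  using assms(3)
proof (induction arbitrary: s rule: rank_le.induct)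
  case (rank_le_leaf r t)
  then show ?case using rank_le_out by (metis rank_le.rank_le_leaf)
next
  case (rank_le_step r t)
  have "\<forall>n. \<exists>k. rank_le S S'' (node_cons n s) (node_cons k r)"
  proof
    fix n
    have "\<exists>m. rank_le S S' (node_cons n s) (node_cons m t)"
    proof (cases "S' t")
      case True
      then show ?thesis using rank_le_step.prems rank_le_in by metis
    next
      case False
      then have "\<not> S (node_cons n s)" "\<not> S' (node_cons 0 t)"
        using rank_le_step.prems rank_le_out assms(1,2) unfolding tree_def by metis+
      then show ?thesis by (metis rank_le_leaf)
    qed
    then show "\<exists>k. rank_le S S'' (node_cons n s) (node_cons k r)" using rank_le_step.IH by metis
  qed
  then show ?case using rank_le_step(1) rank_le.rank_le_step by metis
qed

text \<open>If the comparison fails at \<open>s\<close> and \<open>t\<close>, some child of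
  \<open>s\<close> is not below any child of \<open>t\<close>. By induction it is above all of
  them.\<close>

lemma rank_le_total:
  assumes "wf_node S' t" "tree S" "tree S'" shows "\<not> rank_le S S' s t \<Longrightarrow> wf_node S s \<Longrightarrow> rank_le S' S t s"
  using assms(1)
proof (induction arbitrary: s rule: wf_node.induct)
  case (wf_node_leaf t)
  then show ?case by (intro rank_le_not_in assms)
next
  case (wf_node_step t)
  show ?case
  proof (cases "S' t")
    case False
    then show ?thesis using wf_node_step.prems by (intro rank_le_not_in assms)
  next
    case True
    have s: "S s" using rank_le_not_in[OF wf_node.wf_node_step, of S' t S s] wf_node_step assms by blast
    obtain n where n: "\<And>m. \<not> rank_le S S' (node_cons n s) (node_cons m t)"
      using wf_node_step.prems(1) rank_le_in[of S' t S s, OF True] by metis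
    have "wf_node S (node_cons n s)" using wf_node_step.prems(2) s by cases auto
    then have "rank_le S' S (node_cons m t) (node_cons n s)" for m using n wf_node_step.IH by blast
    then show ?thesis using s rank_le_step by metis
  qed
qed

text \<open>The strict version of totality: if \<open>s\<close> has greater rank than
  \<open>t\<close>, already a child of \<open>s\<close> has rank at least that of \<open>t\<close>.
  This provides the one extra level needed in \<open>not_in_all_children\<close>.\<close>

lemma rank_le_child:
  assumes "wf_node S' t" "tree S" "tree S'"
  shows "\<not> rank_le S S' s t \<Longrightarrow> wf_node S s \<Longrightarrow> S s \<and> (\<exists>n. rank_le S' S t (node_cons n s))"
  using assms(1)
proof (induction arbitrary: s rule: wf_node.induct)
  case (wf_node_leaf t)
  then have s: "S s" using rank_le_leaf by blast
  then have "wf_node S (node_cons 0 s)" using wf_node_leaf by (metis wf_node.cases)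
  then show ?case using s rank_le_not_in assms wf_node_leaf by metis
next
  case (wf_node_step t)
  have s: "S s" using rank_le_not_in[OF wf_node.wf_node_step, of S' t S s] wf_node_step assms by blast
  then have w: "wf_node S (node_cons n s)" for n using wf_node_step.prems by (metis wf_node.cases)
  show ?case
  proof (cases "S' t")
    case False
    then show ?thesis using s rank_le_not_in[OF w assms(3)] by blast
  next
    case True
    obtain n where n: "\<And>m. \<not> rank_le S S' (node_cons n s) (node_cons m t)"
      using wf_node_step.prems(1) rank_le_in[of S' t S s, OF True] by metis
    then have *: "S (node_cons n s) \<and> (\<exists>j. rank_le S' S (node_cons m t) (node_cons j (node_cons n s)))" for m
      using wf_node_step.IH w by blast
    then have "rank_le S' S t (node_cons n s)" using rank_le_step by metis
    then show ?thesis using s by blast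
  qed
qed

lemma rank_le_wf_node: "rank_le S S' s t \<Longrightarrow> wf_node S s"
proof (induction rule: rank_le.induct)
  case (rank_le_leaf t s)
  then show ?case by (simp add: wf_node_leaf)
next
  case (rank_le_step t s)
  then show ?case using wf_node_step by metis
qed

lemma wf_node_all: assumes "wf_node S 0" "tree S" shows "wf_node S t"
proof (induction t rule: node_induct)
  case (node_cons n s)
  from node_cons show ?case
  proof cases
    case wf_node_leaf
    then show ?thesis using assms(2) unfolding tree_def by (metis wf_node.wf_node_leaf)
  qed
qed (fact assms)

lemma tree_univ_tree [simp]: "tree (univ_tree a x)"
  unfolding tree_def using univ_tree_cnD by blast

section \<open>A universal \<open>\<Pi>\<^sup>1\<^sub>1\<close> set\<close>

text \<open>With the empty oracle the trees no longer depend on a sequence. The well-founded ones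
  act as notations for ordinals, and their indices form a complete Pi^1_1 set by
  \<open>Univ_iff\<close>.\<close>

definition num_tree :: "nat \<Rightarrow> nat \<Rightarrow> bool" where "num_tree b = univ_tree b (\<lambda>_. False)"
definition Univ :: "nat \<Rightarrow> bool" where "Univ b \<longleftrightarrow> wf_node (num_tree b) 0"

lemma tree_num_tree [simp]: "tree (num_tree b)"
  by (simp add: num_tree_def)

lemma Univ_wf_node: "Univ b \<Longrightarrow> wf_node (num_tree b) t"
  unfolding Univ_def by (rule wf_node_all) auto

lemma Delta_pred_num_tree: "Delta_fun f \<Longrightarrow> Delta_fun h \<Longrightarrow> Delta_pred (\<lambda>e E. num_tree (f e E) (h e E))"
  unfolding num_tree_def by (rule Delta_pred_T0)

text \<open>Membership in an inductively defined set is membership in every set closed under its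
  clauses, which is a single universal set quantifier.\<close>

lemma Univ_alt: "Univ b \<longleftrightarrow> (\<forall>Z. (\<forall>t. (\<not> num_tree b t \<or> (\<forall>m. Z (node_cons m t))) \<longrightarrow> Z t) \<longrightarrow> Z 0)"
proof
  assume "Univ b"
  show "\<forall>Z. (\<forall>t. (\<not> num_tree b t \<or> (\<forall>m. Z (node_cons m t))) \<longrightarrow> Z t) \<longrightarrow> Z 0"
  proof (intro allI impI)
    fix Z
    assume Z: "\<forall>t. (\<not> num_tree b t \<or> (\<forall>m. Z (node_cons m t))) \<longrightarrow> Z t"
    have "wf_node (num_tree b) t \<Longrightarrow> Z t" for t
    proof (induction rule: wf_node.induct)
      case (wf_node_leaf t)
      with Z show ?case by blast
    next
      case (wf_node_step t)
      then show ?case using Z[rule_format, of t] by blast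
    qed
    with \<open>Univ b\<close> show "Z 0" unfolding Univ_def by blast
  qed
next
  assume "\<forall>Z. (\<forall>t. (\<not> num_tree b t \<or> (\<forall>m. Z (node_cons m t))) \<longrightarrow> Z t) \<longrightarrow> Z 0"
  note spec[OF this, of "wf_node (num_tree b)"]
  moreover have "\<forall>t. (\<not> num_tree b t \<or> (\<forall>m. wf_node (num_tree b) (node_cons m t))) \<longrightarrow> wf_node (num_tree b) t"
    by (blast intro: wf_node_leaf wf_node_step)
  ultimately show "Univ b" unfolding Univ_def by blast
qed

lemma Pi_pred_comp1: "Pi_pred (\<lambda>e E. R (e 0)) \<Longrightarrow> Delta_fun f \<Longrightarrow> Pi_pred (\<lambda>e E. R (f e E))"
  using Pi_pred_comp[of "\<lambda>z e E. R z"] by simp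

lemma Pi_pred_Univ: "Delta_fun f \<Longrightarrow> Pi_pred (\<lambda>e E. Univ (f e E))"
  by (rule Pi_pred_comp1, unfold Univ_alt) (intro Pi_pred_allset Delta_pred_Pi_pred(1) definability_rules Delta_pred_num_tree Delta_fun_node_cons)

text \<open>For well-founded \<open>num_tree c\<close> the recursion equations have exactly one
  solution \<open>L\<close>, so this Pi^1_1 condition is the failure of \<open>rank_le\<close>. No
  assumption on \<open>b\<close> is involved: an ill-founded \<open>num_tree b\<close> is never
  below.\<close>

definition not_rank_le :: "nat \<Rightarrow> nat \<Rightarrow> bool" where
  "not_rank_le b c \<longleftrightarrow> (\<forall>L. (\<forall>s t. L (npair s t) \<longleftrightarrow> (num_tree c t \<and> (\<forall>n. \<exists>m. L (npair (node_cons n s) (node_cons m t)))) \<or>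
     (\<not> num_tree c t \<and> \<not> num_tree b s)) \<longrightarrow> \<not> L (npair 0 0))"

lemma Pi_pred_not_rank_le: "Delta_fun f \<Longrightarrow> Delta_fun g \<Longrightarrow> Pi_pred (\<lambda>e E. not_rank_le (f e E) (g e E))"
  by (rule Pi_pred_comp2, unfold not_rank_le_def) (intro Pi_pred_allset Delta_pred_Pi_pred(1) definability_rules Delta_pred_num_tree Delta_fun_node_cons)

lemma not_rank_le_iff: assumes "Univ c" shows "not_rank_le b c \<longleftrightarrow> \<not> rank_le (num_tree b) (num_tree c) 0 0"
proof -
  have uniq: "L (npair s t) \<longleftrightarrow> rank_le (num_tree b) (num_tree c) s t"
    if L: "\<And>s t. L (npair s t) \<longleftrightarrow> (num_tree c t \<and> (\<forall>n. \<exists>m. L (npair (node_cons n s) (node_cons m t)))) \<or> (\<not> num_tree c t \<and> \<not> num_tree b s)"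
    for L s t
    using Univ_wf_node[OF assms, of t]
  proof (induction arbitrary: s rule: wf_node.induct)
    case (wf_node_leaf t)
    then show ?case by (subst L) (simp add: rank_le_out)
  next
    case (wf_node_step t)
    then show ?case by (cases "num_tree c t"; subst L) (auto simp: rank_le_out rank_le_in)
  qed
  show ?thesis
  proof
    assume n: "not_rank_le b c"
    define L where "L = (\<lambda>z. rank_le (num_tree b) (num_tree c) (nfst z) (nsnd z))"
    have "\<forall>s t. L (npair s t) \<longleftrightarrow> (num_tree c t \<and> (\<forall>n. \<exists>m. L (npair (node_cons n s) (node_cons m t)))) \<or> (\<not> num_tree c t \<and> \<not> num_tree b s)"
      unfolding L_def nproj_npair using rank_le_in rank_le_out by metis
    then have "\<not> L (npair 0 0)" using n unfolding not_rank_le_def by blast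
    then show "\<not> rank_le (num_tree b) (num_tree c) 0 0" by (simp add: L_def nproj_eq[symmetric] del: npair_0)
  next
    assume n: "\<not> rank_le (num_tree b) (num_tree c) 0 0"
    show "not_rank_le b c" unfolding not_rank_le_def
    proof (intro allI impI)
      fix L
      assume "\<forall>s t. L (npair s t) \<longleftrightarrow> (num_tree c t \<and> (\<forall>n. \<exists>m. L (npair (node_cons n s) (node_cons m t)))) \<or> (\<not> num_tree c t \<and> \<not> num_tree b s)"
      from uniq[OF this[rule_format], of 0 0] n show "\<not> L (npair 0 0)" by blast
    qed
  qed
qed

lemma Univ_iff: "Univ a \<longleftrightarrow> (\<forall>Y. sat (env_of (nsnd a)) (case_nat Y (\<lambda>_ _. False)) (form_of (nfst a)))"
proof -
  have "case_nat (\<lambda>_. False) (\<lambda>_ _. False) = ((\<lambda>_ _. False) :: nat \<Rightarrow> cantor)"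
    by (auto simp: fun_eq_iff split: nat.split)
  then show ?thesis
    unfolding Univ_def num_tree_def wf_node_iff_no_path univ_tree_path_iff by simp
qed

text \<open>Diagonalization: the index \<open>npair n (npair n 0)\<close> evaluates formula
  \<open>n\<close> at its own code.\<close>

lemma Univ_not_Delta: "\<not> Pi11_set {b. \<not> Univ b}"
proof
  assume "Pi11_set {b. \<not> Univ b}"
  then have "Pi_pred (\<lambda>e E. e 0 \<in> {b. \<not> Univ b})" by (rule Pi_pred_Pi11_set)
  then have n: "Pi_pred (\<lambda>e E. \<not> Univ (e 0))" by simp
  have "Pi_pred (\<lambda>e E. \<not> Univ (npair (e 0) (npair (e 0) 0)))"
    by (rule Pi_pred_comp1[OF n]) (intro definability_rules)
  from Pi11_set_Pi_pred[OF this] obtain \<phi> where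
    \<phi>: "{n. \<not> Univ (npair n (npair n 0))} = {n. \<forall>Y. sat (case_nat n (\<lambda>_. 0)) (case_nat Y (\<lambda>_ _. False)) \<phi>}"
    unfolding Pi11_set_def by auto
  obtain n where n: "form_of n = \<phi>" using form_of_surj by blast
  have "Univ (npair n (npair n 0)) \<longleftrightarrow> (\<forall>Y. sat (case_nat n (\<lambda>_. 0)) (case_nat Y (\<lambda>_ _. False)) \<phi>)"
    unfolding Univ_iff by (simp add: n)
  with \<phi> show False by blast
qed

text \<open>If \<open>b\<close> had maximal rank, not being in \<open>Univ\<close> would amount to
  \<open>not_rank_le a b\<close> for each index \<open>a\<close>, a Pi^1_1 condition, against
  \<open>Univ_not_Delta\<close>.\<close>

lemma Univ_no_max: "\<exists>b'. Univ b' \<and> \<not> rank_le (num_tree b') (num_tree b) 0 0" if "Univ b"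
proof (rule ccontr)
  assume "\<not> ?thesis"
  then have "Univ a \<longleftrightarrow> rank_le (num_tree a) (num_tree b) 0 0" for a using rank_le_wf_node unfolding Univ_def by metis
  then have *: "\<not> Univ a \<longleftrightarrow> not_rank_le a b" for a using not_rank_le_iff[OF that] by simp
  have "Pi_pred (\<lambda>e E. not_rank_le (e 0) b)" by (intro Pi_pred_not_rank_le Delta_fun_var Delta_fun_const)
  from Pi11_set_Pi_pred[OF this] Univ_not_Delta show False by (simp add: *)
qed

lemma Univ_nonempty: "\<exists>b. Univ b"
proof (rule ccontr)
  assume "\<not> ?thesis"
  moreover have "Pi_pred (\<lambda>e E. True)" by (intro Delta_pred_Pi_pred(1) Delta_pred_bool)
  from Pi11_set_Pi_pred[OF this] have "Pi11_set UNIV" by simp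
  ultimately show False using Univ_not_Delta by simp
qed

section \<open>Open sets and the uniform measure\<close>

abbreviation "mu \<equiv> measure cantor_measure"

lemma space_cantor [simp]: "space cantor_measure = UNIV"
  by (simp add: cantor_measure_def space_PiM)

interpretation cantor: prob_space cantor_measure
  unfolding cantor_measure_def by (intro prob_space_PiM measure_pmf.prob_space_axioms)

section \<open>Numbered strings and the measure of levels\<close>

lemma measure_box:
  "{Y. \<forall>i<l. Y i = b i} \<in> sets cantor_measure \<and> mu {Y. \<forall>i<l. Y i = b i} = 1 / 2 ^ l"
proof -
  interpret product_prob_space "\<lambda>_. measure_pmf (bernoulli_pmf (1/2))" "UNIV :: nat set"
    by unfold_locales
  have eq: "{Y. \<forall>i<l. Y i = b i} = prod_emb UNIV (\<lambda>_. measure_pmf (bernoulli_pmf (1/2))) {..<l} (PiE {..<l} (\<lambda>i. {b i}))"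
    by (auto simp: prod_emb_def PiE_def Pi_def extensional_def)
  have 1: "mu {Y. \<forall>i<l. Y i = b i} = (\<Prod>i<l. measure (measure_pmf (bernoulli_pmf (1/2))) {b i})"
    unfolding eq cantor_measure_def by (rule measure_PiM_emb) auto
  also have "\<dots> = (\<Prod>i<l. 1/2)"
    by (intro prod.cong) (simp_all add: measure_pmf_single pmf_bernoulli_True pmf_bernoulli_False pmf.rep_eq[symmetric] split: bool.split, (metis (full_types) pmf_bernoulli_False pmf_bernoulli_True)?)
  finally show ?thesis unfolding eq cantor_measure_def
    by (auto simp: power_divide intro!: sets_PiM_I)
qed

lemma prefix_num_surj: "2 ^ l \<le> p \<Longrightarrow> p < 2 ^ Suc l \<Longrightarrow> \<exists>Y. prefix_num Y l = p"
proof (induction l arbitrary: p)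
  case (Suc l)
  then have "2 ^ l \<le> p div 2" "p div 2 < 2 ^ Suc l" by auto
  then obtain Y where Y: "prefix_num Y l = p div 2" using Suc.IH by blast
  have c: "prefix_num Y l = prefix_num Z l" if "\<And>i. i < l \<Longrightarrow> Y i = Z i" for Y Z l
    using that by (induction l) auto
  have "prefix_num (Y(l := odd p)) l = p div 2"
    using c[of l Y "Y(l := odd p)"] Y by simp
  then have "prefix_num (Y(l := odd p)) (Suc l) = p" by (cases "odd p") simp_all
  then show ?case by blast
qed simp

lemma prefix_num_cong: "(\<And>i. i < l \<Longrightarrow> Y i = Z i) \<Longrightarrow> prefix_num Y l = prefix_num Z l"
  by (induction l) auto

lemma measure_prefix_num_eq:
  assumes "2 ^ l \<le> p" "p < 2 ^ Suc l"
  shows "{Y. prefix_num Y l = p} \<in> sets cantor_measure" "mu {Y. prefix_num Y l = p} = 1 / 2 ^ l"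
proof -
  obtain Z where Z: "prefix_num Z l = p" using prefix_num_surj[OF assms] by blast
  have "prefix_num Y l = p \<longleftrightarrow> (\<forall>i<l. Y i = Z i)" for Y
    using str_bit_prefix_num[of Y l] str_bit_prefix_num[of Z l] Z prefix_num_cong[of l Y Z] by metis
  then have "{Y. prefix_num Y l = p} = {Y. \<forall>i<l. Y i = Z i}" by auto
  then show "{Y. prefix_num Y l = p} \<in> sets cantor_measure" "mu {Y. prefix_num Y l = p} = 1 / 2 ^ l"
    using measure_box[of l Z] by auto
qed

definition level_set :: "(nat \<Rightarrow> bool) \<Rightarrow> nat \<Rightarrow> nat set" where
  "level_set S l = {p. p < 2 ^ Suc l \<and> 2 ^ l \<le> p \<and> S p}"

lemma measure_level:
  "{Y. S (prefix_num Y l)} \<in> sets cantor_measure"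
  "mu {Y. S (prefix_num Y l)} = card (level_set S l) / 2 ^ l"
proof -
  have eq: "{Y. S (prefix_num Y l)} = (\<Union>p\<in>level_set S l. {Y. prefix_num Y l = p})"
    using prefix_num_level unfolding level_set_def by blast
  have fin: "finite (level_set S l)" unfolding level_set_def by auto
  show "{Y. S (prefix_num Y l)} \<in> sets cantor_measure"
    unfolding eq using fin measure_prefix_num_eq by (intro sets.finite_UN) (auto simp: level_set_def)
  have "mu {Y. S (prefix_num Y l)} = (\<Sum>p\<in>level_set S l. mu {Y. prefix_num Y l = p})"
    unfolding eq using fin measure_prefix_num_eq
    by (intro cantor.finite_measure_finite_Union) (auto simp: level_set_def disjoint_family_on_def)
  also have "\<dots> = (\<Sum>p\<in>level_set S l. 1 / 2 ^ l)"
    by (intro sum.cong) (auto simp: level_set_def measure_prefix_num_eq)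
  finally show "mu {Y. S (prefix_num Y l)} = card (level_set S l) / 2 ^ l" by simp
qed

definition open_num :: "(nat \<Rightarrow> bool) \<Rightarrow> cantor set" where
  "open_num S = {Y. \<exists>l. S (prefix_num Y l)}"

text \<open>Closure under extension lets a finite conjunction of string predicates describe the
  intersection of the open sets, and makes the measures of the levels increase to that of the open
  set.\<close>

definition ext_closed :: "(nat \<Rightarrow> bool) \<Rightarrow> bool" where
  "ext_closed S \<longleftrightarrow> (\<forall>p. S p \<longrightarrow> S (2 * p) \<and> S (2 * p + 1))"

lemma open_num_sets [measurable, simp]: "open_num S \<in> sets cantor_measure"
proof -
  have "open_num S = (\<Union>l. {Y. S (prefix_num Y l)})" unfolding open_num_def by auto
  then show ?thesis using measure_level(1) by auto
qed

lemma ext_closed_prefix_num: "ext_closed S \<Longrightarrow> S (prefix_num Y l) \<Longrightarrow> l \<le> m \<Longrightarrow> S (prefix_num Y m)"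
proof (induction m)
  case (Suc m)
  then show ?case unfolding ext_closed_def by (cases "l = Suc m") (auto split: if_splits simp: of_bool_def)
qed auto

lemma open_num_fin_inter:
  assumes "\<And>n. n \<le> (N::nat) \<Longrightarrow> ext_closed (A n)"
  shows "open_num (\<lambda>p. \<forall>n\<le>N. A n p) = (\<Inter>n\<in>{..N}. open_num (A n))" "ext_closed (\<lambda>p. \<forall>n\<le>N. A n p)"
proof -
  show "ext_closed (\<lambda>p. \<forall>n\<le>N. A n p)" using assms unfolding ext_closed_def by blast
  have "Y \<in> open_num (\<lambda>p. \<forall>n\<le>N. A n p)" if "\<forall>n\<le>N. \<exists>l. A n (prefix_num Y l)" for Y
  proof -
    have "\<forall>n. \<exists>l. n \<le> N \<longrightarrow> A n (prefix_num Y l)" using that by blast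
    then obtain g where g: "\<And>n. n \<le> N \<Longrightarrow> A n (prefix_num Y (g n))" by metis
    have "g n \<le> Max (g ` {..N})" if "n \<le> N" for n using that by auto
    then have "\<forall>n\<le>N. A n (prefix_num Y (Max (g ` {..N})))" using g assms ext_closed_prefix_num by blast
    then show ?thesis unfolding open_num_def by blast
  qed
  then show "open_num (\<lambda>p. \<forall>n\<le>N. A n p) = (\<Inter>n\<in>{..N}. open_num (A n))" unfolding open_num_def by auto
qed

lemma open_num_conj:
  assumes "ext_closed S" "ext_closed R" shows "open_num (\<lambda>p. S p \<and> R p) = open_num S \<inter> open_num R" "ext_closed (\<lambda>p. S p \<and> R p)"
proof -
  show "ext_closed (\<lambda>p. S p \<and> R p)" using assms unfolding ext_closed_def by blast
  have "Y \<in> open_num (\<lambda>p. S p \<and> R p)" if "S (prefix_num Y l)" "R (prefix_num Y m)" for Y l m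
    using ext_closed_prefix_num[OF assms(1) that(1), of "max l m"] ext_closed_prefix_num[OF assms(2) that(2), of "max l m"]
    unfolding open_num_def by auto
  then show "open_num (\<lambda>p. S p \<and> R p) = open_num S \<inter> open_num R" unfolding open_num_def by auto
qed

lemma open_num_ex: "open_num (\<lambda>p. \<exists>n. A n p) = (\<Union>n. open_num (A n))"
  unfolding open_num_def by auto

lemma lim_level:
  assumes "ext_closed S" shows "(\<lambda>l. mu {Y. S (prefix_num Y l)}) \<longlonglongrightarrow> mu (open_num S)"
proof -
  have "open_num S = (\<Union>l. {Y. S (prefix_num Y l)})" unfolding open_num_def by auto
  moreover have "incseq (\<lambda>l. {Y. S (prefix_num Y l)})"
    unfolding incseq_def using ext_closed_prefix_num[OF assms] by blast
  ultimately show ?thesis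
    using cantor.finite_Lim_measure_incseq[of "\<lambda>l. {Y. S (prefix_num Y l)}"] measure_level(1) by auto
qed

lemma lim_level_diff:
  assumes "ext_closed S" "ext_closed R"
  shows "(\<lambda>l. mu {Y. S (prefix_num Y l) \<and> \<not> R (prefix_num Y l)}) \<longlonglongrightarrow> mu (open_num S - open_num R)"
proof -
  note SR = open_num_conj[OF assms]
  have "mu {Y. S (prefix_num Y l) \<and> \<not> R (prefix_num Y l)} = mu {Y. S (prefix_num Y l)} - mu {Y. S (prefix_num Y l) \<and> R (prefix_num Y l)}" for l
  proof -
    have "{Y. S (prefix_num Y l) \<and> \<not> R (prefix_num Y l)} = {Y. S (prefix_num Y l)} - {Y. S (prefix_num Y l) \<and> R (prefix_num Y l)}" by auto
    then show ?thesis using measure_level(1)[of S l] measure_level(1)[of "\<lambda>p. S p \<and> R p" l]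
      by (simp add: cantor.finite_measure_Diff Collect_mono)
  qed
  moreover have "mu (open_num S - open_num R) = mu (open_num S) - mu (open_num (\<lambda>p. S p \<and> R p))"
  proof -
    have "open_num S - open_num R = open_num S - (open_num S \<inter> open_num R)" by auto
    then show ?thesis unfolding SR by (simp add: cantor.finite_measure_Diff)
  qed
  ultimately show ?thesis using tendsto_diff[OF lim_level[OF assms(1)] lim_level[OF SR(2)]] by simp
qed

section \<open>Canonical open covers\<close>

text \<open>
  Cutting an infinite intersection at the least sufficient index makes the cover unique, so that it can
  be defined both by a universal and by an existential set quantifier.
\<close>

definition tail_small :: "(nat \<Rightarrow> nat \<Rightarrow> bool) \<Rightarrow> nat \<Rightarrow> nat \<Rightarrow> bool" where
  "tail_small A k N \<longleftrightarrow> (\<forall>M. \<exists>m. \<forall>l. m \<le> l \<longrightarrow>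
     card {p. p < 2 ^ Suc l \<and> 2 ^ l \<le> p \<and> (\<forall>n. n \<le> N \<longrightarrow> A n p) \<and> \<not> (\<forall>n. n \<le> M \<longrightarrow> A n p)} * 2 ^ Suc k \<le> 2 ^ l)"

definition finite_cut :: "(nat \<Rightarrow> nat \<Rightarrow> bool) \<Rightarrow> nat \<Rightarrow> nat \<Rightarrow> bool" where
  "finite_cut A k p \<longleftrightarrow> (\<exists>N. tail_small A k N \<and> (\<forall>N'. N' < N \<longrightarrow> \<not> tail_small A k N') \<and> (\<forall>n. n \<le> N \<longrightarrow> A n p))"

definition open_cover :: "(nat \<Rightarrow> bool) \<Rightarrow> cantor set \<Rightarrow> real \<Rightarrow> bool" where
  "open_cover S B \<epsilon> \<longleftrightarrow> ext_closed S \<and> B \<in> sets cantor_measure \<and> B \<subseteq> open_num S \<and> mu (open_num S - B) \<le> \<epsilon>"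

text \<open>The level counts of a difference converge to its measure but need not be monotone, which
  is why \<open>tail_small\<close> speaks of all large \<open>l\<close>. A limit preserves only weak
  inequalities; hence \<open><\<close> in one direction and \<open>\<le>\<close> in the
  other.\<close>

lemma tail_small_iff:
  assumes "\<And>n. ext_closed (A n)"
  shows "(\<forall>M. mu ((\<Inter>n\<in>{..N}. open_num (A n)) - (\<Inter>n\<in>{..M}. open_num (A n))) < 1 / 2 ^ Suc k) \<Longrightarrow> tail_small A k N"
    "tail_small A k N \<Longrightarrow> mu ((\<Inter>n\<in>{..N}. open_num (A n)) - (\<Inter>n\<in>{..M}. open_num (A n))) \<le> 1 / 2 ^ Suc k"
proof -
  define S where "S = (\<lambda>N p. \<forall>n. n \<le> N \<longrightarrow> A n p)"
  have e: "ext_closed (S N)" for N unfolding S_def using open_num_fin_inter(2)[of N A] assms by blast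
  have o: "open_num (S N) = (\<Inter>n\<in>{..N}. open_num (A n))" for N
    unfolding S_def using open_num_fin_inter(1)[of N A] assms by blast
  have lim: "(\<lambda>l. mu {Y. S N (prefix_num Y l) \<and> \<not> S M (prefix_num Y l)}) \<longlonglongrightarrow> mu (open_num (S N) - open_num (S M))" for N M
    by (rule lim_level_diff[OF e e])
  have cnt: "card {p. p < 2 ^ Suc l \<and> 2 ^ l \<le> p \<and> S N p \<and> \<not> S M p} * 2 ^ Suc k \<le> 2 ^ l \<longleftrightarrow>
    mu {Y. S N (prefix_num Y l) \<and> \<not> S M (prefix_num Y l)} \<le> 1 / 2 ^ Suc k" for l N M
  proof -
    define c where "c = card {p. p < 2 ^ Suc l \<and> 2 ^ l \<le> p \<and> S N p \<and> \<not> S M p}"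
    have "c * 2 ^ Suc k \<le> 2 ^ l \<longleftrightarrow> real c * 2 ^ Suc k \<le> 2 ^ l"
      using of_nat_le_iff[of "c * 2 ^ Suc k" "2 ^ l", where 'a=real] by simp
    also have "\<dots> \<longleftrightarrow> real c / 2 ^ l \<le> 1 / 2 ^ Suc k" by (simp add: field_simps)
    finally show ?thesis using measure_level(2)[of "\<lambda>p. S N p \<and> \<not> S M p" l]
      unfolding c_def level_set_def by simp
  qed
  have tl: "tail_small A k N \<longleftrightarrow> (\<forall>M. \<exists>m. \<forall>l\<ge>m. mu {Y. S N (prefix_num Y l) \<and> \<not> S M (prefix_num Y l)} \<le> 1 / 2 ^ Suc k)" for N
    unfolding tail_small_def cnt[symmetric] unfolding S_def by blast
  show "tail_small A k N" if "\<forall>M. mu ((\<Inter>n\<in>{..N}. open_num (A n)) - (\<Inter>n\<in>{..M}. open_num (A n))) < 1 / 2 ^ Suc k"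
    unfolding tl
  proof
    fix M
    have "\<forall>\<^sub>F l in sequentially. mu {Y. S N (prefix_num Y l) \<and> \<not> S M (prefix_num Y l)} < 1 / 2 ^ Suc k"
      using order_tendstoD(2)[OF lim] that unfolding o by blast
    then show "\<exists>m. \<forall>l\<ge>m. mu {Y. S N (prefix_num Y l) \<and> \<not> S M (prefix_num Y l)} \<le> 1 / 2 ^ Suc k"
      unfolding eventually_sequentially using less_imp_le by blast
  qed
  show "mu ((\<Inter>n\<in>{..N}. open_num (A n)) - (\<Inter>n\<in>{..M}. open_num (A n))) \<le> 1 / 2 ^ Suc k" if "tail_small A k N"
    using LIMSEQ_le_const2[OF lim[of N M]] that unfolding tl o by blast
qed

lemma geo_half: "(\<lambda>n. 1 / 2 ^ (k + n + 1) :: real) sums (1 / 2 ^ k)"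
  using sums_mult[OF power_half_series, of "1 / 2 ^ k"]
  by (simp add: power_add power_divide mult_ac)

lemma measure_UN_geo:
  assumes "\<And>n. D n \<in> sets cantor_measure" "\<And>n. mu (D n) \<le> 1 / 2 ^ (k + n + 1)"
  shows "mu (\<Union>n. D n) \<le> 1 / 2 ^ k"
proof -
  have s: "summable (\<lambda>n. mu (D n))"
    by (rule summable_comparison_test'[OF sums_summable[OF geo_half[of k]]]) (use assms in auto)
  have "mu (\<Union>n. D n) \<le> (\<Sum>n. mu (D n))"
    by (rule cantor.finite_measure_subadditive_countably) (use assms s in auto)
  also have "\<dots> \<le> (\<Sum>n. 1 / 2 ^ (k + n + 1))"
    by (rule suminf_le[OF assms(2) s sums_summable[OF geo_half[of k]]])
  finally show ?thesis using sums_unique[OF geo_half[of k]] by simp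
qed

lemma open_cover_UN:
  assumes "\<And>n. open_cover (A n) (B n) (1 / 2 ^ (k + n + 1))"
  shows "open_cover (\<lambda>p. \<exists>n. A n p) (\<Union>n. B n) (1 / 2 ^ k)"
proof -
  have *: "\<And>n. B n \<in> sets cantor_measure" using assms unfolding open_cover_def by blast
  have "mu ((\<Union>n. open_num (A n)) - (\<Union>n. B n)) \<le> mu (\<Union>n. open_num (A n) - B n)"
    using * by (intro cantor.finite_measure_mono) auto
  also have "\<dots> \<le> 1 / 2 ^ k"
    using assms * by (intro measure_UN_geo) (auto simp: open_cover_def)
  finally show ?thesis using assms * unfolding open_cover_def open_num_ex by (auto simp: ext_closed_def)
qed

text \<open>The error is split in halves: one pays for cutting the intersection at a finite index,
  which is possible by continuity of the measure from above; the other is the sum of the errors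
  \<open>1 / 2 ^ (k + n + 2)\<close> over all \<open>n\<close>.\<close>

lemma open_cover_INT:
  assumes "\<And>n. open_cover (A n) (B n) (1 / 2 ^ (k + n + 2))"
  shows "open_cover (finite_cut A k) (\<Inter>n. B n) (1 / 2 ^ k)"
proof -
  have B: "\<And>n. B n \<in> sets cantor_measure" and e: "\<And>n. ext_closed (A n)" using assms unfolding open_cover_def by auto
  define I where "I = (\<lambda>N. \<Inter>n\<in>{..N}. open_num (A n))"
  have I: "I N \<in> sets cantor_measure" for N unfolding I_def by (intro sets.finite_INT) auto
  have dI: "decseq I" unfolding I_def decseq_def by auto
  have iI: "(\<Inter>N. I N) = (\<Inter>n. open_num (A n))" unfolding I_def by auto
  have Iinf: "(\<Inter>N. I N) \<in> sets cantor_measure" using I by auto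
  have lim: "(\<lambda>N. mu (I N)) \<longlonglongrightarrow> mu (\<Inter>N. I N)"
    using I dI by (intro cantor.finite_Lim_measure_decseq) auto
  then have "\<forall>\<^sub>F N in sequentially. mu (I N) < mu (\<Inter>N. I N) + 1 / 2 ^ Suc k"
    by (intro order_tendstoD(2)) auto
  then obtain N0 where N0: "mu (I N0) < mu (\<Inter>N. I N) + 1 / 2 ^ Suc k"
    unfolding eventually_sequentially by blast
  have "mu (I N0 - I M) < 1 / 2 ^ Suc k" for M
  proof -
    have "mu (I N0 - I M) \<le> mu (I N0 - (\<Inter>N. I N))"
      using I Iinf by (intro cantor.finite_measure_mono) auto
    also have "\<dots> = mu (I N0) - mu (\<Inter>N. I N)"
      using I Iinf by (intro cantor.finite_measure_Diff) auto
    finally show ?thesis using N0 by simp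
  qed
  then have "tail_small A k N0" using tail_small_iff(1)[of A, OF e] unfolding I_def by blast
  define N where "N = (LEAST N. tail_small A k N)"
  have N: "tail_small A k N" "\<And>N'. N' < N \<Longrightarrow> \<not> tail_small A k N'"
    unfolding N_def by (rule LeastI, fact) (rule not_less_Least)
  have C: "finite_cut A k = (\<lambda>p. \<forall>n\<le>N. A n p)"
  proof -
    have "M = N" if "tail_small A k M" "\<forall>N'. N' < M \<longrightarrow> \<not> tail_small A k N'" for M
      using that N by (metis linorder_neqE_nat)
    then show ?thesis unfolding finite_cut_def using N by blast
  qed
  have O: "open_num (finite_cut A k) = I N" and eC: "ext_closed (finite_cut A k)"
    unfolding C I_def using open_num_fin_inter[of N A] e by auto
  have 1: "mu (I N - (\<Inter>N. I N)) \<le> 1 / 2 ^ Suc k"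
  proof -
    have "(\<lambda>M. mu (I N - I M)) \<longlonglongrightarrow> mu (\<Union>M. I N - I M)"
      using I dI by (intro cantor.finite_Lim_measure_incseq) (auto simp: incseq_def decseq_def)
    moreover have "(\<Union>M. I N - I M) = I N - (\<Inter>N. I N)" by auto
    ultimately have "(\<lambda>M. mu (I N - I M)) \<longlonglongrightarrow> mu (I N - (\<Inter>N. I N))" by simp
    moreover have "mu (I N - I M) \<le> 1 / 2 ^ Suc k" for M
      unfolding I_def by (rule tail_small_iff(2)[of A, OF e N(1)])
    ultimately show ?thesis by (rule LIMSEQ_le_const2[OF _ exI, OF _ allI, OF _ impI])
  qed
  have 2: "mu (\<Union>n. open_num (A n) - B n) \<le> 1 / 2 ^ Suc k"
    using assms B by (intro measure_UN_geo) (auto simp: open_cover_def)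
  have "mu (I N - (\<Inter>n. B n)) \<le> mu ((I N - (\<Inter>N. I N)) \<union> (\<Union>n. open_num (A n) - B n))"
  proof (rule cantor.finite_measure_mono)
    show "I N - (\<Inter>n. B n) \<subseteq> (I N - (\<Inter>N. I N)) \<union> (\<Union>n. open_num (A n) - B n)"
      unfolding iI by auto
  qed (use I Iinf B in \<open>auto\<close>)
  also have "\<dots> \<le> mu (I N - (\<Inter>N. I N)) + mu (\<Union>n. open_num (A n) - B n)"
    using I Iinf B by (intro measure_Un_le) auto
  also have "\<dots> \<le> 1 / 2 ^ k" using 1 2 by simp
  finally have "mu (open_num (finite_cut A k) - (\<Inter>n. B n)) \<le> 1 / 2 ^ k" unfolding O .
  moreover have "(\<Inter>n. B n) \<subseteq> I N" using assms unfolding open_cover_def I_def by auto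
  ultimately show ?thesis using eC B unfolding open_cover_def O by auto
qed

lemma str_bit_double:
  assumes "2 ^ l \<le> p" "b \<le> 1" "i < l" shows "str_bit (2 * p + b) i \<longleftrightarrow> str_bit p i"
proof -
  have "(2::nat) ^ Suc i \<le> 2 ^ l" using assms(3) by (intro power_increasing) auto
  then have "\<not> p < 2 ^ Suc i" using assms(1) by linarith
  then show ?thesis using str_bit_step[OF assms(2)] by simp
qed

text \<open>The class is clopen and covered without error. The guard \<open>2 ^ l \<le> p\<close>
  excludes shorter strings, whose missing bits \<open>str_bit\<close> would read as 0.\<close>

lemma open_cover_leaf:
  assumes Q: "\<And>x y. (\<And>i. i < l \<Longrightarrow> x i = y i) \<Longrightarrow> Q x \<longleftrightarrow> Q y" and "\<epsilon> \<ge> 0"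
  shows "open_cover (\<lambda>p. 2 ^ l \<le> p \<and> Q (str_bit p)) {Y. Q Y} \<epsilon>"
proof -
  have e: "ext_closed (\<lambda>p. 2 ^ l \<le> p \<and> Q (str_bit p))"
    unfolding ext_closed_def
  proof (intro allI impI)
    fix p assume p: "2 ^ l \<le> p \<and> Q (str_bit p)"
    then have "Q (str_bit (2 * p + b)) \<longleftrightarrow> Q (str_bit p)" if "b \<le> 1" for b
      using str_bit_double[of l p b] that by (intro Q) auto
    from this[of 0] this[of 1] p
    show "(2 ^ l \<le> 2 * p \<and> Q (str_bit (2 * p))) \<and> 2 ^ l \<le> 2 * p + 1 \<and> Q (str_bit (2 * p + 1))" by simp
  qed
  have "2 ^ l \<le> prefix_num Y m \<longleftrightarrow> l \<le> m" for Y m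
  proof
    assume "2 ^ l \<le> prefix_num Y m"
    then have "(2::nat) ^ l < 2 ^ Suc m" using prefix_num_level(2)[of Y m] by linarith
    then show "l \<le> m" using power_less_imp_less_exp[of "2::nat" l "Suc m"] by simp
  next
    assume "l \<le> m"
    then show "2 ^ l \<le> prefix_num Y m" using prefix_num_level(1)[of m Y] power_increasing[of l m "2::nat"] by linarith
  qed
  moreover have "Q (str_bit (prefix_num Y m)) \<longleftrightarrow> Q Y" if "l \<le> m" for Y m
    using that by (intro Q) (simp add: str_bit_prefix_num)
  ultimately have "open_num (\<lambda>p. 2 ^ l \<le> p \<and> Q (str_bit p)) = {Y. Q Y}" unfolding open_num_def by auto
  then show ?thesis using e \<open>\<epsilon> \<ge> 0\<close> open_num_sets[of "\<lambda>p. 2 ^ l \<le> p \<and> Q (str_bit p)"] unfolding open_cover_def by auto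
qed

text \<open>\<open>cover_index 0 s t k p\<close> and \<open>cover_index 1 s t k p\<close> are the positions at which a hierarchy records that \<open>p\<close> lies in
  the cover with error \<open>2\<^sup>-\<^sup>k\<close> of the class \<open>rank_le s t\<close> and of its complement, respectively.\<close>

definition cover_index :: "nat \<Rightarrow> nat \<Rightarrow> nat \<Rightarrow> nat \<Rightarrow> nat \<Rightarrow> nat" where
  "cover_index g s t k p = npair g (npair s (npair t (npair k p)))"

text \<open>By \<open>rank_le_in\<close> the class at \<open>s\<close>, \<open>t\<close> is an
  intersection over \<open>n\<close> of unions over \<open>m\<close> of classes at children, and its
  complement a union of intersections. The exponents nest those of \<open>open_cover_INT\<close>
  (\<open>n + 2\<close>) and \<open>open_cover_UN\<close> (\<open>n + 1\<close>). The last clause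
  settles the positions with other tags, so that \<open>H\<close> is unique as a set.\<close>

definition is_hierarchy :: "nat \<Rightarrow> nat \<Rightarrow> (nat \<Rightarrow> bool) \<Rightarrow> bool" where
  "is_hierarchy a b H \<longleftrightarrow> (\<forall>s t k p.
     (num_tree b t \<longrightarrow>
       (H (cover_index 0 s t k p) \<longleftrightarrow>
         finite_cut (\<lambda>n p. \<exists>m. H (cover_index 0 (node_cons n s) (node_cons m t) (k + n + 2 + m + 1) p)) k p) \<and>
       (H (cover_index 1 s t k p) \<longleftrightarrow>
         (\<exists>n. finite_cut (\<lambda>m p. H (cover_index 1 (node_cons n s) (node_cons m t) (k + n + 1 + m + 2) p)) (k + n + 1) p))) \<and>
     (\<not> num_tree b t \<longrightarrow>
       (H (cover_index 0 s t k p) \<longleftrightarrow> 2 ^ node_len s \<le> p \<and> \<not> univ_tree a (str_bit p) s) \<and>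
       (H (cover_index 1 s t k p) \<longleftrightarrow> 2 ^ node_len s \<le> p \<and> univ_tree a (str_bit p) s))) \<and>
   (\<forall>g r. \<not> H (npair (g + 2) r))"

lemma Delta_pred_is_hierarchy: "Delta_fun f \<Longrightarrow> Delta_pred (\<lambda>e E. is_hierarchy a (f e E) (E i))"
proof (rule Delta_pred_comp[where R="\<lambda>z e E. is_hierarchy a z (E i)"])
  show "Delta_pred (\<lambda>e E. is_hierarchy a (e 0) (E i))"
    unfolding is_hierarchy_def finite_cut_def tail_small_def cover_index_def
    by (intro definability_rules Delta_pred_num_tree Delta_pred_univ_tree Delta_fun_card Delta_fun_node_cons Delta_fun_node_len Delta_fun_pow2)
qed

lemma HierD:
  assumes "is_hierarchy a b H"
  shows "num_tree b t \<Longrightarrow> H (cover_index 0 s t k p) \<longleftrightarrow>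
      finite_cut (\<lambda>n p. \<exists>m. H (cover_index 0 (node_cons n s) (node_cons m t) (k + n + 2 + m + 1) p)) k p"
    "num_tree b t \<Longrightarrow> H (cover_index 1 s t k p) \<longleftrightarrow>
      (\<exists>n. finite_cut (\<lambda>m p. H (cover_index 1 (node_cons n s) (node_cons m t) (k + n + 1 + m + 2) p)) (k + n + 1) p)"
    "\<not> num_tree b t \<Longrightarrow> H (cover_index 0 s t k p) \<longleftrightarrow> 2 ^ node_len s \<le> p \<and> \<not> univ_tree a (str_bit p) s"
    "\<not> num_tree b t \<Longrightarrow> H (cover_index 1 s t k p) \<longleftrightarrow> 2 ^ node_len s \<le> p \<and> univ_tree a (str_bit p) s"
    "\<not> H (npair (g + 2) r)"
proof -
  note 1 = assms[unfolded is_hierarchy_def, THEN conjunct1, THEN spec, of s, THEN spec, of t, THEN spec, of k, THEN spec, of p]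
  note 2 = 1[THEN conjunct1, THEN mp] and 3 = 1[THEN conjunct2, THEN mp]
  show "num_tree b t \<Longrightarrow> H (cover_index 0 s t k p) \<longleftrightarrow>
      finite_cut (\<lambda>n p. \<exists>m. H (cover_index 0 (node_cons n s) (node_cons m t) (k + n + 2 + m + 1) p)) k p"
    by (rule 2[THEN conjunct1])
  show "num_tree b t \<Longrightarrow> H (cover_index 1 s t k p) \<longleftrightarrow>
      (\<exists>n. finite_cut (\<lambda>m p. H (cover_index 1 (node_cons n s) (node_cons m t) (k + n + 1 + m + 2) p)) (k + n + 1) p)"
    by (rule 2[THEN conjunct2])
  show "\<not> num_tree b t \<Longrightarrow> H (cover_index 0 s t k p) \<longleftrightarrow> 2 ^ node_len s \<le> p \<and> \<not> univ_tree a (str_bit p) s"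
    by (rule 3[THEN conjunct1])
  show "\<not> num_tree b t \<Longrightarrow> H (cover_index 1 s t k p) \<longleftrightarrow> 2 ^ node_len s \<le> p \<and> univ_tree a (str_bit p) s"
    by (rule 3[THEN conjunct2])
  show "\<not> H (npair (g + 2) r)"
    by (rule assms[unfolded is_hierarchy_def, THEN conjunct2, THEN spec, of g, THEN spec])
qed

text \<open>Each clause refers only to children of \<open>t\<close>, so two hierarchies agree by
  induction along the well-founded tree of \<open>b\<close>.\<close>

lemma is_hierarchy_unique:
  assumes Univ: "Univ b" and H: "is_hierarchy a b H" and H': "is_hierarchy a b H'" shows "H = H'"
proof -
  have *: "\<forall>s k p. H (cover_index 0 s t k p) = H' (cover_index 0 s t k p) \<and> H (cover_index 1 s t k p) = H' (cover_index 1 s t k p)" for t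
    using Univ_wf_node[OF Univ, of t]
  proof (induction rule: wf_node.induct)
    case (wf_node_leaf t)
    then show ?case by (simp only: HierD(3,4)[OF H] HierD(3,4)[OF H'] simp_thms)
  next
    case (wf_node_step t)
    then have IH: "H (cover_index 0 s (node_cons m t) k p) = H' (cover_index 0 s (node_cons m t) k p)"
      "H (cover_index 1 s (node_cons m t) k p) = H' (cover_index 1 s (node_cons m t) k p)" for s m k p by auto
    show ?case
    proof (cases "num_tree b t")
      case True
      have "H (cover_index 0 s t k p) = H' (cover_index 0 s t k p)" for s k p
      proof -
        have "H (cover_index 0 s t k p) \<longleftrightarrow> finite_cut (\<lambda>n p. \<exists>m. H (cover_index 0 (node_cons n s) (node_cons m t) (k + n + 2 + m + 1) p)) k p"
          by (rule HierD(1)[OF H True])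
        also have "\<dots> \<longleftrightarrow> H' (cover_index 0 s t k p)"
          unfolding IH by (rule HierD(1)[OF H' True, symmetric])
        finally show ?thesis .
      qed
      moreover have "H (cover_index 1 s t k p) = H' (cover_index 1 s t k p)" for s k p
      proof -
        have "H (cover_index 1 s t k p) \<longleftrightarrow> (\<exists>n. finite_cut (\<lambda>m p. H (cover_index 1 (node_cons n s) (node_cons m t) (k + n + 1 + m + 2) p)) (k + n + 1) p)"
          by (rule HierD(2)[OF H True])
        also have "\<dots> \<longleftrightarrow> H' (cover_index 1 s t k p)"
          unfolding IH by (rule HierD(2)[OF H' True, symmetric])
        finally show ?thesis .
      qed
      ultimately show ?thesis by blast
    next
      case False
      then show ?thesis by (simp only: HierD(3,4)[OF H] HierD(3,4)[OF H'] simp_thms)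
    qed
  qed
  show ?thesis
  proof
    fix z
    obtain g r where z: "z = npair g r" using npair_surj by blast
    obtain s r' where r: "r = npair s r'" using npair_surj by blast
    obtain t r'' where r': "r' = npair t r''" using npair_surj by blast
    obtain k p where r'': "r'' = npair k p" using npair_surj by blast
    have z': "z = cover_index g s t k p" unfolding z r r' r'' cover_index_def ..
    consider "g = 0" | "g = 1" | g' where "g = g' + 2"
      by (metis One_nat_def Suc_1 add_2_eq_Suc' not0_implies_Suc)
    then show "H z = H' z"
    proof cases
      case (3 g')
      then show ?thesis unfolding z using HierD(5)[OF H] HierD(5)[OF H'] by blast
    qed (use * z' in simp_all)
  qed
qed

lemma wf_child: assumes "\<And>t. wf_node S t" shows "wf {(node_cons m t, t) | m t. S t}"
  unfolding wf_def
proof (intro allI impI)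
  fix P x
  assume *: "\<forall>x. (\<forall>y. (y, x) \<in> {(node_cons m t, t) | m t. S t} \<longrightarrow> P y) \<longrightarrow> P x"
  show "P x" using assms[of x]
    by (induction rule: wf_node.induct) (use * in blast)+
qed

lemma is_hierarchy_ex: assumes "Univ b" shows "\<exists>H. is_hierarchy a b H"
proof -
  define R where "R = {(node_cons m t, t) | m t. num_tree b t}"
  have R: "wf R" unfolding R_def by (rule wf_child) (rule Univ_wf_node[OF assms])
  define \<Psi> where "\<Psi> = (\<lambda>(V :: nat \<Rightarrow> nat \<Rightarrow> nat \<Rightarrow> nat \<Rightarrow> nat \<Rightarrow> bool) t (g::nat) s k p.
     if num_tree b t then
       (if g = 0 then finite_cut (\<lambda>n p. \<exists>m. V (node_cons m t) 0 (node_cons n s) (k + n + 2 + m + 1) p) k p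
        else (\<exists>n. finite_cut (\<lambda>m p. V (node_cons m t) 1 (node_cons n s) (k + n + 1 + m + 2) p) (k + n + 1) p))
     else 2 ^ node_len s \<le> p \<and> (g = 0 \<longleftrightarrow> \<not> univ_tree a (str_bit p) s))"
  define V where "V = wfrec R \<Psi>"
  have V: "V t = \<Psi> V t" for t
  proof -
    have "V t = \<Psi> (cut (wfrec R \<Psi>) R t) t" unfolding V_def by (rule wfrec[OF R])
    also have "\<dots> = \<Psi> V t"
    proof (cases "num_tree b t")
      case True
      then have "cut (wfrec R \<Psi>) R t (node_cons m t) = V (node_cons m t)" for m
        unfolding V_def by (intro cut_apply) (auto simp: R_def)
      then show ?thesis unfolding \<Psi>_def by simp
    qed (simp add: \<Psi>_def)
    finally show ?thesis .
  qed
  define H where "H = (\<lambda>z. nfst z < 2 \<and>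
    V (nfst (nsnd (nsnd z))) (nfst z) (nfst (nsnd z)) (nfst (nsnd (nsnd (nsnd z)))) (nsnd (nsnd (nsnd (nsnd z)))))"
  have H: "H (cover_index 0 s t k p) = V t 0 s k p" "H (cover_index 1 s t k p) = V t 1 s k p" for s t k p
    unfolding H_def cover_index_def by simp_all
  have "is_hierarchy a b H"
    unfolding is_hierarchy_def H
  proof (intro conjI allI impI)
    fix s t k p
    assume t: "num_tree b t"
    show "V t 0 s k p \<longleftrightarrow> finite_cut (\<lambda>n p. \<exists>m. V (node_cons m t) 0 (node_cons n s) (k + n + 2 + m + 1) p) k p"
      using t by (subst V) (simp add: \<Psi>_def)
    show "V t 1 s k p \<longleftrightarrow> (\<exists>n. finite_cut (\<lambda>m p. V (node_cons m t) 1 (node_cons n s) (k + n + 1 + m + 2) p) (k + n + 1) p)"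
      using t by (subst V) (simp add: \<Psi>_def)
  next
    fix s t k p
    assume t: "\<not> num_tree b t"
    show "V t 0 s k p \<longleftrightarrow> 2 ^ node_len s \<le> p \<and> \<not> univ_tree a (str_bit p) s"
      using t by (subst V) (simp add: \<Psi>_def)
    show "V t 1 s k p \<longleftrightarrow> 2 ^ node_len s \<le> p \<and> univ_tree a (str_bit p) s"
      using t by (subst V) (simp add: \<Psi>_def)
  next
    fix g r
    show "\<not> H (npair (g + 2) r)" unfolding H_def by simp
  qed
  show ?thesis by (rule exI[of _ H]) fact
qed

definition hierarchy :: "nat \<Rightarrow> nat \<Rightarrow> nat \<Rightarrow> bool" where
  "hierarchy a b = (THE H. is_hierarchy a b H)"

lemma hierarchy: assumes "Univ b" shows "is_hierarchy a b (hierarchy a b)" "is_hierarchy a b H \<Longrightarrow> H = hierarchy a b"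
proof -
  have "\<exists>!H. is_hierarchy a b H" using is_hierarchy_ex[OF assms] is_hierarchy_unique[OF assms] by blast
  from theI'[OF this] show 1: "is_hierarchy a b (hierarchy a b)" unfolding hierarchy_def .
  show "H = hierarchy a b" if "is_hierarchy a b H" using is_hierarchy_unique[OF assms that 1] .
qed

text \<open>As \<open>hierarchy a b\<close> is the only hierarchy, statements about it can be made
  with a universal set quantifier. Applied to \<open>Q\<close> and to its negation, this makes them
  Delta^1_1 on \<open>Univ\<close>.\<close>

lemma Pi_pred_hierarchy:
  assumes Q: "Delta_pred (\<lambda>e E. Q (E 0) e (\<lambda>i. E (Suc i)))" and f: "Delta_fun f"
  shows "Pi_pred (\<lambda>e E. Univ (f e E) \<and> Q (hierarchy a (f e E)) e E)"
proof -
  have f': "Delta_fun (\<lambda>e E. f e (\<lambda>i. E (Suc i)))" using Delta_fun_ren[OF f, of "\<lambda>i. i" Suc] .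
  have "Pi_pred (\<lambda>e E. \<forall>H. is_hierarchy a (f e E) H \<longrightarrow> Q H e E)"
    by (rule Pi_pred_allset) (intro Delta_pred_Pi_pred(1) Delta_pred_imp Delta_pred_is_hierarchy f' Q)
  then have "Pi_pred (\<lambda>e E. Univ (f e E) \<and> (\<forall>H. is_hierarchy a (f e E) H \<longrightarrow> Q H e E))"
    by (intro Pi_pred_conj Pi_pred_Univ f)
  moreover have "Univ b \<and> (\<forall>H. is_hierarchy a b H \<longrightarrow> Q H e E) \<longleftrightarrow> Univ b \<and> Q (hierarchy a b) e E" for b e E
    using hierarchy by blast
  ultimately show ?thesis by simp
qed

definition rank_class :: "nat \<Rightarrow> nat \<Rightarrow> nat \<Rightarrow> nat \<Rightarrow> cantor set" where
  "rank_class a b s t = {Y. rank_le (univ_tree a Y) (num_tree b) s t}"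

text \<open>Induction along the tree of \<open>b\<close> follows the recursion of the hierarchy. It
  simultaneously shows that the classes are Borel, which is part of
  \<open>open_cover\<close>.\<close>

lemma hierarchy_open_cover:
  assumes Univ: "Univ b"
  shows "open_cover (\<lambda>p. hierarchy a b (cover_index 0 s t k p)) (rank_class a b s t) (1 / 2 ^ k) \<and>
    open_cover (\<lambda>p. hierarchy a b (cover_index 1 s t k p)) (- rank_class a b s t) (1 / 2 ^ k)"
proof -
  note H = hierarchy(1)[OF Univ, of a]
  have leaf: "open_cover (\<lambda>p. hierarchy a b (cover_index 0 s t k p)) (rank_class a b s t) (1 / 2 ^ k) \<and>
    open_cover (\<lambda>p. hierarchy a b (cover_index 1 s t k p)) (- rank_class a b s t) (1 / 2 ^ k)" if "\<not> num_tree b t" for s t k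
  proof -
    have e: "hierarchy a b (cover_index 0 s t k p) \<longleftrightarrow> 2 ^ node_len s \<le> p \<and> \<not> univ_tree a (str_bit p) s"
       "hierarchy a b (cover_index 1 s t k p) \<longleftrightarrow> 2 ^ node_len s \<le> p \<and> univ_tree a (str_bit p) s" for p
      using HierD(3,4)[OF H that] by blast+
    have "rank_class a b s t = {Y. \<not> univ_tree a Y s}" "- rank_class a b s t = {Y. univ_tree a Y s}"
      unfolding rank_class_def using that by (auto simp: rank_le_out)
    then have c: "rank_class a b s t = {Y. \<not> univ_tree a Y s}" "- rank_class a b s t = {Y. univ_tree a Y s}" by blast+
    have "open_cover (\<lambda>p. 2 ^ node_len s \<le> p \<and> \<not> univ_tree a (str_bit p) s) {Y. \<not> univ_tree a Y s} (1 / 2 ^ k)"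
      by (rule open_cover_leaf) (rule arg_cong[where f=Not], rule univ_tree_cong, simp_all)
    moreover have "open_cover (\<lambda>p. 2 ^ node_len s \<le> p \<and> univ_tree a (str_bit p) s) {Y. univ_tree a Y s} (1 / 2 ^ k)"
      by (rule open_cover_leaf) (rule univ_tree_cong, simp_all)
    ultimately show ?thesis unfolding e c(2) unfolding c(1) by blast
  qed
  have "\<forall>s k. open_cover (\<lambda>p. hierarchy a b (cover_index 0 s t k p)) (rank_class a b s t) (1 / 2 ^ k) \<and>
    open_cover (\<lambda>p. hierarchy a b (cover_index 1 s t k p)) (- rank_class a b s t) (1 / 2 ^ k)"
    using Univ_wf_node[OF Univ, of t]
  proof (induction rule: wf_node.induct)
    case (wf_node_leaf t)
    then show ?case using leaf by blast
  next
    case (wf_node_step t)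
    then have IH: "open_cover (\<lambda>p. hierarchy a b (cover_index 0 s (node_cons m t) k p)) (rank_class a b s (node_cons m t)) (1 / 2 ^ k)"
      "open_cover (\<lambda>p. hierarchy a b (cover_index 1 s (node_cons m t) k p)) (- rank_class a b s (node_cons m t)) (1 / 2 ^ k)" for s m k by auto
    show ?case
    proof (cases "num_tree b t")
      case True
      have e: "(\<lambda>p. hierarchy a b (cover_index 0 s t k p)) = finite_cut (\<lambda>n p. \<exists>m. hierarchy a b (cover_index 0 (node_cons n s) (node_cons m t) (k + n + 2 + m + 1) p)) k"
       "(\<lambda>p. hierarchy a b (cover_index 1 s t k p)) = (\<lambda>p. \<exists>n. finite_cut (\<lambda>m p. hierarchy a b (cover_index 1 (node_cons n s) (node_cons m t) (k + n + 1 + m + 2) p)) (k + n + 1) p)" for s k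
        by (intro HOL.ext HierD(1)[OF H True] HierD(2)[OF H True])+
      have c: "rank_class a b s t = (\<Inter>n. \<Union>m. rank_class a b (node_cons n s) (node_cons m t))"
        "- rank_class a b s t = (\<Union>n. \<Inter>m. - rank_class a b (node_cons n s) (node_cons m t))" for s
        unfolding rank_class_def using True by (auto simp: rank_le_in)
      show ?thesis unfolding e c(2) unfolding c(1)
        by (intro allI conjI open_cover_UN open_cover_INT IH)
    qed (use leaf in blast)
  qed
  then show ?thesis by blast
qed

section \<open>Tests and functionals given by numbered strings\<close>

function num_string :: "nat \<Rightarrow> bool list" where
  "num_string p = (if p \<le> 1 then [] else num_string (p div 2) @ [odd p])"
  by auto
termination by (relation "Wellfounded.measure id") auto

declare num_string.simps [simp del]

lemma num_string_prefix_num: "num_string (prefix_num Y l) = map Y [0..<l]"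
proof (induction l)
  case 0
  then show ?case by (simp add: num_string.simps)
next
  case (Suc l)
  have "1 \<le> prefix_num Y l" using prefix_num_level(1)[where l=l and Y=Y] one_le_power[of "2::nat" l] by linarith
  then show ?case using Suc by (subst num_string.simps) (simp add: of_bool_def)
qed

lemma prefix_num_pos: "1 \<le> prefix_num Y l"
  using prefix_num_level(1)[where l=l and Y=Y] one_le_power[of "2::nat" l] by linarith

lemma ex_prefix_num: assumes "1 \<le> p" obtains Y l where "p = prefix_num Y l"
proof -
  obtain l where "2 ^ l \<le> p" "p < 2 ^ Suc l" using ex_power_ivl1[of 2 p] assms by auto
  then show ?thesis using prefix_num_surj that by metis
qed

definition string_code_step :: "nat \<Rightarrow> nat" where
  "string_code_step x = (if nfst x \<le> 1 then x else npair (nfst x div 2) (node_cons (nfst x mod 2) (nsnd x)))"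

definition num_string_code :: "nat \<Rightarrow> nat" where "num_string_code p = nsnd ((string_code_step ^^ p) (npair p 0))"

lemma string_code_Cons: "string_code (b # \<sigma>) = node_cons (of_bool b) (string_code \<sigma>)"
  by (simp add: string_code_def node_cons_def npair_def)

lemma num_string_code_num_string: "num_string_code p = string_code (num_string p)"
proof -
  \<comment> \<open>Digits are moved one by one from the end of \<open>p\<close> to the front of the
    accumulator \<open>\<sigma>\<close>, which must be general for the induction. A step at least
    halves \<open>p > 1\<close>, so \<open>p\<close> steps are enough.\<close>
  have "p \<le> Suc k \<Longrightarrow> nsnd ((string_code_step ^^ k) (npair p (string_code \<sigma>))) = string_code (num_string p @ \<sigma>)" for k p \<sigma>
  proof (induction k arbitrary: p \<sigma>)
    case 0
    then show ?case by (simp add: num_string.simps)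
  next
    case (Suc k)
    show ?case
    proof (cases "p \<le> 1")
      case True
      then have "(string_code_step ^^ Suc k) (npair p (string_code \<sigma>)) = (string_code_step ^^ k) (npair p (string_code \<sigma>))"
        unfolding funpow_Suc_right by (simp add: string_code_step_def)
      then show ?thesis using Suc.IH[of p \<sigma>] True by simp
    next
      case False
      then have "(string_code_step ^^ Suc k) (npair p (string_code \<sigma>)) = (string_code_step ^^ k) (npair (p div 2) (string_code (odd p # \<sigma>)))"
        unfolding funpow_Suc_right string_code_Cons by (simp add: string_code_step_def mod_2_eq_odd)
      moreover have "num_string p = num_string (p div 2) @ [odd p]" using False by (subst num_string.simps) simp
      ultimately show ?thesis using Suc.IH[of "p div 2" "odd p # \<sigma>"] Suc.prems by simp
    qed
  qed
  from this[of p p "[]"] show ?thesis by (simp add: num_string_code_def string_code_def)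
qed

lemma Delta_fun_num_string_code: "Delta_fun f \<Longrightarrow> Delta_fun (\<lambda>e E. num_string_code (f e E))"
proof (rule Delta_fun_comp1[where h=num_string_code])
  have d: "z = x div 2 \<longleftrightarrow> x = 2 * z \<or> x = 2 * z + 1" for x z :: nat by presburger
  have m: "z = x mod 2 \<longleftrightarrow> (\<exists>q. x = 2 * q + z) \<and> z \<le> 1" for x z :: nat by presburger
  have D: "Delta_fun (\<lambda>e E. f e E div 2)" if "Delta_fun f" for f
    by (rule Delta_fun_comp1[OF _ that], unfold d) (intro definability_rules)
  have M: "Delta_fun (\<lambda>e E. f e E mod 2)" if "Delta_fun f" for f
    by (rule Delta_fun_comp1[OF _ that], unfold m) (intro definability_rules)
  show "Delta_pred (\<lambda>e E. e 0 = num_string_code (e (Suc 0)))"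
    unfolding num_string_code_def string_code_step_def by (intro definability_rules Delta_fun_nsnd Delta_fun_nfst Delta_fun_node_cons D M Delta_fun_funpow)
qed

lemma initial_segment_num_string:
  assumes "1 \<le> p" shows "initial_segment (num_string p) X \<longleftrightarrow> (\<exists>l. p = prefix_num X l)"
proof -
  obtain Y l where p: "p = prefix_num Y l" using ex_prefix_num[OF assms] .
  show ?thesis
  proof
    assume "initial_segment (num_string p) X"
    then have "\<forall>i<l. Y i = X i" unfolding initial_segment_def p num_string_prefix_num by simp
    then show "\<exists>l. p = prefix_num X l" unfolding p using prefix_num_cong[of l Y X] by blast
  next
    assume "\<exists>l. p = prefix_num X l"
    then show "initial_segment (num_string p) X" by (auto simp: num_string_prefix_num initial_segment_def)
  qed
qed

text \<open>The guard excludes 0, which numbers no string although \<open>num_string 0\<close> is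
  empty.\<close>

definition num_strings :: "(nat \<Rightarrow> bool) \<Rightarrow> bool list set" where
  "num_strings S = {num_string p | p. 1 \<le> p \<and> S p}"

lemma open_of_num_strings: "open_of (num_strings S) = open_num S"
proof -
  have "Y \<in> open_of (num_strings S) \<longleftrightarrow> (\<exists>p. 1 \<le> p \<and> S p \<and> initial_segment (num_string p) Y)" for Y
    unfolding open_of_def cylinder_def num_strings_def by auto
  also have "\<dots> Y \<longleftrightarrow> (\<exists>l. S (prefix_num Y l))" for Y
    using initial_segment_num_string prefix_num_pos by metis
  finally show ?thesis unfolding open_num_def by auto
qed

lemma avoids_test:
  assumes X: "Pi11_ML_random X" and S: "Pi_pred (\<lambda>e E. S (e 0) (e (Suc 0)))"
    and m: "\<And>n. mu (open_num (S n)) \<le> 1 / 2 ^ n"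
  shows "\<exists>n. X \<notin> open_num (S n)"
proof -
  have "Pi_pred (\<lambda>e E. \<exists>n p. e 0 = npair n (num_string_code p) \<and> 1 \<le> p \<and> S n p)"
    by (intro Pi_pred_ex Pi_pred_conj Pi_pred_comp2[OF S] Delta_pred_Pi_pred(1) definability_rules Delta_fun_num_string_code)
  from Pi11_set_Pi_pred[OF this]
  have "uniformly_Pi11 (\<lambda>n. num_strings (S n))"
    unfolding uniformly_Pi11_def by (rule back_subst[of Pi11_set]) (auto simp: num_strings_def num_string_code_num_string npair_def)
  moreover have "\<forall>n. mu (open_of (num_strings (S n))) \<le> (1 / 2) ^ n"
    using m by (simp add: open_of_num_strings power_divide)
  ultimately have "X \<notin> (\<Inter>n. open_of (num_strings (S n)))"
    using X unfolding Pi11_ML_random_def by blast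
  then show ?thesis by (simp add: open_of_num_strings)
qed

text \<open>The tails of the sequence form a Martin-Loef test. Starting the \<open>n\<close>-th tail
  at \<open>n + 3\<close> turns the bound \<open>4 / 2 ^ b\<close> into the terms
  \<open>1 / 2 ^ (n + j + 1)\<close>, whose sum is \<open>1 / 2 ^ n\<close>.\<close>

lemma finite_Solovay_test:
  assumes X: "Pi11_ML_random X" and V: "Pi_pred (\<lambda>e E. V (e 0) (e (Suc 0)))"
    and m: "\<And>b. mu (open_num (V b)) \<le> 4 / 2 ^ b"
  shows "finite {b. X \<in> open_num (V b)}"
proof -
  have "\<exists>n. X \<notin> open_num (\<lambda>p. \<exists>j. V (n + 3 + j) p)"
  proof (rule avoids_test[OF X])
    show "Pi_pred (\<lambda>e E. \<exists>j. V (e 0 + 3 + j) (e (Suc 0)))"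
      by (intro Pi_pred_ex Pi_pred_comp2[OF V] definability_rules)
    fix n
    show "mu (open_num (\<lambda>p. \<exists>j. V (n + 3 + j) p)) \<le> 1 / 2 ^ n"
      unfolding open_num_ex
    proof (rule measure_UN_geo)
      fix j
      have "4 / 2 ^ (n + 3 + j) = (1 / 2 ^ (n + j + 1) :: real)" by (simp add: power_add)
      then show "mu (open_num (V (n + 3 + j))) \<le> 1 / 2 ^ (n + j + 1)" using m[of "n + 3 + j"] by simp
    qed simp
  qed
  then obtain n where n: "X \<notin> open_num (V (n + 3 + j))" for j unfolding open_num_ex by blast
  have "b < n + 3" if "X \<in> open_num (V b)" for b
  proof (rule ccontr)
    assume "\<not> b < n + 3"
    then have "b = n + 3 + (b - (n + 3))" by simp
    with n[of "b - (n + 3)"] that show False by metis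
  qed
  then have "{b. X \<in> open_num (V b)} \<subseteq> {..<n + 3}" by auto
  then show ?thesis using finite_subset by blast
qed

lemma Delta_pred_finite:
  assumes "finite B" "Delta_fun f" shows "Delta_pred (\<lambda>e E. f e E \<in> B)"
  using assms(1)
proof induction
  case empty
  show ?case using Delta_pred_bool[of False] by simp
next
  case (insert x B)
  then show ?case using assms(2) by simp (intro definability_rules)
qed

lemma map_upt_prefix: "m \<le> n \<Longrightarrow> prefix (map f [0..<m]) (map f [0..<n])"
  using upt_add_eq_append[of 0 m "n - m"] by (simp add: prefix_def)

text \<open>The functional gives \<open>\<tau>\<close> on \<open>\<sigma>\<close> once every 1 in
  \<open>\<tau>\<close> is confirmed by \<open>P1\<close>, without oracle, and every 0 by
  \<open>P0\<close> at \<open>\<sigma>\<close>. Monotonicity of \<open>P0\<close> along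
  \<open>X\<close> lets one prefix confirm finitely many zeros. Nothing is demanded off
  \<open>X\<close>.\<close>

lemma hT_computesI:
  assumes one: "Pi_pred (\<lambda>e E. P1 (e 0))" and zero: "Pi_pred (\<lambda>e E. P0 (e 0) (e (Suc 0)))"
    and P1: "\<And>i. P1 i \<longleftrightarrow> i \<in> A" and P0: "\<And>l i. P0 (prefix_num X l) i \<Longrightarrow> i \<notin> A"
    and mono: "\<And>l m i. P0 (prefix_num X l) i \<Longrightarrow> l \<le> m \<Longrightarrow> P0 (prefix_num X m) i"
    and ex: "\<And>i. i \<notin> A \<Longrightarrow> \<exists>l. P0 (prefix_num X l) i"
  shows "hT_computes X A"
proof -
  \<comment> \<open>\<open>2 ^ Suc i \<le> q\<close> says that the string numbered \<open>q\<close>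
    is longer than \<open>i\<close>.\<close>
  define R where "R = (\<lambda>p q. \<forall>i. \<not> 2 ^ Suc i \<le> q \<or> ((\<not> str_bit q i \<or> P1 i) \<and> (str_bit q i \<or> P0 p i)))"
  define \<Phi> where "\<Phi> = {(num_string p, num_string q) | p q. 1 \<le> p \<and> 1 \<le> q \<and> R p q}"
  define ch where "ch = (\<lambda>i. i \<in> A)"
  have "Pi_pred (\<lambda>e E. \<exists>p q. e 0 = npair (num_string_code p) (num_string_code q) \<and> 1 \<le> p \<and> 1 \<le> q \<and> R p q)"
  proof -
    have R: "Pi_pred (\<lambda>e E. R (e (Suc 0)) (e 0))" unfolding R_def
      apply (rule Pi_pred_all, rule Pi_pred_disj, rule Delta_pred_Pi_pred, intro definability_rules Delta_fun_pow2)
      apply (rule Pi_pred_conj; rule Pi_pred_disj)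
         apply (rule Delta_pred_Pi_pred, intro definability_rules Delta_pred_str_bit)
        apply (intro Pi_pred_comp1[OF one] definability_rules)
       apply (rule Delta_pred_Pi_pred, intro definability_rules Delta_pred_str_bit)
      apply (intro Pi_pred_comp2[OF zero] definability_rules)
      done
    then show ?thesis by (intro Pi_pred_ex Pi_pred_conj R Delta_pred_Pi_pred(1) definability_rules Delta_fun_num_string_code)
  qed
  from Pi11_set_Pi_pred[OF this] have "Pi11_string_pairs \<Phi>"
    unfolding Pi11_string_pairs_def
    by (rule back_subst[of Pi11_set]) (auto simp: \<Phi>_def num_string_code_num_string npair_def, blast?)
  have level: "2 ^ Suc i \<le> prefix_num Y m \<longleftrightarrow> i < m" for i Y m
  proof
    assume "2 ^ Suc i \<le> prefix_num Y m"
    then have "(2::nat) ^ Suc i < 2 ^ Suc m" using prefix_num_level(2)[where Y=Y and l=m] by linarith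
    then show "i < m" using power_less_imp_less_exp[of "2::nat" "Suc i" "Suc m"] by simp
  next
    assume "i < m"
    then show "2 ^ Suc i \<le> prefix_num Y m"
      using prefix_num_level(1)[where Y=Y and l=m] power_increasing[of "Suc i" m "2::nat"] by linarith
  qed
  have out: "\<exists>m. \<tau> = map ch [0..<m]" if "\<tau> \<in> hT_output \<Phi> X" for \<tau>
  proof -
    from that obtain p q where *: "initial_segment (num_string p) X" "1 \<le> p" "1 \<le> q" "R p q" "\<tau> = num_string q"
      unfolding hT_output_def \<Phi>_def by blast
    obtain l where p: "p = prefix_num X l" using * initial_segment_num_string by blast
    obtain Y m where q: "q = prefix_num Y m" using ex_prefix_num[OF *(3)] .
    have "Y i = ch i" if "i < m" for i
      using *(4) that P0 unfolding R_def q level str_bit_prefix_num P1 p ch_def by metis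
    then have "\<tau> = map ch [0..<m]" unfolding *(5) q num_string_prefix_num by simp
    then show ?thesis ..
  qed
  have mem: "map ch [0..<m] \<in> hT_output \<Phi> X" for m
  proof -
    have "\<forall>i. \<exists>l. i \<notin> A \<longrightarrow> P0 (prefix_num X l) i" using ex by blast
    then obtain g where g: "\<And>i. i \<notin> A \<Longrightarrow> P0 (prefix_num X (g i)) i" by metis
    define L where "L = Max (g ` {..m})"
    have "g i \<le> L" if "i < m" for i unfolding L_def using that by auto
    then have "P0 (prefix_num X L) i" if "i < m" "i \<notin> A" for i using g mono that by blast
    then have "R (prefix_num X L) (prefix_num ch m)" unfolding R_def level str_bit_prefix_num P1 ch_def by blast
    then have "(num_string (prefix_num X L), num_string (prefix_num ch m)) \<in> \<Phi>" unfolding \<Phi>_def using prefix_num_pos by blast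
    moreover have "initial_segment (num_string (prefix_num X L)) X" using initial_segment_num_string prefix_num_pos by blast
    ultimately show ?thesis unfolding hT_output_def num_string_prefix_num by blast
  qed
  have "\<forall>\<tau>\<in>hT_output \<Phi> X. \<forall>\<tau>'\<in>hT_output \<Phi> X. prefix \<tau> \<tau>' \<or> prefix \<tau>' \<tau>"
    using out map_upt_prefix[of _ _ ch] by (metis nle_le)
  moreover have "(\<Union>\<tau>\<in>hT_output \<Phi> X. string_graph \<tau>) = seq_graph (\<lambda>n. n \<in> A)"
  proof
    show "(\<Union>\<tau>\<in>hT_output \<Phi> X. string_graph \<tau>) \<subseteq> seq_graph (\<lambda>n. n \<in> A)"
      using out by (fastforce simp: string_graph_def seq_graph_def ch_def)
    show "seq_graph (\<lambda>n. n \<in> A) \<subseteq> (\<Union>\<tau>\<in>hT_output \<Phi> X. string_graph \<tau>)"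
    proof
      fix z assume "z \<in> seq_graph (\<lambda>n. n \<in> A)"
      then obtain i where "z = (i, i \<in> A)" unfolding seq_graph_def by blast
      then have "z \<in> string_graph (map ch [0..<Suc i])"
        unfolding string_graph_def by (auto simp: ch_def nth_append intro!: exI[of _ i])
      then show "z \<in> (\<Union>\<tau>\<in>hT_output \<Phi> X. string_graph \<tau>)" using mem by blast
    qed
  qed
  ultimately show ?thesis unfolding hT_computes_def using \<open>Pi11_string_pairs \<Phi>\<close> by blast
qed

section \<open>The construction\<close>

text \<open>A cover of the class on which children 0 to \<open>n\<close> are below \<open>c\<close>.
  The \<open>m\<close>-th error is \<open>1 / 2 ^ (n + c + 1 + m + 1)\<close>; they add up to at
  most \<open>1 / 2 ^ (n + c + 1)\<close>, and over all \<open>c\<close> to at most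
  \<open>1 / 2 ^ n\<close>.\<close>

definition child_cover :: "nat \<Rightarrow> (nat \<Rightarrow> bool) \<Rightarrow> nat \<Rightarrow> nat \<Rightarrow> nat \<Rightarrow> bool" where
  "child_cover s H n c p \<longleftrightarrow> (\<forall>m. m \<le> n \<longrightarrow> H (cover_index 0 (node_cons m s) 0 (n + c + 1 + m + 1) p))"

text \<open>A cover of the complement of \<open>Q(b)\<close> with error \<open>1 / 2 ^ b\<close>. It
  turns the fact that \<open>X\<close> avoids \<open>Q(b)\<close> into an open condition.\<close>

definition child_cocover :: "nat \<Rightarrow> (nat \<Rightarrow> bool) \<Rightarrow> nat \<Rightarrow> nat \<Rightarrow> bool" where
  "child_cocover s H b p \<longleftrightarrow> (\<exists>m. H (cover_index 1 (node_cons m s) 0 (b + m + 1) p))"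

text \<open>The pair \<open>npair b k\<close> is both the candidate element of \<open>A\<close> and
  the number of the last child inspected. The cocover already has error \<open>1 / 2 ^ b\<close>,
  and twice this leaves room for the limit in \<open>k\<close>. Since levels increase, a bound at
  every level bounds the measure of the open set.\<close>

definition small :: "nat \<Rightarrow> (nat \<Rightarrow> bool) \<Rightarrow> nat \<Rightarrow> nat \<Rightarrow> bool" where
  "small s H b k \<longleftrightarrow> (\<forall>l. card {p. p < 2 ^ Suc l \<and> 2 ^ l \<le> p \<and> child_cover s H (npair b k) b p \<and> child_cocover s H b p} * 2 ^ b \<le> 2 * 2 ^ l)"

definition least_small :: "nat \<Rightarrow> (nat \<Rightarrow> bool) \<Rightarrow> nat \<Rightarrow> nat \<Rightarrow> bool" where
  "least_small s H b k \<longleftrightarrow> small s H b k \<and> (\<forall>j. j < k \<longrightarrow> \<not> small s H b j)"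

lemma least_small_unique: "least_small s H b k \<Longrightarrow> least_small s H b j \<Longrightarrow> k = j"
  unfolding least_small_def by (metis linorder_neqE_nat)

lemma Delta_pred_child_cover: "Delta_fun f \<Longrightarrow> Delta_fun g \<Longrightarrow> Delta_fun h \<Longrightarrow> Delta_pred (\<lambda>e E. child_cover s (E i) (f e E) (g e E) (h e E))"
proof -
  assume f: "Delta_fun f" and g: "Delta_fun g" and h: "Delta_fun h"
  have f': "Delta_fun (\<lambda>e E. f (\<lambda>i. e (Suc i)) E)" using Delta_fun_ren[OF f, of Suc "\<lambda>i. i"] .
  have g': "Delta_fun (\<lambda>e E. g (\<lambda>i. e (Suc i)) E)" using Delta_fun_ren[OF g, of Suc "\<lambda>i. i"] .
  have h': "Delta_fun (\<lambda>e E. h (\<lambda>i. e (Suc i)) E)" using Delta_fun_ren[OF h, of Suc "\<lambda>i. i"] .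
  show ?thesis unfolding child_cover_def cover_index_def by (intro definability_rules f' g' h' Delta_fun_node_cons)
qed

lemma Delta_pred_child_cocover: "Delta_fun g \<Longrightarrow> Delta_fun h \<Longrightarrow> Delta_pred (\<lambda>e E. child_cocover s (E i) (g e E) (h e E))"
proof -
  assume g: "Delta_fun g" and h: "Delta_fun h"
  have g': "Delta_fun (\<lambda>e E. g (\<lambda>i. e (Suc i)) E)" using Delta_fun_ren[OF g, of Suc "\<lambda>i. i"] .
  have h': "Delta_fun (\<lambda>e E. h (\<lambda>i. e (Suc i)) E)" using Delta_fun_ren[OF h, of Suc "\<lambda>i. i"] .
  show ?thesis unfolding child_cocover_def cover_index_def by (intro definability_rules g' h' Delta_fun_node_cons)
qed

lemma Delta_pred_least_small: "Delta_pred (\<lambda>e E. least_small s (E i) (e j) (e k))"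
  unfolding least_small_def small_def by (intro definability_rules Delta_pred_child_cover Delta_pred_child_cocover Delta_fun_card Delta_fun_pow2)

section \<open>Bounds for the ranks of nodes in the tree of \<open>X\<close>\<close>

lemma rank_le_mono_rank_class:
  assumes "Univ b" "Univ c" "not_rank_le b c" shows "rank_class a c s 0 \<subseteq> rank_class a b s 0"
proof -
  have "\<not> rank_le (num_tree b) (num_tree c) 0 0" using assms not_rank_le_iff by blast
  then have "rank_le (num_tree c) (num_tree b) 0 0" using rank_le_total[of "num_tree c" 0 "num_tree b" 0] Univ_wf_node assms by simp
  then show ?thesis unfolding rank_class_def using rank_le_trans'[OF tree_univ_tree tree_num_tree] by blast
qed

text \<open>Finitely many bounds are pairwise comparable, so the largest of them serves for
  all.\<close>

lemma rank_class_chain: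
  fixes g :: "nat \<Rightarrow> nat"
  assumes "\<And>n. \<exists>b. Univ b \<and> X \<in> rank_class a b (g n) 0"
  shows "\<exists>c. Univ c \<and> (\<forall>m\<le>n. X \<in> rank_class a c (g m) 0)"
proof (induction n)
  case 0
  then show ?case using assms[of 0] by auto
next
  case (Suc n)
  obtain c where c: "Univ c" "\<forall>m\<le>n. X \<in> rank_class a c (g m) 0" using Suc by blast
  obtain b where b: "Univ b" "X \<in> rank_class a b (g (Suc n)) 0" using assms by blast
  show ?case
  proof (cases "not_rank_le b c")
    case True
    then have "rank_class a c s 0 \<subseteq> rank_class a b s 0" for s using rank_le_mono_rank_class[OF b(1) c(1)] by blast
    then show ?thesis using b c by (metis le_Suc_eq subsetD)
  next
    case False
    then have "rank_le (num_tree b) (num_tree c) 0 0" using not_rank_le_iff[OF c(1)] by blast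
    then have "rank_class a b s 0 \<subseteq> rank_class a c s 0" for s
      unfolding rank_class_def using rank_le_trans'[OF tree_univ_tree tree_num_tree] by blast
    then show ?thesis using b c by (metis le_Suc_eq subsetD)
  qed
qed

text \<open>Descend to children without a bound; well-foundedness stops the descent, and a node
  outside the tree is below every well-founded \<open>num_tree b\<close>.\<close>

lemma minimal_node:
  assumes "wf_node (univ_tree a X) s" "\<And>b. Univ b \<Longrightarrow> X \<notin> rank_class a b s 0"
  shows "\<exists>s. (\<forall>b. Univ b \<longrightarrow> X \<notin> rank_class a b s 0) \<and> (\<forall>n. \<exists>b. Univ b \<and> X \<in> rank_class a b (node_cons n s) 0)"
  using assms
proof (induction rule: wf_node.induct)
  case (wf_node_leaf s)
  obtain b where b: "Univ b" using Univ_nonempty by blast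
  then have "rank_le (univ_tree a X) (num_tree b) s 0" using rank_le_not_in[OF Univ_wf_node[OF b] tree_univ_tree] wf_node_leaf(1) by blast
  then show ?case using wf_node_leaf(2)[OF b] unfolding rank_class_def by blast
next
  case (wf_node_step s)
  then show ?case by blast
qed

text \<open>If \<open>b\<close> bounded all children of \<open>s\<close>, a tree \<open>b'\<close>
  of larger rank would have a child of its root above \<open>b\<close>, and so would bound
  \<open>s\<close> itself.\<close>

lemma not_in_all_children:
  assumes X: "\<And>b. Univ b \<Longrightarrow> X \<notin> rank_class a b s 0" and b: "Univ b"
  shows "X \<notin> (\<Inter>m. rank_class a b (node_cons m s) 0)"
proof
  assume "X \<in> (\<Inter>m. rank_class a b (node_cons m s) 0)"
  then have 1: "rank_le (univ_tree a X) (num_tree b) (node_cons m s) 0" for m unfolding rank_class_def by blast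
  obtain b' where b': "Univ b'" "\<not> rank_le (num_tree b') (num_tree b) 0 0" using Univ_no_max[OF b] by blast
  obtain n where n: "num_tree b' 0" "rank_le (num_tree b) (num_tree b') 0 (node_cons n 0)"
    using rank_le_child[OF Univ_wf_node[OF b] tree_num_tree tree_num_tree b'(2) Univ_wf_node[OF b'(1)]] by blast
  have "rank_le (univ_tree a X) (num_tree b') (node_cons m s) (node_cons n 0)" for m
    using rank_le_trans'[OF tree_univ_tree tree_num_tree n(2) 1] .
  then have "rank_le (univ_tree a X) (num_tree b') s 0" using n(1) rank_le_step by metis
  then show False using X[OF b'(1)] unfolding rank_class_def by blast
qed

section \<open>Measure estimates at a fixed node \<open>s\<close>\<close>

context
  fixes a s :: nat
begin

definition children_class :: "nat \<Rightarrow> nat \<Rightarrow> cantor set" where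
  "children_class n c = (\<Inter>m\<in>{..n}. rank_class a c (node_cons m s) 0)"

lemma rank_class_sets: "Univ b \<Longrightarrow> rank_class a b u t \<in> sets cantor_measure"
  using hierarchy_open_cover unfolding open_cover_def by blast

lemma child_cover_open_cover: assumes "Univ c" shows "open_cover (child_cover s (hierarchy a c) n c) (children_class n c) (1 / 2 ^ (n + c + 1))"
proof -
  define A where "A = (\<lambda>m p. hierarchy a c (cover_index 0 (node_cons m s) 0 (n + c + 1 + m + 1) p))"
  have A: "open_cover (A m) (rank_class a c (node_cons m s) 0) (1 / 2 ^ (n + c + 1 + m + 1))" for m
    unfolding A_def using hierarchy_open_cover[OF assms] by blast
  have G: "child_cover s (hierarchy a c) n c = (\<lambda>p. \<forall>m\<le>n. A m p)" unfolding child_cover_def A_def by auto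
  note O = open_num_fin_inter[of n A]
  have e: "ext_closed (A m)" for m using A unfolding open_cover_def by blast
  have "mu ((\<Inter>m\<in>{..n}. open_num (A m)) - children_class n c) \<le> mu (\<Union>m. if m \<le> n then open_num (A m) - rank_class a c (node_cons m s) 0 else {})"
    unfolding children_class_def using rank_class_sets[OF assms] by (intro cantor.finite_measure_mono) auto
  also have "\<dots> \<le> 1 / 2 ^ (n + c + 1)"
    using A rank_class_sets[OF assms] by (intro measure_UN_geo) (auto simp: open_cover_def)
  finally have "mu (open_num (child_cover s (hierarchy a c) n c) - children_class n c) \<le> 1 / 2 ^ (n + c + 1)" using O e unfolding G by simp
  moreover have "children_class n c \<in> sets cantor_measure" unfolding children_class_def using rank_class_sets[OF assms] by auto
  moreover have "children_class n c \<subseteq> open_num (child_cover s (hierarchy a c) n c)" using O e A unfolding G children_class_def open_cover_def by auto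
  ultimately show ?thesis using O e unfolding open_cover_def G by blast
qed

lemma child_cocover_open_cover: assumes "Univ b" shows "open_cover (child_cocover s (hierarchy a b) b) (- (\<Inter>m. rank_class a b (node_cons m s) 0)) (1 / 2 ^ b)"
proof -
  have "open_cover (\<lambda>p. \<exists>m. hierarchy a b (cover_index 1 (node_cons m s) 0 (b + m + 1) p)) (\<Union>m. - rank_class a b (node_cons m s) 0) (1 / 2 ^ b)"
    using hierarchy_open_cover[OF assms] by (intro open_cover_UN) blast
  moreover have "child_cocover s (hierarchy a b) b = (\<lambda>p. \<exists>m. hierarchy a b (cover_index 1 (node_cons m s) 0 (b + m + 1) p))"
    unfolding child_cocover_def by auto
  ultimately show ?thesis by simp
qed

lemma small_iff: assumes "Univ b"
  shows "small s (hierarchy a b) b k \<longleftrightarrow> mu (open_num (child_cover s (hierarchy a b) (npair b k) b) \<inter> open_num (child_cocover s (hierarchy a b) b)) \<le> 2 / 2 ^ b"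
proof -
  define S where "S = (\<lambda>p. child_cover s (hierarchy a b) (npair b k) b p \<and> child_cocover s (hierarchy a b) b p)"
  have e: "ext_closed (child_cover s (hierarchy a b) (npair b k) b)" "ext_closed (child_cocover s (hierarchy a b) b)"
    using child_cover_open_cover[OF assms] child_cocover_open_cover[OF assms] unfolding open_cover_def by blast+
  note SE = open_num_conj[OF e, folded S_def]
  have c: "card {p. p < 2 ^ Suc l \<and> 2 ^ l \<le> p \<and> S p} * 2 ^ b \<le> 2 * 2 ^ l \<longleftrightarrow>
    mu {Y. S (prefix_num Y l)} \<le> 2 / 2 ^ b" for l
  proof -
    define c where "c = card {p. p < 2 ^ Suc l \<and> 2 ^ l \<le> p \<and> S p}"
    have "c * 2 ^ b \<le> 2 * 2 ^ l \<longleftrightarrow> real c * 2 ^ b \<le> 2 * 2 ^ l"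
      using of_nat_le_iff[of "c * 2 ^ b" "2 * 2 ^ l", where 'a=real] by simp
    also have "\<dots> \<longleftrightarrow> real c / 2 ^ l \<le> 2 / 2 ^ b" by (simp add: field_simps)
    finally show ?thesis using measure_level(2)[of S l] unfolding c_def level_set_def by simp
  qed
  have "small s (hierarchy a b) b k \<longleftrightarrow> (\<forall>l. mu {Y. S (prefix_num Y l)} \<le> 2 / 2 ^ b)"
    unfolding small_def c[symmetric] unfolding S_def ..
  also have "\<dots> \<longleftrightarrow> mu (open_num S) \<le> 2 / 2 ^ b"
  proof
    assume "\<forall>l. mu {Y. S (prefix_num Y l)} \<le> 2 / 2 ^ b"
    then show "mu (open_num S) \<le> 2 / 2 ^ b" using LIMSEQ_le_const2[OF lim_level[OF SE(2)]] by blast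
  next
    assume *: "mu (open_num S) \<le> 2 / 2 ^ b"
    show "\<forall>l. mu {Y. S (prefix_num Y l)} \<le> 2 / 2 ^ b"
    proof
      fix l
      have "{Y. S (prefix_num Y l)} \<subseteq> open_num S" unfolding open_num_def by blast
      then have "mu {Y. S (prefix_num Y l)} \<le> mu (open_num S)"
        by (rule cantor.finite_measure_mono) simp
      with * show "mu {Y. S (prefix_num Y l)} \<le> 2 / 2 ^ b" by linarith
    qed
  qed
  finally show ?thesis unfolding SE(1) .
qed

lemma ex_least_small: assumes b: "Univ b" shows "\<exists>k. least_small s (hierarchy a b) b k"
proof -
  define Q where "Q = (\<Inter>m. rank_class a b (node_cons m s) 0)"
  have Qs: "Q \<in> sets cantor_measure" unfolding Q_def using rank_class_sets[OF b] by auto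
  have Ds: "children_class n b \<in> sets cantor_measure" for n unfolding children_class_def using rank_class_sets[OF b] by auto
  have DQ: "Q \<subseteq> children_class n b" for n unfolding Q_def children_class_def by auto
  let ?G = "\<lambda>n. open_num (child_cover s (hierarchy a b) n b)" and ?P = "open_num (child_cocover s (hierarchy a b) b)"
  \<comment> \<open>A point of both covers lies in the error of \<open>?G n\<close>, in
    \<open>children_class n b - Q\<close>, or in \<open>Q\<close> and hence in the error of
    \<open>?P\<close>. For large \<open>n\<close> the first two terms vanish in the limit, leaving
    \<open>1 / 2 ^ b\<close>.\<close>
  have bound: "mu (?G n \<inter> ?P) \<le> 1 / 2 ^ (n + b + 1) + (mu (children_class n b) - mu Q) + 1 / 2 ^ b" for n
  proof -
    have "mu (?G n \<inter> ?P) \<le> mu (((?G n - children_class n b) \<union> (children_class n b - Q)) \<union> (?P - (- Q)))"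
      using Qs Ds by (intro cantor.finite_measure_mono) auto
    also have "\<dots> \<le> mu ((?G n - children_class n b) \<union> (children_class n b - Q)) + mu (?P - (- Q))"
      using Qs Ds by (intro measure_Un_le) auto
    also have "mu ((?G n - children_class n b) \<union> (children_class n b - Q)) \<le> mu (?G n - children_class n b) + mu (children_class n b - Q)"
      using Qs Ds by (intro measure_Un_le) auto
    also have "mu (children_class n b - Q) = mu (children_class n b) - mu Q"
      using Qs Ds DQ by (intro cantor.finite_measure_Diff) auto
    also have "mu (?G n - children_class n b) \<le> 1 / 2 ^ (n + b + 1)" using child_cover_open_cover[OF b] unfolding open_cover_def by blast
    also have "mu (?P - (- Q)) \<le> 1 / 2 ^ b" using child_cocover_open_cover[OF b] unfolding open_cover_def Q_def by blast
    finally show ?thesis by simp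
  qed
  have l1: "(\<lambda>n. mu (children_class n b)) \<longlonglongrightarrow> mu Q"
  proof -
    have "Q = (\<Inter>n. children_class n b)" unfolding Q_def children_class_def by auto
    moreover have "decseq (\<lambda>n. children_class n b)" unfolding decseq_def children_class_def by auto
    ultimately show ?thesis using cantor.finite_Lim_measure_decseq[of "\<lambda>n. children_class n b"] Ds by auto
  qed
  have l2: "(\<lambda>n. 1 / 2 ^ (n + b + 1) :: real) \<longlonglongrightarrow> 0"
    using sums_summable[OF geo_half[of b], THEN summable_LIMSEQ_zero] by (simp add: add.commute)
  have "(\<lambda>n. 1 / 2 ^ (n + b + 1) + (mu (children_class n b) - mu Q) + 1 / 2 ^ b) \<longlonglongrightarrow> 0 + (mu Q - mu Q) + 1 / 2 ^ b"
    by (intro tendsto_add tendsto_diff l1 l2 tendsto_const)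
  then have "\<forall>\<^sub>F n in sequentially. 1 / 2 ^ (n + b + 1) + (mu (children_class n b) - mu Q) + 1 / 2 ^ b < 2 / 2 ^ b"
    by (rule order_tendstoD(2)) (simp add: field_simps)
  then obtain N where "\<And>n. n \<ge> N \<Longrightarrow> 1 / 2 ^ (n + b + 1) + (mu (children_class n b) - mu Q) + 1 / 2 ^ b < 2 / 2 ^ b"
    unfolding eventually_sequentially by blast
  \<comment> \<open>The estimate applies because \<open>npair b N\<close> is at least
    \<open>N\<close>.\<close>
  from this[of "npair b N"] bound[of "npair b N"] have "small s (hierarchy a b) b N"
    unfolding small_iff[OF b] using npair_rank_le(2)[of N b] by linarith
  then have "\<exists>k. small s (hierarchy a b) b k \<and> (\<forall>j<k. \<not> small s (hierarchy a b) b j)"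
    using exists_least_iff[of "small s (hierarchy a b) b"] by blast
  then show ?thesis unfolding least_small_def by blast
qed

text \<open>The open set into which a wrong answer on \<open>b\<close> puts \<open>X\<close>:
  \<open>npair b k\<close> is in \<open>A\<close>, yet a stage \<open>c\<close> that
  \<open>b\<close> exceeds appears to suffice for the children inspected.\<close>

definition Solovay_comp :: "nat \<Rightarrow> nat \<Rightarrow> bool" where
  "Solovay_comp b p \<longleftrightarrow> (\<exists>k c. (Univ b \<and> least_small s (hierarchy a b) b k) \<and> not_rank_le b c \<and> (Univ c \<and> child_cover s (hierarchy a c) (npair b k) c p) \<and>
     (Univ b \<and> child_cocover s (hierarchy a b) b p))"

lemma Pi_pred_child_cover: "Pi_pred (\<lambda>e E. Univ (e i) \<and> child_cover s (hierarchy a (e i)) (e j) (e k) (e l))"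
  by (rule Pi_pred_hierarchy[where Q="\<lambda>H e E. child_cover s H (e j) (e k) (e l)"]) (intro Delta_pred_child_cover Delta_fun_var)+

lemma Pi_pred_least_small:
  "Pi_pred (\<lambda>e E. Univ (e i) \<and> least_small s (hierarchy a (e i)) (e i) (e j))"
  "Pi_pred (\<lambda>e E. Univ (e i) \<and> \<not> least_small s (hierarchy a (e i)) (e i) (e j))"
  using Pi_pred_hierarchy[where Q="\<lambda>H e E. least_small s H (e i) (e j)", OF Delta_pred_least_small Delta_fun_var]
    Pi_pred_hierarchy[where Q="\<lambda>H e E. \<not> least_small s H (e i) (e j)", OF Delta_pred_not[OF Delta_pred_least_small] Delta_fun_var] by auto

lemma Pi_pred_Solovay_comp: "Pi_pred (\<lambda>e E. Solovay_comp (e 0) (e (Suc 0)))"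
proof -
  have P: "Pi_pred (\<lambda>e E. Univ (e i) \<and> child_cocover s (hierarchy a (e i)) (e j) (e l))" for i j l
    by (rule Pi_pred_hierarchy[where Q="\<lambda>H e E. child_cocover s H (e j) (e l)"]) (intro Delta_pred_child_cocover Delta_fun_var)+
  have G: "Pi_pred (\<lambda>e E. Univ (e i) \<and> child_cover s (hierarchy a (e i)) (npair (e j) (e m)) (e k) (e l))" for i j k l m
    by (rule Pi_pred_hierarchy[where Q="\<lambda>H e E. child_cover s H (npair (e j) (e m)) (e k) (e l)"]) (intro Delta_pred_child_cover Delta_fun_var Delta_fun_npair)+
  show ?thesis unfolding Solovay_comp_def by (intro Pi_pred_ex Pi_pred_conj[of "\<lambda>e E. Univ (f e E) \<and> least_small s (hierarchy a (f e E)) (f e E) (g e E)" for f g]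
      Pi_pred_conj[of "\<lambda>e E. not_rank_le (f e E) (g e E)" for f g]
      Pi_pred_conj[of "\<lambda>e E. Univ (f e E) \<and> child_cover s (hierarchy a (f e E)) (h e E) (f e E) (g e E)" for f g h]
      Pi_pred_least_small Pi_pred_not_rank_le Delta_fun_var G P)
qed

text \<open>All stages \<open>c\<close> are treated at once: a stage exceeded by \<open>b\<close>
  satisfies \<open>children_class ?n c \<subseteq> children_class ?n b\<close>. Outside the errors
  \<open>Bd c\<close>, of total measure at most \<open>1 / 2 ^ ?n \<le> 1 / 2 ^ b\<close>, a point
  therefore lies in the one set that \<open>small\<close> bounds by
  \<open>2 / 2 ^ b\<close>.\<close>

lemma measure_Solovay_comp: "mu (open_num (Solovay_comp b)) \<le> 4 / 2 ^ b"
proof (cases "\<exists>k. Univ b \<and> least_small s (hierarchy a b) b k")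
  case False
  then have "open_num (Solovay_comp b) = {}" unfolding open_num_def Solovay_comp_def by blast
  then show ?thesis by simp
next
  case True
  then obtain k where b: "Univ b" and k: "least_small s (hierarchy a b) b k" by blast
  let ?n = "npair b k"
  define Bd where "Bd = (\<lambda>c. if Univ c \<and> not_rank_le b c then open_num (child_cover s (hierarchy a c) ?n c) - children_class ?n c else {})"
  have Bs: "Bd c \<in> sets cantor_measure" for c
    unfolding Bd_def using child_cover_open_cover[of c ?n] by (auto simp: open_cover_def)
  have 1: "mu (\<Union>c. Bd c) \<le> 1 / 2 ^ ?n"
  proof (rule measure_UN_geo[OF Bs])
    fix c show "mu (Bd c) \<le> 1 / 2 ^ (?n + c + 1)"
      unfolding Bd_def using child_cover_open_cover[of c ?n] by (auto simp: open_cover_def)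
  qed
  have 2: "mu (open_num (child_cover s (hierarchy a b) ?n b) \<inter> open_num (child_cocover s (hierarchy a b) b)) \<le> 2 / 2 ^ b"
    using k small_iff[OF b] unfolding least_small_def by blast
  have "open_num (Solovay_comp b) \<subseteq> (\<Union>c. Bd c) \<union> (open_num (child_cover s (hierarchy a b) ?n b) \<inter> open_num (child_cocover s (hierarchy a b) b))"
  proof
    fix Y assume "Y \<in> open_num (Solovay_comp b)"
    then obtain l k' c where *: "least_small s (hierarchy a b) b k'" "not_rank_le b c" "Univ c" "child_cover s (hierarchy a c) (npair b k') c (prefix_num Y l)"
      "child_cocover s (hierarchy a b) b (prefix_num Y l)" unfolding open_num_def Solovay_comp_def by blast
    have k': "k' = k" using least_small_unique[OF *(1) k] .
    have "children_class ?n c \<subseteq> children_class ?n b" unfolding children_class_def using rank_le_mono_rank_class[OF b *(3,2)] by blast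
    also have "\<dots> \<subseteq> open_num (child_cover s (hierarchy a b) ?n b)" using child_cover_open_cover[OF b, of ?n] unfolding open_cover_def by blast
    finally have "children_class ?n c \<subseteq> open_num (child_cover s (hierarchy a b) ?n b)" .
    moreover have "Y \<in> open_num (child_cover s (hierarchy a c) ?n c)" "Y \<in> open_num (child_cocover s (hierarchy a b) b)"
      using * unfolding open_num_def k' by blast+
    ultimately show "Y \<in> (\<Union>c. Bd c) \<union> (open_num (child_cover s (hierarchy a b) ?n b) \<inter> open_num (child_cocover s (hierarchy a b) b))"
      unfolding Bd_def using *(2,3) by auto
  qed
  then have "mu (open_num (Solovay_comp b)) \<le> mu ((\<Union>c. Bd c) \<union> (open_num (child_cover s (hierarchy a b) ?n b) \<inter> open_num (child_cocover s (hierarchy a b) b)))"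
    using Bs by (intro cantor.finite_measure_mono) auto
  also have "\<dots> \<le> mu (\<Union>c. Bd c) + mu (open_num (child_cover s (hierarchy a b) ?n b) \<inter> open_num (child_cocover s (hierarchy a b) b))"
    using Bs by (intro measure_Un_le) auto
  also have "\<dots> \<le> 1 / 2 ^ ?n + 2 / 2 ^ b" using 1 2 by simp
  also have "1 / 2 ^ ?n \<le> (1 / 2 ^ b :: real)"
    using npair_rank_le(1)[of b k] by (intro divide_left_mono power_increasing) auto
  finally show ?thesis by (simp add: field_simps)
qed

end

theorem theorem5p1:
  fixes X :: cantor
  assumes "Pi11_ML_random X"
    and "\<not> Pi11_random X"
  shows "\<exists>A :: nat set. Pi11_set A \<and> \<not> Delta11_set A \<and> hT_computes X A"
proof -
  obtain C where C: "Pi11_class C" "C \<in> null_sets (completion cantor_measure)" "X \<in> C"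
    using assms(2) unfolding Pi11_random_def by blast
  obtain \<phi> where \<phi>: "C = {X. \<forall>Y. sat (\<lambda>_. 0) (two_sets Y X) \<phi>}" using C(1) unfolding Pi11_class_def by blast
  obtain n0 where n0: "form_of n0 = \<phi>" using form_of_surj by blast
  \<comment> \<open>The second component 0 codes the zero environment prescribed by
    \<open>Pi11_class\<close>.\<close>
  define a where "a = npair n0 0"
  have Ca: "Y \<in> C \<longleftrightarrow> wf_node (univ_tree a Y) 0" for Y
    unfolding wf_node_iff_no_path univ_tree_path_iff \<phi> by (simp add: a_def n0)
  have notin: "X \<notin> rank_class a b 0 0" if b: "Univ b" for b
  proof
    assume X: "X \<in> rank_class a b 0 0"
    have "rank_class a b 0 0 \<subseteq> C" unfolding rank_class_def using Ca rank_le_wf_node by blast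
    then have "rank_class a b 0 0 \<in> null_sets (completion cantor_measure)"
      using C(2) null_sets_completion_subset by blast
    then have "emeasure cantor_measure (rank_class a b 0 0) = 0"
      using emeasure_completion[of "rank_class a b 0 0" cantor_measure] rank_class_sets[OF b] by (simp add: null_sets_def main_part_sets)
    then have 0: "mu (rank_class a b 0 0) = 0" by (simp add: measure_def)
    \<comment> \<open>The covers of a null class form a Martin-Loef test, since their measure is
      just their error. The conjunct \<open>Univ b\<close> brings \<open>S\<close> into the form of
      \<open>Pi_pred_hierarchy\<close>.\<close>
    define S where "S = (\<lambda>k p. Univ b \<and> hierarchy a b (cover_index 0 0 0 k p))"
    have "\<exists>k. X \<notin> open_num (S k)"
    proof (rule avoids_test[OF assms(1)])
      show "Pi_pred (\<lambda>e E. S (e 0) (e (Suc 0)))" unfolding S_def cover_index_def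
        by (rule Pi_pred_hierarchy[where Q="\<lambda>H e E. H (npair 0 (npair 0 (npair 0 (npair (e 0) (e (Suc 0))))))"]) (intro definability_rules)+
      fix k
      have A: "open_cover (S k) (rank_class a b 0 0) (1 / 2 ^ k)" unfolding S_def using hierarchy_open_cover[OF b] b by simp
      have "mu (open_num (S k)) \<le> mu ((open_num (S k) - rank_class a b 0 0) \<union> rank_class a b 0 0)"
        using rank_class_sets[OF b] by (intro cantor.finite_measure_mono) auto
      also have "\<dots> \<le> mu (open_num (S k) - rank_class a b 0 0) + mu (rank_class a b 0 0)"
        using rank_class_sets[OF b] by (intro measure_Un_le) auto
      finally show "mu (open_num (S k)) \<le> 1 / 2 ^ k" using A 0 unfolding open_cover_def by linarith
    qed
    moreover have "X \<in> open_num (S k)" for k using hierarchy_open_cover[OF b, of a 0 0 k] b X unfolding S_def open_cover_def by auto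
    ultimately show False by blast
  qed
  obtain s where s1: "\<And>b. Univ b \<Longrightarrow> X \<notin> rank_class a b s 0" and s2: "\<And>n. \<exists>b. Univ b \<and> X \<in> rank_class a b (node_cons n s) 0"
    using minimal_node[OF _ notin] C(3) Ca by metis
  define A where "A = {i. \<exists>b k. i = npair b k \<and> (Univ b \<and> least_small s (hierarchy a b) b k)}"
  have PA: "Pi_pred (\<lambda>e E. e 0 \<in> A)"
    unfolding A_def mem_Collect_eq
    by (rule Pi_pred_ex, rule Pi_pred_ex, rule Pi_pred_conj, rule Delta_pred_Pi_pred, intro definability_rules, rule Pi_pred_least_small)
  have "Pi11_set A" using Pi11_set_Pi_pred[OF PA] by simp
  have "\<not> Delta11_set A"
  proof
    assume "Delta11_set A"
    then have "Pi11_set (- A)" unfolding Delta11_set_def by blast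
    then have n: "Pi_pred (\<lambda>e E. e 0 \<in> - A)" by (rule Pi_pred_Pi11_set)
    \<comment> \<open>A number quantifier preserves Pi^1_1, so the complement of the projection of
      \<open>A\<close>, hence of \<open>Univ\<close>, would be Pi^1_1 too.\<close>
    have "Pi_pred (\<lambda>e E. \<forall>k. npair (e 0) k \<in> - A)"
      by (rule Pi_pred_all, rule Pi_pred_comp1[OF n]) (intro definability_rules)
    from Pi11_set_Pi_pred[OF this] have "Pi11_set {b. \<forall>k. npair b k \<notin> A}" by simp
    moreover have "(\<forall>k. npair b k \<notin> A) \<longleftrightarrow> \<not> Univ b" for b
      unfolding A_def using ex_least_small by auto
    ultimately show False using Univ_not_Delta by simp
  qed
  have fin: "finite {b. X \<in> open_num (Solovay_comp a s b)}"
    by (rule finite_Solovay_test[OF assms(1) Pi_pred_Solovay_comp measure_Solovay_comp])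
  \<comment> \<open>Finitely many exceptional \<open>b\<close> give finitely many exceptional
    numbers, as \<open>least_small\<close> determines \<open>k\<close>.\<close>
  have "\<exists>N. \<forall>b k. X \<in> open_num (Solovay_comp a s b) \<longrightarrow> least_small s (hierarchy a b) b k \<longrightarrow> npair b k < N"
  proof -
    have "{npair b k | b k. X \<in> open_num (Solovay_comp a s b) \<and> least_small s (hierarchy a b) b k} \<subseteq>
      (\<lambda>b. npair b (THE k. least_small s (hierarchy a b) b k)) ` {b. X \<in> open_num (Solovay_comp a s b)}"
    proof
      fix z assume "z \<in> {npair b k | b k. X \<in> open_num (Solovay_comp a s b) \<and> least_small s (hierarchy a b) b k}"
      then obtain b k where *: "z = npair b k" "X \<in> open_num (Solovay_comp a s b)" "least_small s (hierarchy a b) b k" by blast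
      then have "(THE k. least_small s (hierarchy a b) b k) = k" using least_small_unique by (intro the_equality) blast+
      then show "z \<in> (\<lambda>b. npair b (THE k. least_small s (hierarchy a b) b k)) ` {b. X \<in> open_num (Solovay_comp a s b)}" using * by blast
    qed
    then have "finite {npair b k | b k. X \<in> open_num (Solovay_comp a s b) \<and> least_small s (hierarchy a b) b k}"
      using fin finite_subset by blast
    then obtain N where "\<forall>z \<in> {npair b k | b k. X \<in> open_num (Solovay_comp a s b) \<and> least_small s (hierarchy a b) b k}. z < N"
      using finite_nat_set_iff_bounded by blast
    then show ?thesis by blast
  qed
  then obtain N where N: "\<And>b k. X \<in> open_num (Solovay_comp a s b) \<Longrightarrow> least_small s (hierarchy a b) b k \<Longrightarrow> npair b k < N" by blast
  \<comment> \<open>Below \<open>N\<close> a finite table answers. From \<open>N\<close> on,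
    \<open>i\<close> is rejected either because \<open>b\<close> is not below the stage
    \<open>c\<close>, or because \<open>b\<close> is in \<open>Univ\<close> and \<open>k\<close> is
    not the right one. The second kind of rejection is always correct; only the first can
    err.\<close>
  define P0 where "P0 = (\<lambda>p i. i \<in> {i. i < N \<and> i \<notin> A} \<or> (N \<le> i \<and> (\<exists>b k c. i = npair b k \<and> (Univ c \<and> child_cover s (hierarchy a c) i c p) \<and>
     (not_rank_le b c \<or> (Univ b \<and> \<not> least_small s (hierarchy a b) b k)))))"
  have "hT_computes X A"
  proof (rule hT_computesI[where ?P1.0="\<lambda>i. i \<in> A" and ?P0.0=P0])
    show "Pi_pred (\<lambda>e E. e 0 \<in> A)" by (rule PA)
    show "Pi_pred (\<lambda>e E. P0 (e 0) (e (Suc 0)))"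
      unfolding P0_def
      apply (rule Pi_pred_disj, rule Delta_pred_Pi_pred, rule Delta_pred_finite, simp, rule Delta_fun_var)
      apply (rule Pi_pred_conj, rule Delta_pred_Pi_pred, intro definability_rules)
      apply (rule Pi_pred_ex, rule Pi_pred_ex, rule Pi_pred_ex)
      apply (rule Pi_pred_conj, rule Delta_pred_Pi_pred, intro definability_rules)
      apply (rule Pi_pred_conj, rule Pi_pred_child_cover, rule Pi_pred_disj, intro Pi_pred_not_rank_le Delta_fun_var, rule Pi_pred_least_small)
      done
    show "i \<in> A \<longleftrightarrow> i \<in> A" for i ..
    show "i \<notin> A" if P: "P0 (prefix_num X l) i" for l i
    proof
      assume i: "i \<in> A"
      then obtain b k c where *: "i = npair b k" "Univ c" "child_cover s (hierarchy a c) i c (prefix_num X l)" "N \<le> i"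
         "not_rank_le b c \<or> (Univ b \<and> \<not> least_small s (hierarchy a b) b k)"
        using P unfolding P0_def by blast
      then have b: "Univ b" "least_small s (hierarchy a b) b k" using i unfolding A_def by auto
      have "X \<in> open_num (child_cocover s (hierarchy a b) b)"
        using child_cocover_open_cover[OF b(1), of s a] not_in_all_children[OF s1 b(1)] unfolding open_cover_def by blast
      moreover have "X \<in> open_num (child_cover s (hierarchy a c) i c)" using *(3) unfolding open_num_def by blast
      moreover have "ext_closed (child_cocover s (hierarchy a b) b)" "ext_closed (child_cover s (hierarchy a c) i c)"
        using child_cocover_open_cover[OF b(1), of s a] child_cover_open_cover[OF *(2), of s a] unfolding open_cover_def by blast+
      \<comment> \<open>\<open>Solovay_comp\<close> asks for one prefix of \<open>X\<close> in both
        covers; closure under extension provides it.\<close>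
      ultimately have "X \<in> open_num (\<lambda>p. child_cover s (hierarchy a c) i c p \<and> child_cocover s (hierarchy a b) b p)" using open_num_conj by blast
      then have "X \<in> open_num (Solovay_comp a s b)" using * b unfolding open_num_def Solovay_comp_def by blast
      then show False using N[OF _ b(2)] *(1,4) by simp
    qed
    show "P0 (prefix_num X m) i" if P: "P0 (prefix_num X l) i" and "l \<le> m" for l m i
    proof -
      have "child_cover s (hierarchy a c) i c (prefix_num X m)" if "Univ c" "child_cover s (hierarchy a c) i c (prefix_num X l)" for c
        using ext_closed_prefix_num[of "child_cover s (hierarchy a c) i c" X l m] that \<open>l \<le> m\<close> child_cover_open_cover[OF that(1), of s a] unfolding open_cover_def by blast
      then show ?thesis using P unfolding P0_def by blast
    qed
    show "\<exists>l. P0 (prefix_num X l) i" if i: "i \<notin> A" for i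
    proof (cases "i < N")
      case True
      then show ?thesis using i unfolding P0_def by blast
    next
      case False
      obtain c where c: "Univ c" "\<forall>m\<le>i. X \<in> rank_class a c (node_cons m s) 0"
        using rank_class_chain[where g="\<lambda>n. node_cons n s", OF s2] by blast
      then have "X \<in> children_class a s i c" unfolding children_class_def by blast
      then have "X \<in> open_num (child_cover s (hierarchy a c) i c)" using child_cover_open_cover[OF c(1), of s a i] unfolding open_cover_def by blast
      then obtain l where l: "child_cover s (hierarchy a c) i c (prefix_num X l)" unfolding open_num_def by blast
      obtain b k where bk: "i = npair b k" using npair_surj by blast
      \<comment> \<open>If \<open>b\<close> is in \<open>Univ\<close>, then \<open>k\<close> must be
        wrong, as \<open>i\<close> is not in \<open>A\<close>. Otherwise the tree of
        \<open>b\<close> is ill-founded and below no well-founded tree.\<close>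
      have "not_rank_le b c \<or> (Univ b \<and> \<not> least_small s (hierarchy a b) b k)"
      proof (cases "Univ b")
        case True
        then show ?thesis using i unfolding A_def bk by blast
      next
        case False
        then show ?thesis using not_rank_le_iff[OF c(1)] rank_le_wf_node unfolding Univ_def by blast
      qed
      then have "P0 (prefix_num X l) i" unfolding P0_def using False c(1) l bk by (metis not_le_imp_less)
      then show ?thesis ..
    qed
  qed
  then show ?thesis using \<open>Pi11_set A\<close> \<open>\<not> Delta11_set A\<close> by blast
qed

end
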